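(* Let $a,b,c>2$ be real numbers satisfying $a^2+b^2+c^2=abc$. Let $X$ be the complete hyperbolic once-punctured torus determined by $(a,b,c)$, and let $\gamma_1,\gamma_2,\gamma_3$ be the corresponding simple closed geodesics on $X$, which pairwise intersect in a single point and have traces $t(\gamma_1)=a$, $t(\gamma_2)=b$, $t(\gamma_3)=c$, where $t(\gamma)=2\cosh(l(\gamma)/2)$ and $l(\gamma)$ is the length of $\gamma$. Let $h(\gamma)=h(\gamma;\{\gamma_1,\gamma_2,\gamma_3\})$ be the positive integer height of a simple closed geodesic $\gamma$ relative to this triple (defined in the context). Then $$ \prod_{\gamma}\left(\frac{t(\gamma)^2}{t(\gamma)^2-4}\right)^{h(\gamma)}=\frac{a+\sqrt{a^2-4}}{2}\cdot\frac{b+\sqrt{b^2-4}}{2}\cdot\frac{c+\sqrt{c^2-4}}{2}, $$ or equivalently $$ \prod_{\gamma}\left(\frac{e^{l(\gamma)}+1}{e^{l(\gamma)}-1}\right)^{2h(\gamma)}=\exp\left(\frac{l(\gamma_1)+l(\gamma_2)+l(\gamma_3)}{2}\right), $$ where both products run over all (unoriented) simple closed geodesics $\gamma$ on $X$.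
   Context: A triple $(a,b,c)$ with $a,b,c>2$ and $a^2+b^2+c^2=abc$ determines a marked complete hyperbolic once-punctured torus $X=G\backslash\mathbb{H}$, where $G=\langle A,B\rangle\subseteq SL_2(\mathbb{R})$ is free on two generators $A,B$, the commutator $ABA^{-1}B^{-1}$ has trace $-2$, and the traces of $A$, $B$, $AB$ are the given numbers in some order; all such marked surfaces arise this way. The trace of a closed geodesic $\gamma$ of length $l(\gamma)$ is $t(\gamma)=2\cosh(l(\gamma)/2)$. Traces and heights on the topograph. The unoriented simple closed geodesics on $X$ are in bijection with $P^1(\mathbb{Q})$ (primitive vectors $(p,q)\in\mathbb{Z}^2$ up to sign), with $\gamma_1,\gamma_2,\gamma_3$ corresponding to $0/1$, $1/1$, $1/0$ respectively. Equivalently, they are in bijection with the complementary regions of the infinite 3-regular tree embedded in the plane, with $\gamma_1,\gamma_2,\gamma_3$ the three regions meeting at a chosen vertex $v_0$. Direct all edges away from $v_0$. Traces: the three regions at $v_0$ have traces $a,b,c$. For every directed edge $e$, the region at the target of $e$ has trace $xy-z$, where $x,y$ are the traces of the two regions to the left and right of $e$ and $z$ is the trace of the region at the source of $e$. In terms of $P^1(\mathbb{Q})$: $t(0/1)=a$, $t(1/1)=b$, $t(1/0)=c$, and $t(v+w)+t(v-w)=t(v)t(w)$ for every basis $v,w$ of $\mathbb{Z}^2$. Heights: the three regions at $v_0$ have height $1$. For every directed edge $e$, the region at the target of $e$ has height equal to the sum of the heights of the two regions to the left and right of $e$. In terms of $P^1(\mathbb{Q})$, with $p,q$ coprime integers,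 $h([p:q])=\max\{|p|,|q|,|p-q|\}$. *)

theory Defs
  imports "HOL-Analysis.Analysis"
begin

section \<open>The hyperbolic plane\<close>

definition upper_half_plane :: "complex set" where
  "upper_half_plane = {z. Im z > 0}"

definition hyp_dist :: "complex \<Rightarrow> complex \<Rightarrow> real" where
  "hyp_dist z w = arcosh (1 + (cmod (z - w))\<^sup>2 / (2 * Im z * Im w))"

text \<open>Complete geodesics of the hyperbolic plane, parametrised by arc length over the whole line.\<close>

definition geodesic_line :: "(real \<Rightarrow> complex) \<Rightarrow> bool" where
  "geodesic_line c \<longleftrightarrow>
     (\<forall>s. c s \<in> upper_half_plane) \<and> (\<forall>s t. hyp_dist (c s) (c t) = \<bar>s - t\<bar>)"

definition mat_act :: "real^2^2 \<Rightarrow> complex \<Rightarrow> complex" where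
  "mat_act M = moebius (of_real (M $ 1 $ 1)) (of_real (M $ 1 $ 2))
                       (of_real (M $ 2 $ 1)) (of_real (M $ 2 $ 2))"


section \<open>Marked once-punctured tori\<close>

text \<open>A word is a list of letters; \<open>(x, True)\<close> stands for the generator \<open>x\<close>
  and \<open>(x, False)\<close> for its inverse.\<close>

datatype gen = GenA | GenB

type_synonym word = "(gen \<times> bool) list"

fun letter_mat :: "real^2^2 \<Rightarrow> real^2^2 \<Rightarrow> gen \<times> bool \<Rightarrow> real^2^2" where
  "letter_mat A B (GenA, e) = (if e then A else matrix_inv A)"
| "letter_mat A B (GenB, e) = (if e then B else matrix_inv B)"

fun word_mat :: "real^2^2 \<Rightarrow> real^2^2 \<Rightarrow> word \<Rightarrow> real^2^2" where
  "word_mat A B [] = mat 1"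
| "word_mat A B (x # w) = letter_mat A B x ** word_mat A B w"

definition reduced :: "word \<Rightarrow> bool" where
  "reduced w \<longleftrightarrow> successively (\<lambda>x y. \<not> (fst x = fst y \<and> snd x \<noteq> snd y)) w"

definition exponent_sum :: "gen \<Rightarrow> word \<Rightarrow> int" where
  "exponent_sum g w = (\<Sum>(x, e)\<leftarrow>w. if x = g then (if e then 1 else -1) else 0)"

definition gen_group :: "real^2^2 \<Rightarrow> real^2^2 \<Rightarrow> (real^2^2) set" where
  "gen_group A B = range (word_mat A B)"

definition free_on :: "real^2^2 \<Rightarrow> real^2^2 \<Rightarrow> bool" where
  "free_on A B \<longleftrightarrow> (\<forall>w. reduced w \<and> word_mat A B w = mat 1 \<longrightarrow> w = [])"

text \<open>The quotient of the upper half plane by \<open>gen_group A B\<close> is then a complete hyperbolic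
  once-punctured torus, marked by the pair \<open>A, B\<close>.\<close>

definition marked_punctured_torus :: "real^2^2 \<Rightarrow> real^2^2 \<Rightarrow> bool" where
  "marked_punctured_torus A B \<longleftrightarrow>
     det A = 1 \<and> det B = 1 \<and> free_on A B \<and>
     trace (A ** B ** matrix_inv A ** matrix_inv B) = -2"


section \<open>Closed geodesics on the quotient surface\<close>

text \<open>The quotient map of the upper half plane onto \<open>G\<close>-orbits; the points of the surface are
  the orbits \<open>quot_map G z\<close>.\<close>

definition quot_map :: "(real^2^2) set \<Rightarrow> complex \<Rightarrow> complex set" where
  "quot_map G z = (\<lambda>g. mat_act g z) ` G"

text \<open>The projection of the line \<open>c\<close> to the surface closes up smoothly after time \<open>l\<close>, and \<open>g\<close>
  is the deck transformation belonging to this loop.\<close>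

definition closes_up :: "(real^2^2) set \<Rightarrow> (real \<Rightarrow> complex) \<Rightarrow> real \<Rightarrow> real^2^2 \<Rightarrow> bool" where
  "closes_up G c l g \<longleftrightarrow>
     geodesic_line c \<and> l > 0 \<and> g \<in> G \<and> (\<forall>s. mat_act g (c s) = c (s + l))"

definition loop_image :: "(real^2^2) set \<Rightarrow> (real \<Rightarrow> complex) \<Rightarrow> real \<Rightarrow> complex set set" where
  "loop_image G c l = (\<lambda>s. quot_map G (c s)) ` {0..<l}"

definition simple_loop :: "(real^2^2) set \<Rightarrow> (real \<Rightarrow> complex) \<Rightarrow> real \<Rightarrow> real^2^2 \<Rightarrow> bool" where
  "simple_loop G c l g \<longleftrightarrow>
     closes_up G c l g \<and> inj_on (\<lambda>s. quot_map G (c s)) {0..<l}"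

text \<open>Unoriented simple closed geodesics are identified with their images in the surface.\<close>

definition simple_closed_geodesics :: "(real^2^2) set \<Rightarrow> complex set set set" where
  "simple_closed_geodesics G = {loop_image G c l | c l g. simple_loop G c l g}"

definition geod_length :: "(real^2^2) set \<Rightarrow> complex set set \<Rightarrow> real" where
  "geod_length G C = (THE l. \<exists>c g. simple_loop G c l g \<and> C = loop_image G c l)"

definition geod_trace :: "(real^2^2) set \<Rightarrow> complex set set \<Rightarrow> real" where
  "geod_trace G C = 2 * cosh (geod_length G C / 2)"

text \<open>The image in the surface of the axis of a hyperbolic element \<open>g\<close> of \<open>G\<close>.\<close>

definition geod_of :: "(real^2^2) set \<Rightarrow> real^2^2 \<Rightarrow> complex set set" where
  "geod_of G g = {quot_map G (c s) | c l s. closes_up G c l g}"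


section \<open>Heights\<close>

text \<open>The point \<open>[p:q]\<close> of the rational projective line belonging to a simple closed geodesic is
  its homology class up to sign, with respect to the basis of the abelianised group in which
  \<open>A\<close> is \<open>(1,0)\<close> and \<open>B\<close> is \<open>(0,1)\<close>. Hence the geodesics of \<open>B\<close>, \<open>A ** B\<close> and \<open>A\<close>
  belong to \<open>0/1\<close>, \<open>1/1\<close> and \<open>1/0\<close>.\<close>

definition has_slope :: "real^2^2 \<Rightarrow> real^2^2 \<Rightarrow> complex set set \<Rightarrow> int \<Rightarrow> int \<Rightarrow> bool" where
  "has_slope A B C p q \<longleftrightarrow>
     (\<exists>c l w. simple_loop (gen_group A B) c l (word_mat A B w) \<and>
              C = loop_image (gen_group A B) c l \<and>
              p = exponent_sum GenA w \<and> q = exponent_sum GenB w)"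

definition height :: "real^2^2 \<Rightarrow> real^2^2 \<Rightarrow> complex set set \<Rightarrow> nat" where
  "height A B C = (THE n. \<exists>p q. has_slope A B C p q \<and> int n = Max {\<bar>p\<bar>, \<bar>q\<bar>, \<bar>p - q\<bar>})"


section \<open>Products over sets\<close>

text \<open>Unconditional convergence of a product to \<open>L\<close>; the multiplicative analogue
  of \<open>has_sum\<close>.\<close>

definition has_prod_over :: "('a \<Rightarrow> real) \<Rightarrow> 'a set \<Rightarrow> real \<Rightarrow> bool" where
  "has_prod_over f S L \<longleftrightarrow> ((\<lambda>F. prod f F) \<longlongrightarrow> L) (finite_subsets_at_top S)"

end

theory Submission
  imports Defs
begin

text \<open>The product runs over the simple closed geodesics of the surface, so the proof has a geometric part,
  which lists these geodesics, and an analytic part, which sums the logarithms of the factors over the list.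

  The group is free and acts by ping-pong. The commutator has trace \<open>-2\<close>; its fixed vector and the
  images of this vector under the generators are the vertices of an ideal quadrilateral whose sides are
  paired by the generators (\<open>ex_ideal_quad\<close>). A reduced word maps the boundary arcs cut off by the sides
  into one another (\<open>word_maps\<close>). This shows that the action is free (\<open>fixes_point\<close>), locates
  the end points of the axis of every cyclically reduced word (\<open>endpoints\<close>), and shows that the axes of
  the two generators project to simple closed geodesics that meet exactly once (\<open>axes_meet\<close>).

  Conversely, the axis of a simple closed geodesic does not cross its translates, and crossing is a sign condition on
  the end points (\<open>link\<close>). If the word contained a letter and its inverse, the shifts of its axis would
  cut off all four corners of the quadrilateral, and the shift closest to a cusp would turn around this
  cusp for ever (\<open>not_all_cusps_cut\<close>). Hence, up to inversion, the word is positive in \<open>A\<close>, \<open>B\<close> or in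
  \<open>B\<close> and the inverse of \<open>A\<close>. In a positive word at most one of the two letters is repeated, so it can be rewritten
  as a shorter word in a new basis (\<open>descend\<close>). The changes of basis are the steps of the infinite tree, and it follows
  that the simple closed geodesics are exactly the regions of this tree (\<open>classification\<close>). Slopes, which are well
  defined because the group is free, separate the regions and give their heights.

  For the summation, the traces of the regions adjacent to a region of trace \<open>t\<close> are \<open>\<alpha> \<mu>\<^sup>n + \<beta> \<mu>\<^sup>-\<^sup>n\<close> with
  \<open>\<alpha> \<beta> = t\<^sup>2 / (t\<^sup>2 - 4)\<close>. So the logarithm of a factor splits into one contribution for each of the two
  directions around its region, and the contributions telescope along the tree: the sum over the sector
  beyond an edge has the closed form \<open>sector_value\<close>, linear in the two heights at the edge (\<open>sector_value_rec\<close>). Along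
  edges with non-decreasing traces the remainder of the sum is at most a constant times the next layer of a series with bounded
  partial sums, so it tends to zero (\<open>uphill_sum\<close>); the other edges reduce to these in finitely many steps.
  Adding the three sectors at the initial vertex gives the formula (\<open>log_formula\<close>).\<close>

section \<open>Plane linear algebra and the upper half plane\<close>

text \<open>The area form. It vanishes exactly on proportional vectors, so it decides equality of boundary points, and
  its signs describe their cyclic order.\<close>

definition wedge :: "real^2 \<Rightarrow> real^2 \<Rightarrow> real" where
  "wedge x y = x$1 * y$2 - x$2 * y$1"

lemma mv_nth: "(M *v x)$1 = M$1$1 * x$1 + M$1$2 * x$2" "(M *v x)$2 = M$2$1 * x$1 + M$2$2 * x$2"
  for M :: "real^2^2"
  by (simp_all add: matrix_vector_mult_def sum_2)

lemma mm_nth: "(M ** N)$1$1 = M$1$1 * N$1$1 + M$1$2 * N$2$1"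
  "(M ** N)$1$2 = M$1$1 * N$1$2 + M$1$2 * N$2$2"
  "(M ** N)$2$1 = M$2$1 * N$1$1 + M$2$2 * N$2$1"
  "(M ** N)$2$2 = M$2$1 * N$1$2 + M$2$2 * N$2$2"
  for M N :: "real^2^2"
  by (simp_all add: matrix_matrix_mult_def sum_2)

lemma vec2_eq_iff: "x = y \<longleftrightarrow> x$1 = y$1 \<and> x$2 = y$2" for x y :: "'a^2"
  by (simp add: vec_eq_iff forall_2)

lemma trace_2: "trace M = M$1$1 + M$2$2" for M :: "real^2^2"
  by (simp add: trace_def sum_2)

lemma wedge_scaleR [simp]: "wedge (c *\<^sub>R x) y = c * wedge x y" "wedge x (c *\<^sub>R y) = c * wedge x y"
  by (simp_all add: wedge_def algebra_simps)

lemma wedge_add: "wedge (x + x') y = wedge x y + wedge x' y" "wedge x (y + y') = wedge x y + wedge x y'"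
  by (simp_all add: wedge_def algebra_simps)

lemma wedge_minus [simp]: "wedge (- x) y = - wedge x y" "wedge x (- y) = - wedge x y"
  by (simp_all add: wedge_def algebra_simps)

lemma wedge_self [simp]: "wedge x x = 0"
  by (simp add: wedge_def)

lemma wedge_0 [simp]: "wedge 0 x = 0" "wedge x 0 = 0"
  by (simp_all add: wedge_def)

lemma wedge_commute: "wedge x y = - wedge y x"
  by (simp add: wedge_def)

lemma wedge_mult: "wedge (M *v x) (M *v y) = det M * wedge x y"
  unfolding wedge_def mv_nth det_2 by algebra

lemma wedge_mult1: "det M = 1 \<Longrightarrow> wedge (M *v x) (M *v y) = wedge x y"
  by (simp add: wedge_mult)

text \<open>All statements about the cyclic order of four boundary points rest on this relation.\<close>

lemma wedge_plucker: "wedge a b * wedge c d - wedge a c * wedge b d + wedge a d * wedge b c = 0"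
  unfolding wedge_def by algebra

lemma wedge_expand: "wedge u v *\<^sub>R x = wedge x v *\<^sub>R u + wedge u x *\<^sub>R v"
  by (simp add: vec2_eq_iff wedge_def) algebra

lemma wedge_trace: "trace M * wedge x y = wedge (M *v x) y + wedge x (M *v y)"
  unfolding wedge_def mv_nth trace_2 by algebra

lemma wedge_eq_0_imp:
  assumes "wedge x y = 0" "x \<noteq> 0"
  obtains c where "y = c *\<^sub>R x"
proof -
  have *: "x$1 * y$2 = x$2 * y$1" using assms by (simp add: wedge_def)
  show ?thesis
  proof (cases "x$1 = 0")
    case True
    then have "x$2 \<noteq> 0" using assms by (auto simp: vec2_eq_iff)
    then show ?thesis using * True by (intro that[of "y$2/x$2"]) (auto simp: vec2_eq_iff field_simps)
  next
    case False
    then show ?thesis using * by (intro that[of "y$1/x$1"]) (auto simp: vec2_eq_iff field_simps)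
  qed
qed

lemma mat_eq_basis:
  fixes M N :: "real^2^2"
  assumes "wedge u v \<noteq> 0" "M *v u = N *v u" "M *v v = N *v v"
  shows "M = N"
proof -
  have "M *v x = N *v x" for x
  proof -
    have x: "x = (wedge x v / wedge u v) *\<^sub>R u + (wedge u x / wedge u v) *\<^sub>R v"
      using arg_cong[OF wedge_expand[of u v x], of "\<lambda>z. (1 / wedge u v) *\<^sub>R z"] assms(1)
      by (simp add: scaleR_add_right)
    show ?thesis
      by (subst (1 2) x) (simp add: matrix_vector_right_distrib matrix_vector_mult_scaleR assms)
  qed
  then show ?thesis by (simp add: matrix_eq)
qed

lemma det1_inv:
  fixes M :: "real^2^2"
  assumes "det M = 1"
  shows "M ** matrix_inv M = mat 1" "matrix_inv M ** M = mat 1" "det (matrix_inv M) = 1"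
proof -
  have "invertible M" using assms by (simp add: invertible_det_nz)
  then have "\<exists>A'. M ** A' = mat 1 \<and> A' ** M = mat 1" by (simp add: invertible_def)
  then have *: "M ** matrix_inv M = mat 1 \<and> matrix_inv M ** M = mat 1"
    unfolding matrix_inv_def by (rule someI_ex)
  then show "M ** matrix_inv M = mat 1" "matrix_inv M ** M = mat 1" by auto
  then have "det M * det (matrix_inv M) = 1" by (metis det_mul det_I)
  then show "det (matrix_inv M) = 1" using assms by simp
qed

lemma matrix_inv_unique2:
  fixes M N :: "real^2^2"
  assumes "det M = 1" "M ** N = mat 1"
  shows "matrix_inv M = N"
  by (metis assms det1_inv(2) matrix_mul_assoc matrix_mul_lid matrix_mul_rid)

lemma matrix_inv_inv:
  fixes M :: "real^2^2"
  assumes "det M = 1"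
  shows "matrix_inv (matrix_inv M) = M"
  by (rule matrix_inv_unique2) (simp_all add: assms det1_inv)

lemma matrix_inv_entries:
  fixes M :: "real^2^2"
  assumes "det M = 1"
  shows "matrix_inv M $1$1 = M$2$2" "matrix_inv M $1$2 = - M$1$2"
    "matrix_inv M $2$1 = - M$2$1" "matrix_inv M $2$2 = M$1$1"
proof -
  define N :: "real^2^2" where "N = vector [vector [M$2$2, - M$1$2], vector [- M$2$1, M$1$1]]"
  have "M ** N = mat 1"
    using assms by (simp add: vec2_eq_iff mm_nth N_def mat_def det_2 algebra_simps)
  then have "matrix_inv M = N" using assms by (rule matrix_inv_unique2[rotated])
  then show "matrix_inv M $1$1 = M$2$2" "matrix_inv M $1$2 = - M$1$2"
    "matrix_inv M $2$1 = - M$2$1" "matrix_inv M $2$2 = M$1$1" by (simp_all add: N_def)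
qed

lemma trace_matrix_inv: "det M = 1 \<Longrightarrow> trace (matrix_inv M) = trace M" for M :: "real^2^2"
  by (simp add: trace_2 matrix_inv_entries)

lemma inv_mv:
  fixes M :: "real^2^2"
  assumes "det M = 1"
  shows "matrix_inv M *v (M *v x) = x" "M *v (matrix_inv M *v x) = x"
  by (simp_all add: matrix_vector_mul_assoc det1_inv assms)


text \<open>A vector \<open>u + \<i> v\<close> of the complexified plane represents a point of the projective line
  over the complex numbers. This encoding keeps the action of matrices linear and
  puts the real boundary on the same footing as the interior.\<close>

definition proj_pt :: "real^2 \<Rightarrow> real^2 \<Rightarrow> complex" where
  "proj_pt u v = Complex (u$1) (v$1) / Complex (u$2) (v$2)"

lemma proj_pt_denom_nz: "wedge v u \<noteq> 0 \<Longrightarrow> Complex (u$2) (v$2) \<noteq> 0"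
  by (auto simp: wedge_def complex_eq_iff)

lemma Im_proj_pt: "Im (proj_pt u v) = wedge v u / ((u$2)\<^sup>2 + (v$2)\<^sup>2)"
  by (simp add: proj_pt_def Im_divide wedge_def power2_eq_square algebra_simps)

lemma proj_pt_in_H: "wedge v u > 0 \<Longrightarrow> proj_pt u v \<in> upper_half_plane"
  using proj_pt_denom_nz[of v u]
  by (auto simp: upper_half_plane_def Im_proj_pt complex_eq_iff sum_power2_gt_zero_iff intro!: divide_pos_pos)

lemma ex_proj_pt:
  assumes "z \<in> upper_half_plane"
  obtains u v where "wedge v u = 1" "z = proj_pt u v"
proof -
  have y: "Im z > 0" using assms by (simp add: upper_half_plane_def)
  define r where "r = sqrt (Im z)"
  have r: "r > 0" "r * r = Im z" using y by (simp_all add: r_def)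
  show ?thesis
  proof (rule that)
    show "wedge (vector [Im z / r, 0]) (vector [Re z / r, 1 / r]) = 1"
      using r y by (simp add: wedge_def field_simps)
    show "z = proj_pt (vector [Re z / r, 1 / r]) (vector [Im z / r, 0])"
      using r y by (simp add: proj_pt_def complex_eq_iff Re_divide Im_divide field_simps power2_eq_square)
  qed
qed

lemma mat_act_proj_pt:
  assumes "wedge v u \<noteq> 0" "det M = 1"
  shows "mat_act M (proj_pt u v) = proj_pt (M *v u) (M *v v)"
proof -
  have 1: "Complex (u$2) (v$2) \<noteq> 0" using assms(1) by (rule proj_pt_denom_nz)
  have 2: "Complex ((M *v u)$2) ((M *v v)$2) \<noteq> 0"
    by (rule proj_pt_denom_nz) (simp add: wedge_mult assms)
  have n1: "Complex ((M *v u)$1) ((M *v v)$1) =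
      of_real (M$1$1) * Complex (u$1) (v$1) + of_real (M$1$2) * Complex (u$2) (v$2)"
    by (simp add: complex_eq_iff mv_nth)
  have n2: "Complex ((M *v u)$2) ((M *v v)$2) =
      of_real (M$2$1) * Complex (u$1) (v$1) + of_real (M$2$2) * Complex (u$2) (v$2)"
    by (simp add: complex_eq_iff mv_nth)
  have aux: "(a * (p / q) + b) / (c * (p / q) + d) = (a * p + b * q) / (c * p + d * q)"
    if "q \<noteq> 0" for a b c d p q :: complex
  proof -
    have "a * (p / q) + b = (a * p + b * q) / q" "c * (p / q) + d = (c * p + d * q) / q"
      using that by (simp_all add: field_simps)
    then show ?thesis using that by simp
  qed
  show ?thesis
    unfolding mat_act_def moebius_def proj_pt_def n1 n2 using 1 by (rule aux)
qed

lemma proj_pt_eq_iff: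
  assumes "wedge v u \<noteq> 0" "wedge v' u' \<noteq> 0"
  shows "proj_pt u v = proj_pt u' v' \<longleftrightarrow> wedge u u' = wedge v v' \<and> wedge u v' + wedge v u' = 0"
proof -
  have "proj_pt u v = proj_pt u' v' \<longleftrightarrow>
    Complex (u$1) (v$1) * Complex (u'$2) (v'$2) = Complex (u'$1) (v'$1) * Complex (u$2) (v$2)"
    unfolding proj_pt_def using proj_pt_denom_nz[OF assms(1)] proj_pt_denom_nz[OF assms(2)]
    by (rule frac_eq_eq)
  also have "\<dots> \<longleftrightarrow> wedge u u' = wedge v v' \<and> wedge u v' + wedge v u' = 0"
    by (auto simp: complex_eq_iff wedge_def algebra_simps)
  finally show ?thesis .
qed

text \<open>For representatives of area one the distance depends only on the complex area that the two representatives span,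
  which makes its invariance under matrices of determinant one evident.\<close>

lemma hyp_dist_proj_pt:
  assumes "wedge v u = 1" "wedge v' u' = 1"
  shows "hyp_dist (proj_pt u v) (proj_pt u' v') =
    arcosh (1 + ((wedge u u' - wedge v v')\<^sup>2 + (wedge u v' + wedge v u')\<^sup>2) / 2)"
proof -
  let ?q = "Complex (u$2) (v$2)" and ?q' = "Complex (u'$2) (v'$2)"
  let ?p = "Complex (u$1) (v$1)" and ?p' = "Complex (u'$1) (v'$1)"
  have nz: "?q \<noteq> 0" "?q' \<noteq> 0" using assms proj_pt_denom_nz by force+
  have "proj_pt u v - proj_pt u' v' = (?p * ?q' - ?p' * ?q) / (?q * ?q')"
    unfolding proj_pt_def using nz by (simp add: field_simps)
  also have "?p * ?q' - ?p' * ?q = Complex (wedge u u' - wedge v v') (wedge u v' + wedge v u')"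
    by (simp add: complex_eq_iff wedge_def algebra_simps)
  finally have "(cmod (proj_pt u v - proj_pt u' v'))\<^sup>2 =
     ((wedge u u' - wedge v v')\<^sup>2 + (wedge u v' + wedge v u')\<^sup>2) / ((cmod ?q)\<^sup>2 * (cmod ?q')\<^sup>2)"
    by (simp add: norm_divide norm_mult power_divide power_mult_distrib cmod_power2)
  moreover have "Im (proj_pt u v) = 1 / (cmod ?q)\<^sup>2" "Im (proj_pt u' v') = 1 / (cmod ?q')\<^sup>2"
    by (simp_all add: Im_proj_pt assms cmod_power2)
  moreover have "(cmod ?q)\<^sup>2 \<noteq> 0" "(cmod ?q')\<^sup>2 \<noteq> 0" using nz by auto
  moreover have aux: "X / (2 * I * J) = N / 2" if "X = N / (A * B)" "I = 1 / A" "J = 1 / B" "A \<noteq> 0" "B \<noteq> 0"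
    for X N A B I J :: real using that by simp
  ultimately have "(cmod (proj_pt u v - proj_pt u' v'))\<^sup>2 / (2 * Im (proj_pt u v) * Im (proj_pt u' v'))
      = ((wedge u u' - wedge v v')\<^sup>2 + (wedge u v' + wedge v u')\<^sup>2) / 2"
    by blast
  then show ?thesis unfolding hyp_dist_def by presburger
qed

lemma mat_act_H: "\<lbrakk>det M = 1; z \<in> upper_half_plane\<rbrakk> \<Longrightarrow> mat_act M z \<in> upper_half_plane"
  by (erule ex_proj_pt) (auto simp: mat_act_proj_pt wedge_mult1 intro!: proj_pt_in_H)

lemma mat_act_comp:
  assumes "det M = 1" "det N = 1" "z \<in> upper_half_plane"
  shows "mat_act (M ** N) z = mat_act M (mat_act N z)"
  using assms(3)
  by (rule ex_proj_pt) (use assms(1,2) in \<open>auto simp: mat_act_proj_pt wedge_mult1 det_mul matrix_vector_mul_assoc\<close>)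

lemma mat_act_one: "mat_act (mat 1) z = z"
  by (simp add: mat_act_def moebius_def mat_def)

lemma hyp_dist_mat_act:
  assumes "det M = 1" "z \<in> upper_half_plane" "w \<in> upper_half_plane"
  shows "hyp_dist (mat_act M z) (mat_act M w) = hyp_dist z w"
proof -
  obtain u v where 1: "wedge v u = 1" "z = proj_pt u v" using assms(2) by (rule ex_proj_pt)
  obtain u' v' where 2: "wedge v' u' = 1" "w = proj_pt u' v'" using assms(3) by (rule ex_proj_pt)
  show ?thesis using 1 2 assms(1) by (simp add: mat_act_proj_pt hyp_dist_proj_pt wedge_mult1)
qed


section \<open>Geodesic lines\<close>

text \<open>For representatives with \<open>wedge v u = 1\<close> this is the geodesic with end points \<open>u\<close> and \<open>v\<close>, parametrised by arc length.\<close>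

definition geo_line :: "real^2 \<Rightarrow> real^2 \<Rightarrow> real \<Rightarrow> complex" where
  "geo_line u v s = proj_pt (exp (- s/2) *\<^sub>R u) (exp (s/2) *\<^sub>R v)"

lemma geo_line_H: "wedge v u = 1 \<Longrightarrow> geo_line u v s \<in> upper_half_plane"
  unfolding geo_line_def by (rule proj_pt_in_H) simp

lemma mat_act_geo_line: "\<lbrakk>det M = 1; wedge v u = 1\<rbrakk> \<Longrightarrow> mat_act M (geo_line u v s) = geo_line (M *v u) (M *v v) s"
  unfolding geo_line_def by (subst mat_act_proj_pt) (simp_all add: matrix_vector_mult_scaleR)

lemma geo_line_eq_iff:
  assumes "wedge v u = 1" "wedge v' u' = 1"
  shows "geo_line u v s = geo_line u' v' t \<longleftrightarrow>
    exp (-(s+t)/2) * wedge u u' = exp ((s+t)/2) * wedge v v' \<and>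
    exp ((t-s)/2) * wedge u v' + exp ((s-t)/2) * wedge v u' = 0"
proof -
  have e: "exp (- s / 2) * (exp (- t / 2) * x) = exp (-(s+t)/2) * x"
    "exp (s / 2) * (exp (t / 2) * x) = exp ((s+t)/2) * x"
    "exp (- s / 2) * (exp (t / 2) * x) = exp ((t-s)/2) * x"
    "exp (s / 2) * (exp (- t / 2) * x) = exp ((s-t)/2) * x" for x
    by (simp_all add: mult.assoc[symmetric] exp_add[symmetric] add_divide_distrib diff_divide_distrib)
  have nz: "wedge (exp (s/2) *\<^sub>R v) (exp (- s/2) *\<^sub>R u) \<noteq> 0"
    "wedge (exp (t/2) *\<^sub>R v') (exp (- t/2) *\<^sub>R u') \<noteq> 0" by (simp_all add: assms)
  show ?thesis
    unfolding geo_line_def proj_pt_eq_iff[OF nz] wedge_scaleR e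
    by (simp only: mult.left_commute[of "exp (- t/2)"] mult.left_commute[of "exp (t/2)"] e)
qed

lemma geodesic_geo_line:
  assumes "wedge v u = 1"
  shows "geodesic_line (geo_line u v)"
  unfolding geodesic_line_def
proof (intro conjI allI)
  fix s t :: real
  show "geo_line u v s \<in> upper_half_plane" by (rule geo_line_H[OF assms])
  have a: "wedge u v = -1" using assms wedge_commute[of u v] by simp
  have "hyp_dist (geo_line u v s) (geo_line u v t) =
     arcosh (1 + ((exp (- s/2) * exp (t/2) * (-1) + exp (s/2) * exp (-t/2))\<^sup>2) / 2)"
    unfolding geo_line_def
    by (subst hyp_dist_proj_pt) (simp_all add: assms a mult.left_commute mult.commute exp_minus)
  also have "exp (- s/2) * exp (t/2) * (-1) + exp (s/2) * exp (-t/2) = 2 * sinh ((s-t)/2)"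
    by (simp add: sinh_def exp_add[symmetric] algebra_simps add_divide_distrib diff_divide_distrib)
  also have "1 + (2 * sinh ((s - t)/2))\<^sup>2 / 2 = cosh (2 * ((s-t)/2))"
    by (subst cosh_double) (simp add: power_mult_distrib cosh_square_eq)
  also have "2 * ((s - t)/2) = s - t" by simp
  also have "cosh (s - t) = cosh \<bar>s - t\<bar>"
    by simp
  finally show "hyp_dist (geo_line u v s) (geo_line u v t) = \<bar>s - t\<bar>" using arcosh_cosh_real[of "\<bar>s - t\<bar>"] by simp
qed


lemma geo_line_inj: "\<lbrakk>wedge v u = 1; geo_line u v s = geo_line u v t\<rbrakk> \<Longrightarrow> s = t"
proof -
  assume a: "wedge v u = 1" "geo_line u v s = geo_line u v t"
  have "hyp_dist (geo_line u v s) (geo_line u v t) = \<bar>s - t\<bar>" "hyp_dist (geo_line u v s) (geo_line u v s) = \<bar>s - s\<bar>"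
    using geodesic_geo_line[OF a(1)] unfolding geodesic_line_def by blast+
  then show "s = t" using a(2) by simp
qed

text \<open>The two conditions are linear in the squared modulus of \<open>z\<close>. Their difference determines the imaginary part,
  and then either of them forces the real part to vanish.\<close>

lemma imag_axis_unique:
  assumes z: "z \<in> upper_half_plane"
    and 1: "hyp_dist \<i> z = \<bar>s\<bar>" and 2: "hyp_dist (of_real (exp 1) * \<i>) z = \<bar>1 - s\<bar>"
  shows "z = of_real (exp s) * \<i>"
proof -
  define x y where "x = Re z" and "y = Im z"
  have y: "y > 0" using z by (simp add: y_def upper_half_plane_def)
  have eq: "1 + (cmod (p - z))\<^sup>2 / (2 * Im p * Im z) = cosh r"
    if "hyp_dist p z = \<bar>r\<bar>" "Im p > 0" for p r
  proof -
    have "1 + (cmod (p - z))\<^sup>2 / (2 * Im p * Im z) \<ge> 1"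
      using that(2) y by (auto simp: y_def intro!: divide_nonneg_pos)
    then have "1 + (cmod (p - z))\<^sup>2 / (2 * Im p * Im z) = cosh (hyp_dist p z)"
      unfolding hyp_dist_def by simp
    then show ?thesis by (simp add: that(1) abs_if)
  qed
  define E where "E = exp (1::real)"
  define S where "S = exp s"
  have E: "E > 1" and S: "S > 0" by (simp_all add: E_def S_def)
  have c1: "cosh s = (S + 1/S) / 2" by (simp add: cosh_def S_def exp_minus field_simps)
  have c2: "cosh (1 - s) = (E/S + S/E) / 2"
    by (simp add: cosh_def S_def E_def exp_diff field_simps)
  have "1 + (x\<^sup>2 + (1 - y)\<^sup>2) / (2 * y) = cosh s"
    using eq[OF 1] by (simp add: cmod_power2 x_def y_def)
  then have "2 * y * (1 + (x\<^sup>2 + (1 - y)\<^sup>2) / (2 * y)) = 2 * y * ((S + 1/S) / 2)"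
    unfolding c1 by (rule arg_cong)
  moreover have "2 * y * (1 + (x\<^sup>2 + (1 - y)\<^sup>2) / (2 * y)) = 2 * y + (x\<^sup>2 + (1 - y)\<^sup>2)"
    using y nonzero_mult_div_cancel_left[of "2 * y"] by (simp add: distrib_left del: times_divide_eq_right) simp
  moreover have "2 * y * ((S + 1/S) / 2) = y * (S + 1/S)" by simp
  ultimately have "2 * y + (x\<^sup>2 + (1 - y)\<^sup>2) = y * (S + 1/S)" by (simp only:)
  then have a: "x\<^sup>2 + y\<^sup>2 + 1 = y * (S + 1/S)"
    by (simp add: power2_eq_square algebra_simps)
  have aux: "2 * (a + N) = a * W" if "1 + N / a = W / 2" "a \<noteq> 0" for a N W :: real
  proof -
    have "2 * (a + N) = 2 * a * (1 + N / a)" using that(2) by (simp add: distrib_left)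
    then show ?thesis using that(1) by simp
  qed
  have "1 + (x\<^sup>2 + (E - y)\<^sup>2) / (2 * E * y) = cosh (1 - s)"
    using eq[OF 2] by (simp add: cmod_power2 x_def y_def E_def)
  then have "1 + (x\<^sup>2 + (E - y)\<^sup>2) / (2 * E * y) = (E/S + S/E) / 2" unfolding c2 .
  from aux[OF this] have "2 * (2 * E * y + (x\<^sup>2 + (E - y)\<^sup>2)) = 2 * (E * y * (E/S + S/E))"
    using y E by (simp only: mult.assoc) simp
  then have "2 * E * y + (x\<^sup>2 + (E - y)\<^sup>2) = E * y * (E/S + S/E)"
    by (simp only: mult_cancel_left) simp
  also have "E * y * (E/S + S/E) = y * (E * E / S + S)" using E by (simp add: field_simps)
  finally have b: "x\<^sup>2 + y\<^sup>2 + E * E = y * (E * E / S + S)"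
    by (simp add: power2_eq_square algebra_simps)
  have "E * E - 1 = y * (E * E / S + S) - y * (S + 1/S)" using a b by linarith
  also have "\<dots> = (E * E - 1) * (y / S)" using S by (simp add: field_simps)
  finally have "(E * E - 1) * (y / S - 1) = 0" by (simp add: algebra_simps)
  moreover have "E * E > 1 * 1" using E by (intro mult_strict_mono) auto
  ultimately have yS: "y = S" using S by simp
  then have "x\<^sup>2 = 0" using a S by (simp add: field_simps power2_eq_square)
  then show ?thesis using yS by (simp add: complex_eq_iff x_def y_def S_def)
qed

definition rot :: "real \<Rightarrow> real^2^2" where
  "rot a = vector [vector [cos a, - sin a], vector [sin a, cos a]]"

lemma det_rot: "det (rot a) = 1"
  by (simp add: rot_def det_2)

lemma rot_i: "mat_act (rot a) \<i> = \<i>"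
proof -
  have "complex_of_real (cos a) + \<i> * complex_of_real (sin a) \<noteq> 0"
    using sin_zero_abs_cos_one[of a] by (auto simp: complex_eq_iff)
  then show ?thesis
    by (simp add: mat_act_def moebius_def rot_def field_simps)
qed

lemma i_in_H: "r > 0 \<Longrightarrow> of_real r * \<i> \<in> upper_half_plane"
  by (simp add: upper_half_plane_def)

text \<open>The real part of the rotated point is a combination of the sine and cosine of the double angle, hence can be made zero.
  A quarter turn then decides between the two points of the imaginary axis at distance one.\<close>

lemma ex_rot:
  assumes z: "z \<in> upper_half_plane" and d: "hyp_dist \<i> z = 1"
  obtains a where "mat_act (rot a) z = of_real (exp 1) * \<i>"
proof -
  define x y where "x = Re z" and "y = Im z"
  have y: "y > 0" using z by (simp add: y_def upper_half_plane_def)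
  obtain r b where rb: "x\<^sup>2 + y\<^sup>2 - 1 = r * cos b" "- 2 * x = r * sin b"
    using polar_Ex[of "x\<^sup>2 + y\<^sup>2 - 1" "- 2 * x"] by auto
  define a where "a = b / 2"
  have b: "cos b = (cos a)\<^sup>2 - (sin a)\<^sup>2" "sin b = 2 * sin a * cos a"
    using cos_double[of a] sin_double[of a] by (simp_all add: a_def)
  have Re0: "Re (mat_act (rot a) z) = 0"
  proof -
    have "cos a * sin a * (x\<^sup>2 + y\<^sup>2 - 1) + ((cos a)\<^sup>2 - (sin a)\<^sup>2) * x
        = (sin b / 2) * (r * cos b) + cos b * x" by (simp add: b rb(1)[unfolded b])
    also have "\<dots> = cos b * (r * sin b + 2 * x) / 2" by (simp add: algebra_simps)
    also have "\<dots> = 0" using rb(2) by simp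
    finally have "(cos a * x - sin a) * (sin a * x + cos a) + (cos a * y) * (sin a * y) = 0"
      by (simp add: power2_eq_square algebra_simps)
    then show ?thesis
      by (simp add: mat_act_def moebius_def rot_def Re_divide x_def y_def mult_ac)
  qed
  define w where "w = mat_act (rot a) z"
  have w: "w \<in> upper_half_plane" unfolding w_def using z det_rot by (intro mat_act_H)
  define t where "t = Im w"
  have t: "t > 0" using w by (simp add: t_def upper_half_plane_def)
  have region_height: "w = of_real t * \<i>" using Re0 by (simp add: complex_eq_iff t_def w_def)
  have "hyp_dist (mat_act (rot a) \<i>) w = 1"
    unfolding w_def using z d i_in_H[of 1] by (subst hyp_dist_mat_act) (simp_all add: det_rot)
  then have "arcosh (1 + (1 - t)\<^sup>2 / (2 * t)) = 1"
    by (simp add: rot_i hyp_dist_def region_height cmod_power2)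
  moreover have "1 + (1 - t)\<^sup>2 / (2 * t) \<ge> 1" using t by simp
  ultimately have "1 + (1 - t)\<^sup>2 / (2 * t) = cosh 1" by (metis cosh_arcosh_real)
  then have "t\<^sup>2 + 1 = t * (exp 1 + exp (-1))"
    using t by (simp add: cosh_def field_simps power2_eq_square)
  then have "(t - exp 1) * (t - exp (-1)) = 0"
    by (simp add: power2_eq_square algebra_simps flip: exp_add)
  then consider "t = exp 1" | "t = exp (-1)" by auto
  then show ?thesis
  proof cases
    case 1
    then show ?thesis using region_height by (intro that[of a]) (simp add: w_def)
  next
    case 2
    have "rot (pi/2 + a) = rot (pi/2) ** rot a"
      by (simp add: vec2_eq_iff mm_nth rot_def cos_add sin_add)
    then have "mat_act (rot (pi/2 + a)) z = mat_act (rot (pi/2)) w"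
      unfolding w_def using z by (simp add: mat_act_comp det_rot)
    also have "\<dots> = of_real (exp 1) * \<i>"
      by (simp add: region_height 2 mat_act_def moebius_def rot_def exp_minus field_simps)
    finally show ?thesis by (rule that)
  qed
qed

text \<open>A point of a line is determined by its distances from two given points of the line, so it suffices to move
  these two points to the imaginary axis.\<close>

lemma geodesic_line_imp:
  assumes "geodesic_line c"
  obtains u v where "wedge v u = 1" "c = geo_line u v"
proof -
  have H: "c s \<in> upper_half_plane" and d: "hyp_dist (c s) (c t) = \<bar>s - t\<bar>" for s t
    using assms unfolding geodesic_line_def by auto
  define e1 e2 :: "real^2" where "e1 = vector [1, 0]" and "e2 = vector [0, 1]"
  have axis: "geo_line e2 e1 s = of_real (exp s) * \<i>" for s
    by (simp add: geo_line_def proj_pt_def e1_def e2_def complex_eq_iff Re_divide Im_divide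
      power2_eq_square exp_minus field_simps flip: exp_add)
  obtain u v where uv: "wedge v u = 1" "c 0 = proj_pt u v" using H[of 0] by (rule ex_proj_pt)
  define N :: "real^2^2" where "N = vector [vector [v$1, u$1], vector [v$2, u$2]]"
  have dN: "det N = 1" using uv by (simp add: N_def det_2 wedge_def mult.commute)
  have Ne: "N *v e1 = v" "N *v e2 = u" by (simp_all add: vec2_eq_iff mv_nth N_def e1_def e2_def)
  have e12: "wedge e1 e2 = 1" by (simp add: e1_def e2_def wedge_def)
  have Ni: "mat_act N \<i> = c 0"
    using mat_act_geo_line[OF dN e12, of 0] axis[of 0] uv Ne by (simp add: geo_line_def)
  let ?N' = "matrix_inv N"
  have dN': "det ?N' = 1" by (rule det1_inv[OF dN])
  have N'i: "mat_act ?N' (c 0) = \<i>"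
    using Ni mat_act_comp[OF dN' dN i_in_H[of 1]] by (simp add: det1_inv[OF dN] mat_act_one)
  have "hyp_dist \<i> (mat_act ?N' (c 1)) = 1"
    unfolding N'i[symmetric] by (subst hyp_dist_mat_act) (simp_all add: dN' H d)
  then obtain a where a: "mat_act (rot a) (mat_act ?N' (c 1)) = of_real (exp 1) * \<i>"
    by (rule ex_rot[rotated]) (auto intro: mat_act_H dN' H)
  define M where "M = rot a ** ?N'"
  have dM: "det M = 1" by (simp add: M_def det_mul det_rot dN')
  have M0: "mat_act M (c 0) = \<i>" "mat_act M (c 1) = of_real (exp 1) * \<i>"
    by (simp_all add: M_def mat_act_comp det_rot dN' H N'i rot_i a)
  have Ms: "mat_act M (c s) = geo_line e2 e1 s" for s
    unfolding axis
  proof (rule imag_axis_unique)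
    show "mat_act M (c s) \<in> upper_half_plane" by (intro mat_act_H dM H)
    show "hyp_dist \<i> (mat_act M (c s)) = \<bar>s\<bar>"
      unfolding M0(1)[symmetric] by (subst hyp_dist_mat_act) (simp_all add: dM H d)
    show "hyp_dist (of_real (exp 1) * \<i>) (mat_act M (c s)) = \<bar>1 - s\<bar>"
      unfolding M0(2)[symmetric] by (subst hyp_dist_mat_act) (simp_all add: dM H d)
  qed
  let ?M' = "matrix_inv M"
  have dM': "det ?M' = 1" by (rule det1_inv[OF dM])
  have "c s = geo_line (?M' *v e2) (?M' *v e1) s" for s
  proof -
    have "c s = mat_act ?M' (mat_act M (c s))"
      using mat_act_comp[OF dM' dM H[of s]] by (simp add: det1_inv[OF dM] mat_act_one)
    then show ?thesis unfolding Ms by (simp add: mat_act_geo_line dM' e12)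
  qed
  then show ?thesis using that[of "?M' *v e1" "?M' *v e2"] e12 wedge_mult1[OF dM'] by auto
qed

text \<open>Two lines cross exactly when their end points separate each other on the boundary circle;
  the sign of this product is the combinatorial form of that condition.\<close>

definition link :: "real^2 \<Rightarrow> real^2 \<Rightarrow> real^2 \<Rightarrow> real^2 \<Rightarrow> real" where
  "link u v u' v' = wedge u u' * wedge u v' * wedge v u' * wedge v v'"

text \<open>The equations for a common point determine \<open>exp (s + t)\<close> and \<open>exp (s - t)\<close>; both values are positive because
  exactly one of the two products in the Pluecker relation is.\<close>

lemma geo_line_cross_exists:
  assumes "wedge v u = 1" "wedge v' u' = 1" "link u v u' v' < 0"
  obtains s t where "geo_line u v s = geo_line u' v' t"
proof -
  define p q r w where "p = wedge u u'" and "q = wedge v v'" and "r = wedge u v'" and "w = wedge v u'"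
  note d = p_def q_def r_def w_def
  have pl: "p * q - r * w = 1"
    using wedge_plucker[of v u v' u'] assms(1,2) by (simp add: d mult.commute)
  have neg: "(p * q) * (r * w) < 0" using assms(3) by (simp add: link_def d mult_ac)
  have pq: "p * q > 0" and rw: "r * w < 0"
    using pl neg[unfolded mult_less_0_iff[of "p*q" "r*w"]] by linarith+
  have 1: "p / q > 0" and 2: "- r / w > 0"
    using pq rw by (auto simp: zero_less_mult_iff zero_less_divide_iff mult_less_0_iff divide_less_0_iff)
  define s t where "s = (ln (p/q) + ln (-r/w)) / 2" and "t = (ln (p/q) - ln (-r/w)) / 2"
  have st: "exp (s + t) = p / q" "exp (s - t) = - r / w"
  proof -
    have "s + t = ln (p/q)" "s - t = ln (-r/w)" by (simp_all add: s_def t_def field_simps)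
    then show "exp (s + t) = p / q" "exp (s - t) = - r / w" using 1 2 by simp_all
  qed
  have "exp (-(s+t)/2) * p = exp ((s+t)/2) * q"
  proof -
    have "p = exp ((s+t)/2) * exp ((s+t)/2) * q" using st(1) pq by (auto simp flip: exp_add)
    moreover have "exp (-(s+t)/2) = 1 / exp ((s+t)/2)" by (simp only: minus_divide_left[symmetric] exp_minus inverse_eq_divide)
    ultimately show ?thesis by simp
  qed
  moreover have "exp ((t-s)/2) * r + exp ((s-t)/2) * w = 0"
  proof -
    have "r = - (exp ((s-t)/2) * exp ((s-t)/2) * w)" using st(2) rw by (auto simp flip: exp_add)
    moreover have "exp ((t-s)/2) = 1 / exp ((s-t)/2)"
      by (simp add: exp_minus[symmetric] field_simps flip: exp_add)
    ultimately show ?thesis by (simp add: field_simps)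
  qed
  ultimately have "geo_line u v s = geo_line u' v' t" using assms by (subst geo_line_eq_iff) (simp_all add: d)
  then show ?thesis by (rule that)
qed

lemma geo_line_no_cross:
  assumes "wedge v u = 1" "wedge v' u' = 1" "link u v u' v' > 0"
  shows "geo_line u v s \<noteq> geo_line u' v' t"
proof
  assume "geo_line u v s = geo_line u' v' t"
  then have e: "exp (-(s+t)/2) * wedge u u' = exp ((s+t)/2) * wedge v v'"
    "exp ((t-s)/2) * wedge u v' + exp ((s-t)/2) * wedge v u' = 0"
    using assms by (simp_all add: geo_line_eq_iff)
  have "exp (-(s+t)/2) * (wedge u u' * wedge v v') = exp ((s+t)/2) * (wedge v v')\<^sup>2"
    using arg_cong[OF e(1), of "\<lambda>z. z * wedge v v'"] by (simp add: power2_eq_square mult_ac)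
  then have "0 \<le> exp (-(s+t)/2) * (wedge u u' * wedge v v')" by simp
  then have 1: "0 \<le> wedge u u' * wedge v v'" by (simp add: zero_le_mult_iff)
  have "exp ((t-s)/2) * (wedge u v' * wedge v u') = - (exp ((s-t)/2) * (wedge v u')\<^sup>2)"
    using arg_cong[OF e(2), of "\<lambda>z. z * wedge v u'"] by (simp add: power2_eq_square algebra_simps)
  then have "exp ((t-s)/2) * (wedge u v' * wedge v u') \<le> 0" by simp
  then have 2: "wedge u v' * wedge v u' \<le> 0" by (simp add: mult_le_0_iff)
  have "(wedge u u' * wedge v v') * (wedge u v' * wedge v u') \<le> 0"
    using 1 2 by (rule mult_nonneg_nonpos)
  then show False using assms(3) by (simp add: link_def mult_ac)
qed

lemma geo_line_cross_unique:
  assumes "wedge v u = 1" "wedge v' u' = 1" "wedge v v' \<noteq> 0" "wedge v u' \<noteq> 0"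
    and "geo_line u v s = geo_line u' v' t" "geo_line u v s' = geo_line u' v' t'"
  shows "s = s'" "t = t'"
proof -
  have e: "exp (s + t) * wedge v v' = wedge u u' \<and> exp (s - t) * wedge v u' = - wedge u v'"
    if "geo_line u v s = geo_line u' v' t" for s t
  proof -
    have e: "exp (-(s+t)/2) * wedge u u' = exp ((s+t)/2) * wedge v v'"
      "exp ((t-s)/2) * wedge u v' + exp ((s-t)/2) * wedge v u' = 0"
      using assms that by (simp_all add: geo_line_eq_iff)
    have "exp ((s+t)/2) * (exp (-(s+t)/2) * wedge u u') = exp ((s+t)/2) * (exp ((s+t)/2) * wedge v v')"
      using e(1) by simp
    moreover have "exp ((s+t)/2) * exp (-(s+t)/2) = 1" "exp ((s+t)/2) * exp ((s+t)/2) = exp (s+t)"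
      by (simp_all flip: exp_add add_divide_distrib)
    ultimately have 1: "wedge u u' = exp (s+t) * wedge v v'" by (metis mult.assoc mult_1)
    have "exp ((s-t)/2) * (exp ((t-s)/2) * wedge u v' + exp ((s-t)/2) * wedge v u') = 0"
      using e(2) by simp
    moreover have "exp ((s-t)/2) * exp ((t-s)/2) = 1" "exp ((s-t)/2) * exp ((s-t)/2) = exp (s-t)"
      by (simp_all flip: exp_add add_divide_distrib)
    ultimately have "wedge u v' + exp (s-t) * wedge v u' = 0"
      by (metis distrib_left mult.assoc mult_1)
    with 1 show ?thesis by simp
  qed
  have "exp (s + t) = exp (s' + t')" "exp (s - t) = exp (s' - t')"
    using e[OF assms(5)] e[OF assms(6)] assms(3,4) by (metis mult_right_cancel)+
  then show "s = s'" "t = t'" by simp_all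
qed

lemma geo_line_scale:
  assumes "wedge v u = 1" "k \<noteq> 0"
  shows "geo_line (k *\<^sub>R u) ((1/k) *\<^sub>R v) s = geo_line u v (s - ln (k\<^sup>2))"
proof -
  let ?t = "s - ln (k\<^sup>2)"
  have "exp ((?t - s)/2) = 1 / \<bar>k\<bar>" "exp ((s - ?t)/2) = \<bar>k\<bar>"
    using assms ln_realpow[of "\<bar>k\<bar>" 2] by (simp_all add: exp_minus field_simps)
  then show ?thesis
    using assms wedge_commute[of u v] by (subst geo_line_eq_iff) (auto simp: field_simps abs_if)
qed

lemma geo_line_reverse:
  assumes "wedge v u = 1" "k \<noteq> 0"
  shows "geo_line (k *\<^sub>R v) ((- 1/k) *\<^sub>R u) s = geo_line u v (- s + ln (k\<^sup>2))"
proof -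
  let ?t = "- s + ln (k\<^sup>2)"
  have "exp (- (s + ?t)/2) = 1 / \<bar>k\<bar>" "exp ((s + ?t)/2) = \<bar>k\<bar>"
    using assms ln_realpow[of "\<bar>k\<bar>" 2] by (simp_all add: exp_minus field_simps)
  then show ?thesis
    using assms wedge_commute[of u v] by (subst geo_line_eq_iff) (auto simp: field_simps abs_if)
qed


text \<open>A second common point makes the equations degenerate, so the two lines have the same end points, in one order or the other.\<close>

lemma geo_line_two_points:
  assumes uv: "wedge v u = 1" "wedge v' u' = 1"
    and eq: "geo_line u v s = geo_line u' v' t" "geo_line u v s' = geo_line u' v' t'" and ne: "t \<noteq> t'"
  obtains \<sigma> t0 where "\<sigma> = 1 \<or> \<sigma> = -1" "\<And>r. geo_line u' v' r = geo_line u v (\<sigma> * r + t0)"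
proof -
  have "u \<noteq> 0" "v \<noteq> 0" using uv by auto
  have "wedge v v' = 0 \<or> wedge v u' = 0"
    using geo_line_cross_unique(2)[OF uv _ _ eq] ne by auto
  then consider "wedge v v' = 0" "wedge u u' = 0" | "wedge v u' = 0" "wedge u v' = 0"
    using eq(1) unfolding geo_line_eq_iff[OF uv] by auto
  then show ?thesis
  proof cases
    case 1
    obtain k where k: "u' = k *\<^sub>R u" using wedge_eq_0_imp[OF 1(2) \<open>u \<noteq> 0\<close>] .
    obtain m where m: "v' = m *\<^sub>R v" using wedge_eq_0_imp[OF 1(1) \<open>v \<noteq> 0\<close>] .
    have km: "k * m = 1" using uv k m by (simp add: mult.commute)
    then have "k \<noteq> 0" by auto
    with km have "m = 1/k" by (simp add: field_simps)
    from \<open>k \<noteq> 0\<close> this show ?thesis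
      using geo_line_scale[OF uv(1), of k] k m by (intro that[of 1 "- ln (k\<^sup>2)"]) auto
  next
    case 2
    obtain k where k: "u' = k *\<^sub>R v" using wedge_eq_0_imp[OF 2(1) \<open>v \<noteq> 0\<close>] .
    obtain m where m: "v' = m *\<^sub>R u" using wedge_eq_0_imp[OF 2(2) \<open>u \<noteq> 0\<close>] .
    have "wedge u v = -1" using uv wedge_commute[of u v] by simp
    then have km: "k * m = -1" using uv k m by (simp add: mult.commute)
    then have "k \<noteq> 0" by auto
    with km have "m = - 1/k" by (simp add: field_simps)
    from \<open>k \<noteq> 0\<close> this show ?thesis
      using geo_line_reverse[OF uv(1), of k] k m by (intro that[of "-1" "ln (k\<^sup>2)"]) auto
  qed
qed

text \<open>The sign \<open>e\<close> below is unavoidable: a matrix acts on the half plane through its class up to sign.\<close>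

lemma translation_axis:
  assumes uv: "wedge v u = 1" and g: "det g = 1"
    and tr: "\<And>s. mat_act g (geo_line u v s) = geo_line u v (s + l)"
  obtains e where "e = 1 \<or> e = (-1::real)" "g *v u = (e * exp (- l/2)) *\<^sub>R u" "g *v v = (e * exp (l/2)) *\<^sub>R v"
proof -
  have nz: "u \<noteq> 0" "v \<noteq> 0" using uv by auto
  have guv: "wedge (g *v v) (g *v u) = 1" using uv by (simp add: wedge_mult1 g)
  have e: "exp (-(s + (s + l))/2) * wedge (g *v u) u = exp ((s + (s + l))/2) * wedge (g *v v) v"
     "exp (((s + l)-s)/2) * wedge (g *v u) v + exp ((s - (s + l))/2) * wedge (g *v v) u = 0" for s
    using tr[of s] unfolding mat_act_geo_line[OF g uv] geo_line_eq_iff[OF guv uv] by auto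
  have a: "wedge (g *v u) u = wedge (g *v v) v" using e(1)[of "- l/2"] by simp
  have "exp (-1) * wedge (g *v v) v = exp 1 * wedge (g *v v) v" using e(1)[of "1 - l/2"] a by simp
  then have b: "wedge (g *v v) v = 0" by simp
  have "wedge u (g *v u) = 0" "wedge v (g *v v) = 0" using a b wedge_commute by (metis neg_equal_0_iff_equal)+
  then obtain k m where k: "g *v u = k *\<^sub>R u" and m: "g *v v = m *\<^sub>R v"
    using wedge_eq_0_imp nz by metis
  have km: "k * m = 1" using guv uv k m by (simp add: mult.commute)
  have "wedge u v = -1" using uv wedge_commute[of u v] by simp
  then have c: "exp (l/2) * k = exp (- l/2) * m" using e(2)[of 0] uv k m by simp
  define e where "e = exp (l/2) * k"
  have "e * e = (exp (l/2) * k) * (exp (- l/2) * m)" using c by (simp add: e_def)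
  also have "\<dots> = (exp (l/2) * exp (- l/2)) * (k * m)" by (simp only: mult_ac)
  also have "\<dots> = 1" using km by (simp flip: exp_add)
  finally have "e = 1 \<or> e = -1" by (simp add: square_eq_1_iff)
  moreover have "k = e * exp (- l/2)" by (simp add: e_def exp_minus)
  moreover have "m = e * exp (l/2)" unfolding e_def c by (simp add: exp_minus)
  ultimately show ?thesis using that k m by blast
qed

lemma axis_translation:
  assumes uv: "wedge v u = 1" and g: "det g = 1"
    and e: "e = 1 \<or> e = (-1::real)" "g *v u = (e * exp (- l/2)) *\<^sub>R u" "g *v v = (e * exp (l/2)) *\<^sub>R v"
  shows "mat_act g (geo_line u v s) = geo_line u v (s + l)"
proof -
  have "wedge (g *v v) (g *v u) = 1" using uv by (simp add: wedge_mult1 g)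
  then show ?thesis
    unfolding mat_act_geo_line[OF g uv] using e uv wedge_commute[of u v]
    by (subst geo_line_eq_iff) (auto simp: algebra_simps simp flip: exp_add)
qed

lemma eigenvector_2:
  fixes M :: "real^2^2"
  assumes "det M = 1" "x \<noteq> 0" "trace M = x + 1/x"
  obtains u where "u \<noteq> 0" "M *v u = x *\<^sub>R u"
proof -
  have d: "(x - M$1$1) * (x - M$2$2) = M$1$2 * M$2$1"
  proof -
    have "M$1$1 + M$2$2 = x + 1/x" "M$1$1 * M$2$2 - M$1$2 * M$2$1 = 1"
      using assms by (simp_all add: trace_2 det_2)
    moreover have "x * (1/x) = 1" using assms by simp
    ultimately show ?thesis by algebra
  qed
  consider "M$1$2 \<noteq> 0 \<or> x \<noteq> M$1$1" | "M$1$2 = 0" "x = M$1$1" "M$2$1 \<noteq> 0 \<or> x \<noteq> M$2$2"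
    | "M$1$2 = 0" "x = M$1$1" "M$2$1 = 0" "x = M$2$2" by blast
  then show ?thesis
  proof cases
    case 1
    then show ?thesis using d
      by (intro that[of "vector [M$1$2, x - M$1$1]"]) (auto simp: vec2_eq_iff mv_nth algebra_simps)
  next
    case 2
    then show ?thesis using d
      by (intro that[of "vector [x - M$2$2, M$2$1]"]) (auto simp: vec2_eq_iff mv_nth algebra_simps)
  next
    case 3
    then show ?thesis
      by (intro that[of "vector [1, 0]"]) (auto simp: vec2_eq_iff mv_nth)
  qed
qed

lemma hyperbolic_axis:
  fixes M :: "real^2^2"
  assumes M: "det M = 1" "trace M > 2"
  obtains u v l where "l > 0" "trace M = 2 * cosh (l/2)" "wedge v u = 1"
    "M *v u = exp (- l/2) *\<^sub>R u" "M *v v = exp (l/2) *\<^sub>R v"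
proof -
  define l where "l = 2 * arcosh (trace M / 2)"
  have l: "l > 0" using assms by (simp add: l_def)
  have t: "trace M = 2 * cosh (l/2)" using assms by (simp add: l_def)
  have t': "trace M = exp (l/2) + exp (- l/2)" using t by (simp add: cosh_def)
  have p: "exp (l/2) * exp (- l/2) = 1" by (simp flip: exp_add)
  have i: "1 / exp (l/2) = exp (- l/2)" "1 / exp (- l/2) = exp (l/2)"
    using p by (metis exp_not_eq_zero nonzero_mult_div_cancel_left nonzero_mult_div_cancel_right)+
  obtain v where v: "v \<noteq> 0" "M *v v = exp (l/2) *\<^sub>R v"
    by (rule eigenvector_2[OF M(1), of "exp (l/2)"]) (simp_all only: exp_not_eq_zero t' i not_False_eq_True)
  obtain u where u: "u \<noteq> 0" "M *v u = exp (- l/2) *\<^sub>R u"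
    by (rule eigenvector_2[OF M(1), of "exp (- l/2)"]) (simp_all only: exp_not_eq_zero t' i not_False_eq_True add.commute)
  have nz: "wedge v u \<noteq> 0"
  proof
    assume "wedge v u = 0"
    then obtain c where c: "u = c *\<^sub>R v" using wedge_eq_0_imp v(1) by blast
    then have "exp (- l/2) *\<^sub>R u = exp (l/2) *\<^sub>R u"
      using u(2) v(2) by (simp add: matrix_vector_mult_scaleR mult.commute)
    then show False using u(1) l by simp
  qed
  show ?thesis
    by (rule that[OF l t, of "(1 / wedge v u) *\<^sub>R v" u])
      (use nz u v in \<open>simp_all add: matrix_vector_mult_scaleR mult.commute\<close>)
qed

text \<open>In a basis adapted to the fixed point the matrix is multiplication by a complex number of modulus one;
  the bound on the trace makes this number real.\<close>

lemma fixes_point_imp_pm1: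
  assumes M: "det M = 1" "\<bar>trace M\<bar> \<ge> 2" and z: "z \<in> upper_half_plane" "mat_act M z = z"
  shows "M = mat 1 \<or> M = - mat 1"
proof -
  obtain u v where uv: "wedge v u = 1" "z = proj_pt u v" using z(1) by (rule ex_proj_pt)
  have guv: "wedge (M *v v) (M *v u) = 1" using uv by (simp add: wedge_mult1 M)
  have vu: "wedge u v = -1" using uv wedge_commute[of u v] by simp
  have "proj_pt (M *v u) (M *v v) = proj_pt u v" using z uv by (simp add: mat_act_proj_pt M)
  then have 1: "wedge (M *v u) u = wedge (M *v v) v" and 2: "wedge (M *v u) v = - wedge (M *v v) u"
    using uv guv by (simp_all add: proj_pt_eq_iff)
  have tr: "trace M = wedge (M *v v) u + wedge v (M *v u)" using wedge_trace[of M v u] uv by simp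
  define x y where "x = wedge (M *v v) u" and "y = wedge (M *v u) u"
  have trx: "trace M = 2 * x" using tr 2 wedge_commute[of v "M *v u"] by (simp add: x_def)
  have Mu: "M *v u = x *\<^sub>R u + y *\<^sub>R v"
    using wedge_expand[of v u "M *v u"] uv(1) wedge_commute[of v "M *v u"] 2 by (simp add: x_def y_def add.commute)
  have Mv: "M *v v = x *\<^sub>R v - y *\<^sub>R u"
    using wedge_expand[of v u "M *v v"] uv(1) wedge_commute[of v "M *v v"] 1 by (simp add: x_def y_def)
  have "x * x + y * y = 1"
    using guv uv(1) vu unfolding Mu Mv by (simp add: wedge_add diff_conv_add_uminus del: add_uminus_conv_diff)
  moreover have "x * x \<ge> 1"
    using M(2) trx abs_le_square_iff[of 1 x] by (simp add: power2_eq_square abs_mult)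
  ultimately have "y * y \<le> 0" "x * x = 1 \<or> y * y > 0" by (linarith, smt (verit) zero_le_square)
  then have "y = 0" "x = 1 \<or> x = -1" by (auto simp: mult_le_0_iff square_eq_1_iff)
  then have "M *v v = x *\<^sub>R v" "M *v u = x *\<^sub>R u" using Mu Mv by simp_all
  then have "M = x *\<^sub>R mat 1"
    using uv(1) by (intro mat_eq_basis[of v u]) (simp_all add: scaleR_matrix_vector_assoc[symmetric])
  then show ?thesis using \<open>x = 1 \<or> x = -1\<close> by auto
qed

section \<open>Ping-pong on an ideal quadrilateral\<close>

text \<open>Letters are residues modulo four, and the inverse of \<open>k\<close> is \<open>k + 2\<close>; the order \<open>A\<close>, \<open>B inverse\<close>, \<open>A inverse\<close>, \<open>B\<close> of the
  generators is the cyclic order of the sides of the quadrilateral.\<close>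

definition cancels :: "int \<Rightarrow> int \<Rightarrow> bool" where
  "cancels i j \<longleftrightarrow> 4 dvd (i - j - 2)"

definition red_word :: "int list \<Rightarrow> bool" where
  "red_word = successively (\<lambda>i j. \<not> cancels i j)"

text \<open>The vertices \<open>v\<close> and side pairings \<open>X\<close> of an ideal quadrilateral, indexed modulo four: the cone of the letter \<open>k\<close>
  lies between \<open>v k\<close> and \<open>v (k + 1)\<close>, and \<open>k + 2\<close> is the inverse letter. Going once around the projective
  line reverses a vector, hence the sign in the first condition. The factor \<open>sg\<close> admits both orientations.\<close>

locale ideal_quad =
  fixes v :: "int \<Rightarrow> real^2" and X :: "int \<Rightarrow> real^2^2" and sg :: real
  assumes v4: "v (k + 4) = - v k"
    and X4: "X (k + 4) = X k"
    and detX: "det (X k) = 1"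
    and Xinv: "X k ** X (k + 2) = mat 1"
    and Xl: "X k *v v (k - 1) = v k"
    and Xr: "X k *v v (k + 2) = v (k + 1)"
    and pos: "\<lbrakk>k < j; j < k + 4\<rbrakk> \<Longrightarrow> sg * wedge (v k) (v j) > 0"
begin

definition swedge :: "real^2 \<Rightarrow> real^2 \<Rightarrow> real" where
  "swedge x y = sg * wedge x y"

lemma swedge_scaleR [simp]: "swedge (c *\<^sub>R x) y = c * swedge x y" "swedge x (c *\<^sub>R y) = c * swedge x y"
  by (simp_all add: swedge_def)

lemma swedge_minus [simp]: "swedge (- x) y = - swedge x y" "swedge x (- y) = - swedge x y"
  by (simp_all add: swedge_def)

lemma swedge_self [simp]: "swedge x x = 0"
  by (simp add: swedge_def)

lemma swedge_commute: "swedge x y = - swedge y x"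
  by (simp add: swedge_def wedge_commute[of x y])

lemma sg_nz: "sg \<noteq> 0"
  using pos[of 0 1] by auto

lemma swedge_X: "swedge (X k *v x) (X k *v y) = swedge x y"
  by (simp add: swedge_def wedge_mult1 detX)

lemma swedge_expand: "swedge p q * swedge x y = swedge x q * swedge p y + swedge p x * swedge q y"
proof -
  have "wedge p q * wedge x y = wedge x q * wedge p y + wedge p x * wedge q y"
    using wedge_plucker[of p q x y] wedge_commute[of q x] by (simp add: algebra_simps)
  from arg_cong[OF this, of "\<lambda>z. sg * sg * z"] show ?thesis by (simp add: swedge_def algebra_simps)
qed

lemma swedge_pos: "\<lbrakk>k < j; j < k + 4\<rbrakk> \<Longrightarrow> swedge (v k) (v j) > 0"
  using pos by (simp add: swedge_def)

lemma v_shift: "v (k + 4 * m) = (if even m then v k else - v k)"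
proof (induction m rule: int_induct[where k = 0])
  case (step1 i)
  then show ?case using v4[of "k + 4 * i"] by (auto simp: algebra_simps)
next
  case (step2 i)
  then show ?case using v4[of "k + 4 * (i - 1)"] by (auto simp: algebra_simps)
qed simp

lemma X_shift: "X (k + 4 * m) = X k"
proof (induction m rule: int_induct[where k = 0])
  case (step1 i)
  then show ?case using X4[of "k + 4 * i"] by (auto simp: algebra_simps)
next
  case (step2 i)
  then show ?case using X4[of "k + 4 * (i - 1)"] by (auto simp: algebra_simps)
qed simp

lemma X_cong: "4 dvd (i - j) \<Longrightarrow> X i = X j"
  using X_shift[of j] by (auto simp: dvd_def) (metis add.commute diff_add_cancel)

lemma Xinv': "X (k + 2) ** X k = mat 1"
  using Xinv[of "k + 2"] X4[of k] by (simp add: add.assoc add.commute)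

lemma cancels_inverse: "cancels i j \<Longrightarrow> X i ** X j = mat 1"
proof -
  assume "cancels i j"
  then have "X i = X (j + 2)" by (intro X_cong) (simp add: cancels_def algebra_simps)
  then show ?thesis by (simp add: Xinv')
qed

lemma X_cancel: "X (k + 2) *v (X k *v x) = x" "X k *v (X (k + 2) *v x) = x"
  by (simp_all add: matrix_vector_mul_assoc Xinv Xinv')

definition in_cone :: "int \<Rightarrow> real^2 \<Rightarrow> bool" where
  "in_cone k e \<longleftrightarrow> swedge (v k) e > 0 \<and> swedge e (v (k + 1)) > 0"

definition in_closed_cone :: "int \<Rightarrow> real^2 \<Rightarrow> bool" where
  "in_closed_cone k e \<longleftrightarrow> swedge (v k) e \<ge> 0 \<and> swedge e (v (k + 1)) \<ge> 0"

definition in_proj_cone :: "int \<Rightarrow> real^2 \<Rightarrow> bool" where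
  "in_proj_cone k e \<longleftrightarrow> in_cone k e \<or> in_cone k (- e)"

lemma in_cone_X: "in_cone k (X k *v e) \<longleftrightarrow> swedge (v (k - 1)) e > 0 \<and> swedge e (v (k + 2)) > 0"
  using swedge_X[of k "v (k - 1)" e] swedge_X[of k e "v (k + 2)"] by (simp add: in_cone_def Xl Xr)

lemma in_closed_cone_X: "in_closed_cone k (X k *v e) \<longleftrightarrow> swedge (v (k - 1)) e \<ge> 0 \<and> swedge e (v (k + 2)) \<ge> 0"
  using swedge_X[of k "v (k - 1)" e] swedge_X[of k e "v (k + 2)"] by (simp add: in_closed_cone_def Xl Xr)

lemma in_cone_left:
  assumes "in_cone j e" "m \<le> j" "j + 1 < m + 4"
  shows "swedge (v m) e > 0"
proof -
  have "swedge (v j) (v (j+1)) * swedge (v m) e = swedge (v m) (v (j+1)) * swedge (v j) e + swedge (v j) (v m) * swedge (v (j+1)) e"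
    by (rule swedge_expand)
  also have "swedge (v j) (v m) * swedge (v (j+1)) e = swedge (v m) (v j) * swedge e (v (j+1))"
    by (simp add: swedge_commute[of "v j" "v m"] swedge_commute[of _ e])
  also have "swedge (v m) (v (j+1)) * swedge (v j) e > 0"
    using assms swedge_pos[of m "j+1"] by (simp add: in_cone_def)
  moreover have "swedge (v m) (v j) * swedge e (v (j+1)) \<ge> 0"
    using assms swedge_pos[of m j] by (cases "m = j") (simp_all add: in_cone_def)
  ultimately show ?thesis using swedge_pos[of j "j+1"] by (smt (verit) zero_less_mult_pos)
qed

lemma in_cone_right:
  assumes "in_cone j e" "j + 1 \<le> m" "m < j + 4"
  shows "swedge e (v m) > 0"
proof -
  have "swedge (v j) (v (j+1)) * swedge e (v m) = swedge e (v (j+1)) * swedge (v j) (v m) + swedge (v j) e * swedge (v (j+1)) (v m)"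
    by (rule swedge_expand)
  moreover have "swedge e (v (j+1)) * swedge (v j) (v m) > 0"
    using assms swedge_pos[of j m] by (simp add: in_cone_def)
  moreover have "swedge (v j) e * swedge (v (j+1)) (v m) \<ge> 0"
    using assms swedge_pos[of "j+1" m] by (cases "m = j + 1") (simp_all add: in_cone_def)
  ultimately show ?thesis using swedge_pos[of j "j+1"] by (smt (verit) zero_less_mult_pos)
qed

lemma in_closed_cone_left:
  assumes "in_closed_cone j e" "m \<le> j" "j + 1 < m + 4"
  shows "swedge (v m) e \<ge> 0"
proof -
  have "swedge (v j) (v (j+1)) * swedge (v m) e = swedge (v m) (v (j+1)) * swedge (v j) e + swedge (v j) (v m) * swedge (v (j+1)) e"
    by (rule swedge_expand)
  also have "swedge (v j) (v m) * swedge (v (j+1)) e = swedge (v m) (v j) * swedge e (v (j+1))"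
    by (simp add: swedge_commute[of "v j" "v m"] swedge_commute[of _ e])
  also have "swedge (v m) (v (j+1)) * swedge (v j) e \<ge> 0"
    using assms swedge_pos[of m "j+1"] by (simp add: in_closed_cone_def)
  moreover have "swedge (v m) (v j) * swedge e (v (j+1)) \<ge> 0"
    using assms swedge_pos[of m j] by (cases "m = j") (simp_all add: in_closed_cone_def)
  ultimately show ?thesis using swedge_pos[of j "j+1"] by (smt (verit) mult_pos_neg)
qed

lemma in_closed_cone_right:
  assumes "in_closed_cone j e" "j + 1 \<le> m" "m < j + 4"
  shows "swedge e (v m) \<ge> 0"
proof -
  have "swedge (v j) (v (j+1)) * swedge e (v m) = swedge e (v (j+1)) * swedge (v j) (v m) + swedge (v j) e * swedge (v (j+1)) (v m)"
    by (rule swedge_expand)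
  moreover have "swedge e (v (j+1)) * swedge (v j) (v m) \<ge> 0"
    using assms swedge_pos[of j m] by (simp add: in_closed_cone_def)
  moreover have "swedge (v j) e * swedge (v (j+1)) (v m) \<ge> 0"
    using assms swedge_pos[of "j+1" m] by (cases "m = j + 1") (simp_all add: in_closed_cone_def)
  ultimately show ?thesis using swedge_pos[of j "j+1"] by (smt (verit) mult_pos_neg)
qed

lemma in_cone_order:
  assumes "in_cone i e" "in_cone j f" "i < j" "j < i + 4"
  shows "swedge e f > 0"
proof -
  have "swedge (v j) (v (j+1)) * swedge e f = swedge e (v (j+1)) * swedge (v j) f + swedge (v j) e * swedge (v (j+1)) f"
    by (rule swedge_expand)
  also have "swedge (v j) e * swedge (v (j+1)) f = swedge e (v j) * swedge f (v (j+1))"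
    by (simp add: swedge_commute[of "v j" e] swedge_commute[of _ f])
  moreover have "swedge e (v j) * swedge f (v (j+1)) > 0"
    using assms in_cone_right[OF assms(1), of j] by (simp add: in_cone_def)
  moreover have "swedge e (v (j+1)) > 0"
  proof (cases "j + 1 = i + 4")
    case True
    have "v (j + 1) = - v i" unfolding True by (rule v4)
    then show ?thesis using assms(1) swedge_commute[of e "v i"] by (simp add: in_cone_def)
  next
    case False
    then show ?thesis using assms in_cone_right[OF assms(1), of "j+1"] by simp
  qed
  then have "swedge e (v (j+1)) * swedge (v j) f > 0" using assms(2) by (simp add: in_cone_def)
  ultimately show ?thesis using swedge_pos[of j "j+1"] by (smt (verit) zero_less_mult_pos)
qed

lemma cone_shift:
  assumes "4 dvd (i - j)"
  obtains \<sigma> where "\<sigma> = 1 \<or> \<sigma> = (-1::real)" "\<And>e. in_cone i e \<longleftrightarrow> in_cone j (\<sigma> *\<^sub>R e)" "\<And>e. in_closed_cone i e \<longleftrightarrow> in_closed_cone j (\<sigma> *\<^sub>R e)"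
proof -
  obtain m where m: "i = j + 4 * m" using assms by (auto simp: dvd_def algebra_simps)
  have m1: "i + 1 = (j + 1) + 4 * m" using m by simp
  have *: "v i = (if even m then v j else - v j)" "v (i+1) = (if even m then v (j+1) else - v (j+1))"
    using v_shift[of j m] v_shift[of "j + 1" m] m m1 by (auto simp: algebra_simps)
  show ?thesis
    by (rule that[of "if even m then 1 else -1"]) (auto simp: in_cone_def in_closed_cone_def *)
qed

lemma in_proj_cone_uminus [simp]: "in_proj_cone k (- e) \<longleftrightarrow> in_proj_cone k e"
  by (auto simp: in_proj_cone_def)

lemma in_proj_cone_scale: "c \<noteq> 0 \<Longrightarrow> in_proj_cone k (c *\<^sub>R e) \<longleftrightarrow> in_proj_cone k e"
  by (cases "c > 0") (auto simp: in_proj_cone_def in_cone_def zero_less_mult_iff mult_less_0_iff)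

lemma in_proj_cone_cong: "4 dvd (i - j) \<Longrightarrow> in_proj_cone i e \<longleftrightarrow> in_proj_cone j e"
  by (erule cone_shift[of i j]) (auto simp: in_proj_cone_def)

lemma in_proj_cone_obtain:
  assumes "in_proj_cone k e" "4 dvd (k - i)"
  obtains \<sigma> where "\<sigma> = 1 \<or> \<sigma> = (-1::real)" "in_cone i (\<sigma> *\<^sub>R e)"
proof -
  have "in_proj_cone i e" using assms in_proj_cone_cong by blast
  then show ?thesis using that[of 1] that[of "-1"] by (auto simp: in_proj_cone_def)
qed

lemma in_proj_cone_disjoint:
  assumes "in_proj_cone i e" "in_proj_cone j e"
  shows "4 dvd (i - j)"
proof (rule ccontr)
  assume a: "\<not> 4 dvd (i - j)"
  define k where "k = i + 1 + (j - i - 1) mod 4"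
  have k: "i < k" "k < i + 4" "4 dvd (j - k)"
  proof -
    have "(j - i - 1) mod 4 \<noteq> 3" using a by presburger
    then show "k < i + 4" unfolding k_def by (smt (verit) pos_mod_bound)
    show "i < k" unfolding k_def by (smt (verit) pos_mod_sign)
    show "4 dvd (j - k)" unfolding k_def by presburger
  qed
  obtain s where s: "s = 1 \<or> s = (-1::real)" "in_cone k (s *\<^sub>R e)" using in_proj_cone_obtain[OF assms(2) k(3)] .
  obtain r where r: "r = 1 \<or> r = (-1::real)" "in_cone i (r *\<^sub>R e)" using in_proj_cone_obtain[OF assms(1), of i] by auto
  show False using in_cone_order[OF r(2) s(2) k(1,2)] by simp
qed

text \<open>A letter maps every cone except the one of its inverse into its own cone. One sign serves
  the whole cone, so that products of letters act on a cone by nonnegative matrices up to sign.\<close>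

lemma letter_maps:
  assumes "\<not> cancels k j"
  obtains \<sigma> where "\<sigma> = 1 \<or> \<sigma> = (-1::real)"
    "\<And>e. in_cone j e \<Longrightarrow> in_cone k (\<sigma> *\<^sub>R (X k *v e))" "\<And>e. in_closed_cone j e \<Longrightarrow> in_closed_cone k (\<sigma> *\<^sub>R (X k *v e))"
proof -
  define i where "i = k - 1 + (j - k + 1) mod 4"
  have "(j - k + 1) mod 4 \<noteq> 3" using assms unfolding cancels_def by presburger
  then have i: "k - 1 \<le> i" "i \<le> k + 1" "4 dvd (j - i)"
    unfolding i_def by (smt (verit) pos_mod_sign, smt (verit) pos_mod_bound, presburger)
  obtain \<sigma> where s: "\<sigma> = 1 \<or> \<sigma> = (-1::real)" "\<And>e. in_cone j e \<longleftrightarrow> in_cone i (\<sigma> *\<^sub>R e)" "\<And>e. in_closed_cone j e \<longleftrightarrow> in_closed_cone i (\<sigma> *\<^sub>R e)"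
    using cone_shift[OF i(3)] by metis
  show ?thesis
  proof (rule that[OF s(1)])
    fix e assume "in_cone j e"
    then have "in_cone i (\<sigma> *\<^sub>R e)" using s by simp
    then have "in_cone k (X k *v (\<sigma> *\<^sub>R e))" 
      unfolding in_cone_X using i in_cone_left[of i "\<sigma> *\<^sub>R e" "k - 1"] in_cone_right[of i "\<sigma> *\<^sub>R e" "k + 2"]
      by (simp del: swedge_scaleR)
    then show "in_cone k (\<sigma> *\<^sub>R (X k *v e))" by (simp add: matrix_vector_mult_scaleR)
  next
    fix e assume "in_closed_cone j e"
    then have "in_closed_cone i (\<sigma> *\<^sub>R e)" using s by simp
    then have "in_closed_cone k (X k *v (\<sigma> *\<^sub>R e))" 
      unfolding in_closed_cone_X using i in_closed_cone_left[of i "\<sigma> *\<^sub>R e" "k - 1"] in_closed_cone_right[of i "\<sigma> *\<^sub>R e" "k + 2"]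
      by (simp del: swedge_scaleR)
    then show "in_closed_cone k (\<sigma> *\<^sub>R (X k *v e))" by (simp add: matrix_vector_mult_scaleR)
  qed
qed

primrec word_prod :: "int list \<Rightarrow> real^2^2" where
  "word_prod [] = mat 1"
| "word_prod (k # w) = X k ** word_prod w"

lemma word_prod_append: "word_prod (a @ b) = word_prod a ** word_prod b"
  by (induction a) (simp_all add: matrix_mul_assoc)

lemma det_word_prod: "det (word_prod w) = 1"
  by (induction w) (simp_all add: det_mul detX)

lemma word_maps:
  assumes "red_word w" "w \<noteq> []" "\<not> cancels (last w) j"
  shows "\<exists>\<sigma>. (\<sigma> = 1 \<or> \<sigma> = (-1::real)) \<and> (\<forall>e. in_cone j e \<longrightarrow> in_cone (hd w) (\<sigma> *\<^sub>R (word_prod w *v e))) \<and>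
    (\<forall>e. in_closed_cone j e \<longrightarrow> in_closed_cone (hd w) (\<sigma> *\<^sub>R (word_prod w *v e)))"
  using assms
proof (induction w)
  case (Cons k w)
  show ?case
  proof (cases "w = []")
    case True
    then have nc: "\<not> cancels k j" using Cons.prems by simp
    show ?thesis by (rule letter_maps[OF nc]) (use True in auto)
  next
    case False
    then have r: "red_word w" "\<not> cancels k (hd w)" using Cons.prems
      by (auto simp: red_word_def successively_Cons)
    obtain \<sigma> where s: "\<sigma> = 1 \<or> \<sigma> = (-1::real)" "\<And>e. in_cone j e \<Longrightarrow> in_cone (hd w) (\<sigma> *\<^sub>R (word_prod w *v e))"
      "\<And>e. in_closed_cone j e \<Longrightarrow> in_closed_cone (hd w) (\<sigma> *\<^sub>R (word_prod w *v e))"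
      using Cons.IH[OF r(1) False] Cons.prems False by auto
    obtain \<tau> where t: "\<tau> = 1 \<or> \<tau> = (-1::real)" "\<And>e. in_cone (hd w) e \<Longrightarrow> in_cone k (\<tau> *\<^sub>R (X k *v e))"
      "\<And>e. in_closed_cone (hd w) e \<Longrightarrow> in_closed_cone k (\<tau> *\<^sub>R (X k *v e))"
      using letter_maps[OF r(2)] by metis
    have eq: "(\<tau> * \<sigma>) *\<^sub>R (word_prod (k # w) *v e) = \<tau> *\<^sub>R (X k *v (\<sigma> *\<^sub>R (word_prod w *v e)))" for e
      by (simp add: matrix_vector_mult_scaleR flip: matrix_vector_mul_assoc)
    have "\<tau> * \<sigma> = 1 \<or> \<tau> * \<sigma> = -1" using s(1) t(1) by auto
    then show ?thesis
      using s(2,3) t(2,3) by (intro exI[of _ "\<tau> * \<sigma>"]) (simp add: eq del: word_prod.simps)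
  qed
qed simp

lemma word_maps_in_proj_cone:
  assumes "red_word w" "w \<noteq> []" "\<not> cancels (last w) j" "in_proj_cone j e"
  shows "in_proj_cone (hd w) (word_prod w *v e)"
proof -
  obtain \<sigma> where s: "\<sigma> = 1 \<or> \<sigma> = (-1::real)" "\<And>e. in_cone j e \<Longrightarrow> in_cone (hd w) (\<sigma> *\<^sub>R (word_prod w *v e))"
    using word_maps[OF assms(1-3)] by auto
  have "in_cone j e \<or> in_cone j (-e)" using assms(4) by (simp add: in_proj_cone_def)
  then have "in_proj_cone (hd w) (\<sigma> *\<^sub>R (word_prod w *v e)) \<or> in_proj_cone (hd w) (\<sigma> *\<^sub>R (word_prod w *v (- e)))"
    using s(2) by (auto simp: in_proj_cone_def)
  moreover have "word_prod w *v (- e) = - (word_prod w *v e)"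
    using matrix_vector_mult_scaleR[of "word_prod w" "-1" e] by simp
  ultimately show ?thesis using s(1) in_proj_cone_scale[of \<sigma>] by (auto simp: in_proj_cone_scale)
qed

lemma ex_in_proj_cone: "in_cone k (v k + v (k + 1))"
  using swedge_pos[of k "k+1"] by (simp add: in_cone_def swedge_def wedge_add)

text \<open>A nonempty reduced word carries a suitable cone into a different one.\<close>

lemma red_word_not_pm1:
  assumes "red_word w" "w \<noteq> []"
  shows "word_prod w \<noteq> mat 1" "word_prod w \<noteq> - mat 1"
proof -
  have "\<exists>j. \<not> cancels b j \<and> \<not> 4 dvd (a - j)" for a b
  proof (cases "4 dvd (a - b)")
    case True
    then show ?thesis unfolding cancels_def by (intro exI[of _ "b + 1"]) presburger
  next
    case False
    then show ?thesis unfolding cancels_def by (intro exI[of _ b]) presburger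
  qed
  then obtain j where j: "\<not> cancels (last w) j" "\<not> 4 dvd (hd w - j)" by blast
  have p: "in_proj_cone j (v j + v (j + 1))" using ex_in_proj_cone by (simp add: in_proj_cone_def)
  from word_maps_in_proj_cone[OF assms j(1) this] have *: "in_proj_cone (hd w) (word_prod w *v (v j + v (j + 1)))" .
  show "word_prod w \<noteq> mat 1" using * p in_proj_cone_disjoint j by auto
  show "word_prod w \<noteq> - mat 1"
  proof
    assume "word_prod w = - mat 1"
    then have "word_prod w *v (v j + v (j + 1)) = - (v j + v (j + 1))"
      by (simp add: vec2_eq_iff mv_nth mat_def)
    then have "in_proj_cone (hd w) (v j + v (j + 1))" using * in_proj_cone_uminus by metis
    then show False using p in_proj_cone_disjoint j by blast
  qed
qed

lemma ex_red_word: "\<exists>w'. red_word w' \<and> word_prod w' = word_prod w"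
proof (induction w)
  case (Cons k w)
  then obtain w' where w': "red_word w'" "word_prod w' = word_prod w" by blast
  show ?case
  proof (cases "w' \<noteq> [] \<and> cancels k (hd w')")
    case True
    then obtain j r where jr: "w' = j # r" "cancels k j" by (cases w') auto
    have "word_prod r = X k ** X j ** word_prod r" by (simp add: cancels_inverse[OF jr(2)])
    also have "\<dots> = X k ** word_prod w'" by (simp add: jr matrix_mul_assoc)
    finally have "word_prod r = word_prod (k # w)" using w' by simp
    moreover have "red_word r" using w' jr by (auto simp: red_word_def successively_Cons)
    ultimately show ?thesis by blast
  next
    case False
    then have "red_word (k # w')" using w' by (auto simp: red_word_def successively_Cons)
    then show ?thesis using w' by (intro exI[of _ "k # w'"]) simp
  qed
qed (auto simp: red_word_def intro!: exI[of _ "[]"])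

definition inv_word :: "int list \<Rightarrow> int list" where
  "inv_word w = rev (map (\<lambda>k. k + 2) w)"

lemma word_prod_inv_word: "word_prod w ** word_prod (inv_word w) = mat 1" "word_prod (inv_word w) ** word_prod w = mat 1"
proof -
  have "word_prod (inv_word w) ** word_prod w = mat 1" for w
  proof (induction w)
    case (Cons k w)
    have "word_prod (inv_word (k # w)) ** word_prod (k # w) = word_prod (inv_word w) ** (X (k + 2) ** X k) ** word_prod w"
      by (simp add: inv_word_def word_prod_append matrix_mul_assoc)
    then show ?case using Cons by (simp add: Xinv')
  qed (simp add: inv_word_def)
  then show *: "word_prod (inv_word w) ** word_prod w = mat 1" .
  show "word_prod w ** word_prod (inv_word w) = mat 1"
    using * matrix_left_right_inverse by blast
qed

lemma matrix_inv_word_prod: "matrix_inv (word_prod w) = word_prod (inv_word w)"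
  by (rule matrix_inv_unique2) (simp_all add: det_word_prod word_prod_inv_word)

definition cyc_red_word :: "int list \<Rightarrow> bool" where
  "cyc_red_word w \<longleftrightarrow> red_word w \<and> (w \<noteq> [] \<longrightarrow> \<not> cancels (last w) (hd w))"

lemma ex_cyc_red_word:
  "\<exists>h w'. cyc_red_word w' \<and> word_prod w = word_prod h ** word_prod w' ** word_prod (inv_word h)"
proof -
  have "red_word w \<Longrightarrow> \<exists>h w'. cyc_red_word w' \<and> word_prod w = word_prod h ** word_prod w' ** word_prod (inv_word h)" for w
  proof (induction w rule: length_induct)
    case (1 w)
    show ?case
    proof (cases "cyc_red_word w")
      case True
      then show ?thesis by (intro exI[of _ "[]"] exI[of _ w]) (simp add: inv_word_def)
    next
      case False
      then have w: "w \<noteq> []" "cancels (last w) (hd w)" using 1(2) by (auto simp: cyc_red_word_def)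
      define k where "k = hd w"
      have "tl w \<noteq> []"
      proof
        assume "tl w = []"
        then have "last w = hd w" using w(1) by (metis last.simps list.exhaust_sel)
        then show False using w(2) by (simp add: cancels_def)
      qed
      define r where "r = butlast (tl w)"
      have wr: "w = k # r @ [last w]"
        using w(1) \<open>tl w \<noteq> []\<close> unfolding k_def r_def by (metis append_butlast_last_id last_tl list.collapse)
      have "X (last w) = X (k + 2)"
        using w(2) by (intro X_cong) (simp add: cancels_def k_def algebra_simps)
      then have eq: "word_prod w = X k ** word_prod r ** X (k + 2)"
        by (subst wr) (simp add: word_prod_append matrix_mul_assoc)
      have "red_word r" using 1(2) unfolding red_word_def
        by (subst (asm) wr) (auto simp: successively_Cons successively_append_iff)
      moreover have "length w = length r + 2" by (subst wr) simp
      then have "length r < length w" by simp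
      ultimately obtain h w' where h: "cyc_red_word w'" "word_prod r = word_prod h ** word_prod w' ** word_prod (inv_word h)"
        using 1(1) by blast
      have "word_prod w = word_prod (k # h) ** word_prod w' ** word_prod (inv_word (k # h))"
        by (simp add: eq h(2) inv_word_def word_prod_append matrix_mul_assoc)
      then show ?thesis using h(1) by blast
    qed
  qed
  then show ?thesis using ex_red_word[of w] by metis
qed

end

text \<open>A statement of Perron-Frobenius type: a matrix that is nonnegative in some basis up to sign is not elliptic,
  and its expanding eigenvector lies in the cone of the basis.\<close>

lemma nonneg_trace:
  fixes P Q :: "real^2"
  assumes M: "det M = 1" and s: "s = 1 \<or> s = (-1::real)" and g: "g * wedge P Q > 0"
    and nn: "g * wedge P (s *\<^sub>R (M *v P)) \<ge> 0" "g * wedge (s *\<^sub>R (M *v P)) Q \<ge> 0"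
      "g * wedge P (s *\<^sub>R (M *v Q)) \<ge> 0" "g * wedge (s *\<^sub>R (M *v Q)) Q \<ge> 0"
  shows "\<bar>trace M\<bar> \<ge> 2"
    and "\<lbrakk>M *v e = x *\<^sub>R e; \<bar>x\<bar> > 1\<rbrakk> \<Longrightarrow> (g * wedge P e) * (g * wedge e Q) \<ge> 0"
proof -
  define t where "t = g * wedge P Q"
  have t: "t > 0" using g by (simp add: t_def)
  have s2: "s * s = 1" using s by auto
  define a b c d where "a = g * wedge (s *\<^sub>R (M *v P)) Q" and "b = g * wedge (s *\<^sub>R (M *v Q)) Q"
    and "c = g * wedge P (s *\<^sub>R (M *v P))" and "d = g * wedge P (s *\<^sub>R (M *v Q))"
  have nn': "a \<ge> 0" "b \<ge> 0" "c \<ge> 0" "d \<ge> 0" using nn by (simp_all add: a_def b_def c_def d_def)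
  have MPQ: "wedge (M *v P) (M *v Q) = wedge P Q" by (rule wedge_mult1[OF M])
  have pl: "wedge P Q * wedge P Q = wedge (M *v P) P * wedge (M *v Q) Q - wedge (M *v P) Q * wedge (M *v Q) P"
    using wedge_plucker[of "M *v P" "M *v Q" P Q] MPQ by simp
  have "a * d - b * c = (s * s) * (g * g) * (wedge (M *v P) Q * wedge P (M *v Q) - wedge (M *v Q) Q * wedge P (M *v P))"
    by (simp add: a_def b_def c_def d_def algebra_simps)
  also have "wedge (M *v P) Q * wedge P (M *v Q) - wedge (M *v Q) Q * wedge P (M *v P) = wedge P Q * wedge P Q"
    using pl by (simp add: wedge_commute[of P "M *v P"] wedge_commute[of P "M *v Q"] algebra_simps)
  also have "(s * s) * (g * g) * (wedge P Q * wedge P Q) = t * t" by (simp add: s2 t_def)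
  finally have det: "a * d - b * c = t * t" .
  have tr: "s * trace M * t = a + d"
    using arg_cong[OF wedge_trace[of M P Q], of "\<lambda>z. s * g * z"]
    by (simp add: t_def a_def d_def algebra_simps)
  show "\<bar>trace M\<bar> \<ge> 2"
  proof -
    have "(a + d)\<^sup>2 = (a - d)\<^sup>2 + 4 * (a * d)" by (simp add: power2_eq_square algebra_simps)
    moreover have "a * d \<ge> t * t" using det nn' mult_nonneg_nonneg[of b c] by linarith
    moreover have "(a - d)\<^sup>2 \<ge> 0" by simp
    moreover have "(2 * t)\<^sup>2 = 4 * (t * t)" by (simp add: power2_eq_square)
    ultimately have "(a + d)\<^sup>2 \<ge> (2 * t)\<^sup>2" by linarith
    then have "a + d \<ge> 2 * t" by (rule power2_le_imp_le) (use nn' in linarith)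
    then have "s * trace M \<ge> 2" using tr t mult_le_cancel_right_pos[OF t, of 2 "s * trace M"] by linarith
    then show ?thesis using s by auto
  qed
  show "(g * wedge P e) * (g * wedge e Q) \<ge> 0" if e: "M *v e = x *\<^sub>R e" "\<bar>x\<bar> > 1"
  proof (rule ccontr)
    define p q where "p = g * wedge e Q" and "q = g * wedge P e"
    assume "\<not> ?thesis"
    then have pq: "p * q < 0" by (simp add: p_def q_def mult.commute)
    define y where "y = s * x"
    have y2: "y * y > 1"
    proof -
      have "y * y = \<bar>x\<bar> * \<bar>x\<bar>" using s2 by (simp add: y_def mult_ac)
      also have "\<dots> > 1 * 1" using e(2) by (intro mult_strict_mono) auto
      finally show ?thesis by simp
    qed
    have ex: "wedge P Q *\<^sub>R (M *v e) = wedge e Q *\<^sub>R (M *v P) + wedge P e *\<^sub>R (M *v Q)"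
      using arg_cong[OF wedge_expand[of P Q e], of "\<lambda>z. M *v z"]
      by (simp add: matrix_vector_right_distrib matrix_vector_mult_scaleR)
    have e1: "y * p * t = a * p + b * q"
      using arg_cong[OF ex, of "\<lambda>z. s * g * g * wedge z Q"] e(1)
      by (simp add: wedge_add y_def p_def q_def t_def a_def b_def algebra_simps)
    have e2: "y * q * t = c * p + d * q"
      using arg_cong[OF ex, of "\<lambda>z. s * g * g * wedge P z"] e(1)
      by (simp add: wedge_add y_def p_def q_def t_def c_def d_def algebra_simps)
    have "(y * t - a) * p = b * q" "(y * t - d) * q = c * p" using e1 e2 by (simp_all add: algebra_simps)
    then have "((y * t - a) * (y * t - d)) * (p * q) = (b * c) * (p * q)" by algebra
    then have ch: "(y * t - a) * (y * t - d) = b * c" using pq by auto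
    then have ch': "(y * t) * (y * t) + t * t = (a + d) * (y * t)" using det by algebra
    have "p \<noteq> 0" "q \<noteq> 0" using pq by auto
    have "(y * t - a) * (p * p) = b * (p * q)" "(y * t - d) * (q * q) = c * (p * q)"
      using e1 e2 by algebra+
    then have "(y * t - a) * (p * p) \<le> 0" "(y * t - d) * (q * q) \<le> 0"
      using mult_nonneg_nonpos[of b "p * q"] mult_nonneg_nonpos[of c "p * q"] pq nn' by linarith+
    then have le: "y * t \<le> a" "y * t \<le> d"
      using \<open>p \<noteq> 0\<close> \<open>q \<noteq> 0\<close> by (auto simp: mult_le_0_iff not_sum_squares_lt_zero zero_less_mult_iff
        dest: order_antisym)
    have "(a + d) * (y * t) > 0"
      using ch' t by (metis add_nonneg_pos mult_pos_pos zero_le_square)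
    then have "y * t > 0" using nn' by (simp add: zero_less_mult_iff)
    then have "(a + d) * (y * t) \<ge> (y * t + y * t) * (y * t)" using le \<open>y * t > 0\<close> by (intro mult_right_mono add_mono) auto
    then have "t * t \<ge> (y * y) * (t * t)" using ch' by (simp add: algebra_simps)
    moreover have "(y * y) * (t * t) > 1 * (t * t)" using y2 t by (intro mult_strict_right_mono) auto
    ultimately show False by simp
  qed
qed

context ideal_quad
begin

lemma nonneg_cyc:
  assumes "cyc_red_word w" "w \<noteq> []"
  shows "\<bar>trace (word_prod w)\<bar> \<ge> 2"
    and "\<lbrakk>word_prod w *v e = x *\<^sub>R e; \<bar>x\<bar> > 1\<rbrakk> \<Longrightarrow> swedge (v (hd w)) e * swedge e (v (hd w + 1)) \<ge> 0"
proof -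
  let ?k = "hd w"
  obtain \<sigma> where s: "\<sigma> = 1 \<or> \<sigma> = (-1::real)" "\<And>e. in_closed_cone ?k e \<Longrightarrow> in_closed_cone ?k (\<sigma> *\<^sub>R (word_prod w *v e))"
    using word_maps[of w ?k] assms by (auto simp: cyc_red_word_def)
  have g: "sg * wedge (v ?k) (v (?k + 1)) > 0" by (rule pos) auto
  have "in_closed_cone ?k (v ?k)" "in_closed_cone ?k (v (?k + 1))"
    using swedge_pos[of ?k "?k + 1"] by (simp_all add: in_closed_cone_def)
  then have c: "in_closed_cone ?k (\<sigma> *\<^sub>R (word_prod w *v v ?k))" "in_closed_cone ?k (\<sigma> *\<^sub>R (word_prod w *v v (?k + 1)))"
    using s(2) by blast+
  note nt = nonneg_trace[OF det_word_prod s(1) g, of w, folded swedge_def, OF _ _ _ _]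
  show "\<bar>trace (word_prod w)\<bar> \<ge> 2" by (rule nt(1)) (use c in \<open>auto simp: in_closed_cone_def\<close>)
  show "swedge (v ?k) e * swedge e (v (?k + 1)) \<ge> 0" if "word_prod w *v e = x *\<^sub>R e" "\<bar>x\<bar> > 1"
    by (rule nt(2)[OF _ _ _ _ that]) (use c in \<open>auto simp: in_closed_cone_def\<close>)
qed

text \<open>The group acts freely: an element fixing a point would be elliptic up to conjugation,
  whereas nonnegative matrices of determinant one are not.\<close>

lemma fixes_point:
  assumes z: "z \<in> upper_half_plane" "mat_act (word_prod w) z = z"
  shows "word_prod w = mat 1"
proof -
  obtain h w' where h: "cyc_red_word w'" "word_prod w = word_prod h ** word_prod w' ** word_prod (inv_word h)"
    using ex_cyc_red_word by blast
  show ?thesis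
  proof (cases "w' = []")
    case True
    then show ?thesis using h(2) by (simp add: word_prod_inv_word)
  next
    case False
    define y where "y = mat_act (word_prod (inv_word h)) z"
    have y: "y \<in> upper_half_plane" unfolding y_def by (intro mat_act_H det_word_prod z)
    have "mat_act (word_prod w' ** word_prod (inv_word h)) z = mat_act (word_prod (inv_word h) ** word_prod w) z"
      unfolding h(2) by (simp add: matrix_mul_assoc word_prod_inv_word)
    then have "mat_act (word_prod w') y = y"
      unfolding y_def using z by (simp add: mat_act_comp det_word_prod)
    then have "word_prod w' = mat 1 \<or> word_prod w' = - mat 1"
      using fixes_point_imp_pm1[OF det_word_prod nonneg_cyc(1)[OF h(1) False] y] by blast
    then show ?thesis using red_word_not_pm1[of w'] h(1) False by (auto simp: cyc_red_word_def)
  qed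
qed

primrec seg :: "(int \<Rightarrow> int) \<Rightarrow> int \<Rightarrow> nat \<Rightarrow> int list" where
  "seg x i 0 = []"
| "seg x i (Suc m) = x i # seg x (i + 1) m"

lemma length_seg [simp]: "length (seg x i m) = m"
  by (induction m arbitrary: i) auto

lemma seg_nth: "k < m \<Longrightarrow> seg x i m ! k = x (i + int k)"
  by (induction m arbitrary: i k) (auto simp: nth_Cons algebra_simps split: nat.split)

lemma red_word_seg: "(\<And>i. \<not> cancels (x i) (x (i + 1))) \<Longrightarrow> red_word (seg x i m)"
  by (auto simp: red_word_def successively_conv_nth seg_nth) (metis add.assoc add.commute)

lemma word_prod_seg: "(\<And>i. e i = X (x i) *v e (i + 1)) \<Longrightarrow> e i = word_prod (seg x i m) *v e (i + int m)"
proof (induction m arbitrary: i)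
  case 0
  show ?case by simp
next
  case (Suc m)
  have "e i = X (x i) *v e (i + 1)" by (rule Suc.prems)
  also have "e (i + 1) = word_prod (seg x (i + 1) m) *v e (i + 1 + int m)" by (rule Suc.IH[OF Suc.prems])
  finally show ?case by (simp add: matrix_vector_mul_assoc add.assoc)
qed

lemma v_nz: "v k \<noteq> 0"
  using swedge_pos[of k "k+1"] by (auto simp: swedge_def)

lemma v_cong: "4 dvd (i - j) \<Longrightarrow> v i = v j \<or> v i = - v j"
  using v_shift[of j] by (auto simp: dvd_def) (metis add.commute diff_add_cancel)

lemma rep4: "\<exists>m\<in>{i, i + 1, i + 2, i + 3}. 4 dvd (j - m)" for i j :: int
  by (simp add: dvd_def) presburger

lemma swedge_v_0: "swedge (v i) (v j) = 0 \<Longrightarrow> 4 dvd (j - i)"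
proof (rule ccontr)
  assume a: "swedge (v i) (v j) = 0" "\<not> 4 dvd (j - i)"
  obtain m where m: "m \<in> {i, i + 1, i + 2, i + 3}" "4 dvd (j - m)" using rep4 by blast
  then have "swedge (v i) (v m) > 0" using a(2) swedge_pos by auto
  then show False using v_cong[OF m(2)] a(1) by auto
qed

lemma X_inv_v: "X (k + 2) *v v k = v (k - 1)" "X (k + 2) *v v (k + 1) = v (k + 2)"
  using X_cancel(1)[of k "v (k - 1)"] X_cancel(1)[of k "v (k + 2)"] by (simp_all add: Xl Xr)

text \<open>An eigenvector on the boundary of a cone would be a cusp, and letters move cusps to cusps
  without rescaling them. Hence the eigenvalue would be \<open>\<plusminus>1\<close>.\<close>

lemma endpoints:
  fixes x :: "int \<Rightarrow> int" and e :: "int \<Rightarrow> real^2"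
  assumes x: "\<And>i. \<not> cancels (x i) (x (i + 1))" "\<And>i. x (i + int n) = x i" and n: "n > 0"
    and e: "\<And>i. e i = X (x i) *v e (i + 1)" "\<And>i. e (i + int n) = \<mu> *\<^sub>R e i" "e i \<noteq> 0"
    and mu: "\<bar>\<mu>\<bar> < 1"
  shows "in_proj_cone (x i) (e i)"
proof -
  have e1: "e (i + 1) = X (x i + 2) *v e i" for i
    using e(1)[of i] X_cancel(1)[of "x i" "e (i + 1)"] by simp
  have cl: "swedge (v (x i)) (e i) * swedge (e i) (v (x i + 1)) \<ge> 0" for i
  proof (cases "e i = 0")
    case False
    let ?w = "seg x i n"
    have w: "?w \<noteq> []" "hd ?w = x i" using n by (cases n; simp)+
    have l: "last ?w = x (i + int n - 1)"
      using w n by (simp add: last_conv_nth seg_nth of_nat_diff add_diff_eq)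
    have "cyc_red_word ?w"
      using red_word_seg[of x, OF x(1)] w x(1)[of "i + int n - 1"] x(2)[of i] by (simp add: cyc_red_word_def l)
    moreover have eq: "word_prod ?w *v (\<mu> *\<^sub>R e i) = e i"
      using word_prod_seg[where e = e and x = x and m = n, OF e(1), of i] e(2)[of i] by simp
    then have "\<mu> \<noteq> 0" using False by auto
    then have "word_prod ?w *v e i = (1/\<mu>) *\<^sub>R e i"
      using arg_cong[OF eq, of "\<lambda>z. (1/\<mu>) *\<^sub>R z"] by (simp add: matrix_vector_mult_scaleR)
    moreover have "\<bar>1/\<mu>\<bar> > 1" using mu \<open>\<mu> \<noteq> 0\<close> by simp
    ultimately show ?thesis using nonneg_cyc(2)[of ?w] w by metis
  qed (simp add: swedge_def)
  define B where "B c m \<longleftrightarrow> (\<exists>j s. (s = 1 \<or> s = (-1::real)) \<and> e m = (s * c) *\<^sub>R v j \<and> (j = x m \<or> j = x m + 1))" for c m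
  have step: "B c (m + 1)" if B: "B c m" and c: "c \<noteq> 0" for c m
  proof -
    obtain j s where js: "s = 1 \<or> s = (-1::real)" "e m = (s * c) *\<^sub>R v j" "j = x m \<or> j = x m + 1"
      using B by (auto simp: B_def)
    have "\<exists>j'. e (m + 1) = (s * c) *\<^sub>R v j'"
      using js X_inv_v[of "x m"] by (auto simp: e1 matrix_vector_mult_scaleR)
    then obtain j' where j': "e (m + 1) = (s * c) *\<^sub>R v j'" by blast
    let ?k = "x (m + 1)"
    obtain i' where i': "i' \<in> {?k, ?k + 1, ?k + 2, ?k + 3}" "4 dvd (j' - i')" using rep4 by blast
    have p: "swedge (v ?k) (v j') * swedge (v j') (v (?k + 1)) \<ge> 0"
    proof -
      have "(s * c) * (s * c) * (swedge (v ?k) (v j') * swedge (v j') (v (?k + 1))) \<ge> 0"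
        using cl[of "m + 1"] by (simp add: j' mult_ac)
      moreover have "(s * c) * (s * c) > 0" using js(1) c by (auto simp: zero_less_mult_iff)
      ultimately show ?thesis by (simp only: zero_le_mult_iff) auto
    qed
    then have "swedge (v ?k) (v i') * swedge (v i') (v (?k + 1)) \<ge> 0"
      using v_cong[OF i'(2)] by auto
    moreover have "swedge (v ?k) (v i') * swedge (v i') (v (?k + 1)) < 0" if "i' = ?k + 2 \<or> i' = ?k + 3"
      using that swedge_pos[of ?k i'] swedge_pos[of "?k + 1" i'] swedge_commute[of "v i'" "v (?k + 1)"]
      by (auto simp: mult_pos_neg)
    ultimately have i'': "i' = ?k \<or> i' = ?k + 1" using i'(1) by auto
    show ?thesis
      using v_cong[OF i'(2)]
    proof
      assume "v j' = v i'"
      then show ?thesis unfolding B_def using js(1) i'' j' by (intro exI[of _ i'] exI[of _ s]) auto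
    next
      assume "v j' = - v i'"
      then show ?thesis unfolding B_def using js(1) i'' j' by (intro exI[of _ i'] exI[of _ "- s"]) auto
    qed
  qed
  show ?thesis
  proof (rule ccontr)
    assume np: "\<not> in_proj_cone (x i) (e i)"
    let ?k = "x i"
    have sgn: "swedge (v ?k) (e i) = 0 \<or> swedge (e i) (v (?k + 1)) = 0"
      using np cl[of i] unfolding in_proj_cone_def in_cone_def by (auto simp: zero_le_mult_iff)
    have "\<exists>c j. e i = c *\<^sub>R v j \<and> (j = ?k \<or> j = ?k + 1)"
    proof -
      have "wedge (v ?k) (e i) = 0 \<or> wedge (v (?k + 1)) (e i) = 0"
        using sgn sg_nz wedge_commute[of "v (?k + 1)" "e i"] by (auto simp: swedge_def)
      then show ?thesis using wedge_eq_0_imp v_nz by metis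
    qed
    then obtain c j where cj: "e i = c *\<^sub>R v j" "j = ?k \<or> j = ?k + 1" by blast
    have c: "c \<noteq> 0" using e(3) cj by auto
    have "B c i" unfolding B_def using cj by (intro exI[of _ j] exI[of _ 1]) auto
    then have "B c (i + int m)" for m
    proof (induction m)
      case (Suc m)
      then show ?case using step[OF _ c, of "i + int m"] by (simp add: add_ac)
    qed simp
    from this[of n] obtain j' s where js: "s = 1 \<or> s = (-1::real)" "e (i + int n) = (s * c) *\<^sub>R v j'"
      by (auto simp: B_def)
    have eq: "(s * c) *\<^sub>R v j' = (\<mu> * c) *\<^sub>R v j" using e(2)[of i] js cj by simp
    have "(s * c) * swedge (v j) (v j') = 0" using arg_cong[OF eq, of "swedge (v j)"] by simp
    then have "swedge (v j) (v j') = 0" using js(1) c by auto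
    then have "v j' = v j \<or> v j' = - v j" using swedge_v_0 v_cong by blast
    then obtain r where r: "r = 1 \<or> r = (-1::real)" "v j' = r *\<^sub>R v j" by force
    have "(s * r * c) *\<^sub>R v j = (\<mu> * c) *\<^sub>R v j" using eq r by (simp add: mult_ac)
    then have "s * r * c = \<mu> * c" using v_nz by (simp only: scaleR_cancel_right) auto
    then have "s * r = \<mu>" using c by simp
    then show False using mu js(1) r(1) by auto
  qed
qed

end

subsection \<open>The axis of a cyclically reduced word\<close>

text \<open>A bi-infinite periodic word together with the end points of the axes of its shifts.\<close>

locale ideal_quad_axis = ideal_quad +
  fixes x :: "int \<Rightarrow> int" and e f :: "int \<Rightarrow> real^2" and n :: nat and \<mu> :: real
  assumes nc: "\<not> cancels (x i) (x (i + 1))"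
    and xper: "x (i + int n) = x i" and npos: "n > 0"
    and eX: "e i = X (x i) *v e (i + 1)" and fX: "f i = X (x i) *v f (i + 1)"
    and eper: "e (i + int n) = \<mu> *\<^sub>R e i" and fper: "f (i + int n) = (1/\<mu>) *\<^sub>R f i"
    and enz: "e i \<noteq> 0" and fnz: "f i \<noteq> 0" and mu: "0 < \<bar>\<mu>\<bar>" "\<bar>\<mu>\<bar> < 1"
    and unlinked: "\<not> link (f i) (e i) (f j) (e j) < 0"
begin

lemma in_proj_cone_e: "in_proj_cone (x i) (e i)"
  by (rule endpoints[where n = n and \<mu> = \<mu>]) (simp_all add: nc xper npos eX[symmetric] eper enz mu)

lemma in_proj_cone_f: "in_proj_cone (x (i - 1) + 2) (f i)"
proof -
  have "in_proj_cone (x (- (1 - i)) + 2) (f (1 - (1 - i)))"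
  proof (rule endpoints[where n = n and \<mu> = \<mu> and x = "\<lambda>j. x (- j) + 2" and e = "\<lambda>j. f (1 - j)"])
    show "\<not> cancels (x (- j) + 2) (x (- (j + 1)) + 2)" for j
    proof -
      have "\<not> cancels (a + 2) (b + 2)" if "\<not> cancels b a" for a b
        using that unfolding cancels_def by presburger
      from this[OF nc[of "- 1 - j"]] show ?thesis by (simp add: algebra_simps)
    qed
    show "x (- (j + int n)) + 2 = x (- j) + 2" for j
      using xper[of "- j - int n"] by simp
    show "f (1 - j) = X (x (- j) + 2) *v f (1 - (j + 1))" for j
      using fX[of "- j"] X_cancel(1)[of "x (- j)" "f (1 - j)"] by (simp add: add.commute)
    show "f (1 - (j + int n)) = \<mu> *\<^sub>R f (1 - j)" for j
      using fper[of "1 - j - int n"] mu by (simp add: algebra_simps)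
  qed (use npos fnz mu in simp_all)
  then show ?thesis by simp
qed

lemma e_f_cones: "\<not> 4 dvd (x i - (x (i - 1) + 2))"
proof -
  have "\<not> 4 dvd (b - (a + 2))" if "\<not> cancels a b" for a b
    using that unfolding cancels_def by presburger
  then show ?thesis using nc[of "i - 1"] by simp
qed

text \<open>A coordinate on the boundary in which the cusp \<open>v j\<close> lies at infinity.\<close>

definition T :: "int \<Rightarrow> real^2 \<Rightarrow> real" where
  "T j p = swedge (v (j + 1)) p / swedge (v j) p"

lemma T_diff:
  assumes "swedge (v j) p \<noteq> 0" "swedge (v j) q \<noteq> 0"
  shows "(T j q - T j p) * (swedge (v j) p * swedge (v j) q) = swedge (v j) (v (j + 1)) * swedge p q"
proof -
  have "(T j q - T j p) * (swedge (v j) p * swedge (v j) q) = swedge (v (j + 1)) q * swedge (v j) p - swedge (v (j + 1)) p * swedge (v j) q"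
    using assms by (simp add: T_def left_diff_distrib)
  then show ?thesis
    using swedge_expand[of "v j" "v (j+1)" p q] swedge_commute[of p "v (j+1)"] by (simp add: mult.commute)
qed

lemma swedge_nz_cone:
  assumes "in_proj_cone i p" shows "swedge (v j) p \<noteq> 0"
proof -
  obtain m where m: "m \<in> {i, i + 1, i + 2, i + 3}" "4 dvd (j - m)" using rep4 by blast
  have *: "swedge (v m) q \<noteq> 0" if q: "in_cone i q" for q
  proof (cases "m = i")
    case False
    then have "swedge q (v m) > 0" using in_cone_right[OF q, of m] m(1) by auto
    then show ?thesis using swedge_commute[of q "v m"] by auto
  qed (use q in \<open>auto simp: in_cone_def\<close>)
  then have "swedge (v m) p \<noteq> 0" using *[of p] *[of "- p"] assms by (auto simp: in_proj_cone_def)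
  then show ?thesis using v_cong[OF m(2)] by auto
qed

lemma T_order:
  assumes p: "in_proj_cone i p" and q: "in_proj_cone l q" and il: "j \<le> i" "i < l" "l \<le> j + 3"
  shows "T j p < T j q"
proof -
  have sgn: "swedge (v j) y > 0" if "in_cone m y" "j \<le> m" "m \<le> j + 3" for m y
  proof (cases "m = j + 3")
    case True
    then have "swedge y (v (j + 4)) > 0" using that(1) by (simp add: in_cone_def add.assoc)
    then show ?thesis using v4[of j] swedge_commute[of y "v j"] by simp
  next
    case False
    then show ?thesis using in_cone_left[OF that(1), of j] that by simp
  qed
  have *: "T j y < T j z" if y: "in_cone i y" and z: "in_cone l z" for y z
  proof -
    have yz: "swedge (v j) y > 0" "swedge (v j) z > 0" using sgn y z il by auto
    have "swedge y z > 0" using in_cone_order[OF y z] il by auto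
    then have "(T j z - T j y) * (swedge (v j) y * swedge (v j) z) > 0"
      using T_diff[of j y z] yz swedge_pos[of j "j+1"] by simp
    moreover have "swedge (v j) y * swedge (v j) z > 0" using yz by simp
    ultimately have "T j z - T j y > 0" using zero_less_mult_pos2 by blast
    then show ?thesis by simp
  qed
  have m: "T j (- y) = T j y" for y by (simp add: T_def)
  show ?thesis using *[of p q] *[of "-p" q] *[of p "-q"] *[of "-p" "-q"] p q by (auto simp: in_proj_cone_def m)
qed

lemma swedge_fe: "swedge (f i) (e i) = swedge (f 0) (e 0)"
proof -
  have s: "swedge (f i) (e i) = swedge (f (i + 1)) (e (i + 1))" for i
    by (subst fX, subst eX) (rule swedge_X)
  show ?thesis
  proof (induction i rule: int_induct[where k = 0])
    case (step1 i) then show ?case using s[of i] by simp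
  next
    case (step2 i) then show ?case using s[of "i - 1"] by simp
  qed simp
qed

text \<open>Small values mean that the \<open>i\<close>-th axis comes close to the cusp \<open>v j\<close>: up to a constant factor this is the
  inverse of the Euclidean diameter of the axis when the cusp is moved to infinity.\<close>

definition D :: "int \<Rightarrow> int \<Rightarrow> real" where
  "D i j = \<bar>swedge (v j) (f i) * swedge (v j) (e i)\<bar>"

definition cuts :: "int \<Rightarrow> int \<Rightarrow> bool" where
  "cuts i j \<longleftrightarrow> (4 dvd (x i - j) \<and> 4 dvd (x (i - 1) + 2 - (j - 1))) \<or>
    (4 dvd (x i - (j - 1)) \<and> 4 dvd (x (i - 1) + 2 - j))"

lemma swedge_nz_f: "swedge (v j) (f i) \<noteq> 0" and swedge_nz_e: "swedge (v j) (e i) \<noteq> 0"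
  using swedge_nz_cone in_proj_cone_e in_proj_cone_f by blast+

lemma D_pos: "D i j > 0"
  using swedge_nz_f swedge_nz_e by (simp add: D_def)

lemma T_gap: "\<bar>T j (e i) - T j (f i)\<bar> * D i j = swedge (v j) (v (j + 1)) * \<bar>swedge (f 0) (e 0)\<bar>"
  using arg_cong[OF T_diff[OF swedge_nz_f swedge_nz_e, of j i i], of abs] swedge_pos[of j "j+1"] swedge_fe[of i]
  by (simp add: abs_mult D_def)

lemma link_T:
  "(T j (f m) - T j (f i)) * (T j (e m) - T j (f i)) * (T j (f m) - T j (e i)) * (T j (e m) - T j (e i)) \<ge> 0"
proof -
  let ?K = "swedge (v j) (v (j + 1))"
  have a: "(T j q - T j p) = ?K * swedge p q / (swedge (v j) p * swedge (v j) q)"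
    if "swedge (v j) p \<noteq> 0" "swedge (v j) q \<noteq> 0" for p q
    using T_diff[OF that] that by (simp add: field_simps)
  have "(T j (f m) - T j (f i)) * (T j (e m) - T j (f i)) * (T j (f m) - T j (e i)) * (T j (e m) - T j (e i))
    = ?K ^ 4 * (swedge (f i) (f m) * swedge (f i) (e m) * swedge (e i) (f m) * swedge (e i) (e m)) /
      (swedge (v j) (f i) * swedge (v j) (f m) * swedge (v j) (e i) * swedge (v j) (e m))\<^sup>2"
    unfolding a[OF swedge_nz_f swedge_nz_f] a[OF swedge_nz_f swedge_nz_e] a[OF swedge_nz_e swedge_nz_f] a[OF swedge_nz_e swedge_nz_e]
    by (simp add: power2_eq_square power4_eq_xxxx mult_ac)
  also have "swedge (f i) (f m) * swedge (f i) (e m) * swedge (e i) (f m) * swedge (e i) (e m) =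
      sg ^ 4 * link (f i) (e i) (f m) (e m)"
    by (simp add: swedge_def link_def power4_eq_xxxx)
  also have "?K ^ 4 * (sg ^ 4 * link (f i) (e i) (f m) (e m)) /
      (swedge (v j) (f i) * swedge (v j) (f m) * swedge (v j) (e i) * swedge (v j) (e m))\<^sup>2 \<ge> 0"
    using unlinked[of i m] by (intro divide_nonneg_nonneg mult_nonneg_nonneg) auto
  finally show ?thesis .
qed

lemma between_real:
  fixes a b p q :: real
  assumes "b < p" "p < a" "(p - a) * (p - b) * ((q - a) * (q - b)) \<ge> 0"
  shows "\<bar>p - q\<bar> < a - b"
proof -
  have "(p - a) * (p - b) < 0" using assms by (simp add: mult_neg_pos)
  then have "(q - a) * (q - b) \<le> 0" using assms(3)
    by (metis linorder_not_le mult_neg_pos)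
  then have "b \<le> q" "q \<le> a" using assms by (auto simp: mult_le_0_iff)
  then show ?thesis using assms by linarith
qed

text \<open>An axis cutting off the cusp \<open>v j\<close> separates it from every axis that does not.\<close>

lemma D_less:
  assumes m: "cuts m j" and i: "\<not> cuts i j"
  shows "D m j < D i j"
proof -
  have j3: "4 dvd (a - (j - 1)) \<longleftrightarrow> 4 dvd (a - (j + 3))" for a by presburger
  have cone_cong: "in_proj_cone r y" if "in_proj_cone s y" "4 dvd (s - r)" for r s y using that in_proj_cone_cong by blast
  have T3: "T j y < T j z" if "in_proj_cone r y" "in_proj_cone s z" "j \<le> r" "r < s" "s \<le> j + 3" for r s y z
    using T_order that by blast
  \<comment> \<open>\<open>b\<close> and \<open>a\<close> are the end points of the cutting axis\<close>
  obtain a b where ab: "in_proj_cone j b" "in_proj_cone (j + 3) a" "{a, b} = {e m, f m}"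
  proof -
    from m consider "4 dvd (x m - j)" "4 dvd (x (m - 1) + 2 - (j + 3))"
      | "4 dvd (x m - (j + 3))" "4 dvd (x (m - 1) + 2 - j)"
      unfolding cuts_def j3 by blast
    then show ?thesis
    proof cases
      case 1
      show ?thesis by (rule that[of "e m" "f m"]) (use 1 cone_cong in_proj_cone_e in_proj_cone_f in blast)+
    next
      case 2
      show ?thesis by (rule that[of "f m" "e m"]) (use 2 cone_cong in_proj_cone_e in_proj_cone_f in blast)+
    qed
  qed
  obtain r where r: "r \<in> {j, j + 1, j + 2, j + 3}" "4 dvd (x i - r)" using rep4 by blast
  obtain s where s: "s \<in> {j, j + 1, j + 2, j + 3}" "4 dvd (x (i - 1) + 2 - s)" using rep4 by blast
  have rs: "in_proj_cone r (e i)" "in_proj_cone s (f i)" using cone_cong in_proj_cone_e in_proj_cone_f r s by blast+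
  have inner: "r \<in> {j + 1, j + 2} \<or> s \<in> {j + 1, j + 2}"
  proof (rule ccontr)
    assume "\<not> ?thesis"
    then have "r = j \<or> r = j + 3" "s = j \<or> s = j + 3" using r s by auto
    moreover have "r \<noteq> s" using e_f_cones[of i] r(2) s(2) by presburger
    ultimately have "r = j \<and> s = j + 3 \<or> r = j + 3 \<and> s = j" by auto
    then have "cuts i j" unfolding cuts_def j3 using r(2) s(2) by auto
    then show False using i by simp
  qed
  obtain p q where pq: "T j b < T j p" "T j p < T j a" "{p, q} = {e i, f i}"
  proof (cases "r \<in> {j + 1, j + 2}")
    case True
    then show ?thesis using that[of "e i" "f i"] T3[OF ab(1) rs(1)] T3[OF rs(1) ab(2)] by auto
  next
    case False
    then show ?thesis using inner that[of "f i" "e i"] T3[OF ab(1) rs(2)] T3[OF rs(2) ab(2)] by (auto simp: insert_commute)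
  qed
  have "(T j p - T j a) * (T j p - T j b) * ((T j q - T j a) * (T j q - T j b)) \<ge> 0"
  proof -
    have perm: "(y1 - x1) * (y1 - x2) * ((y2 - x1) * (y2 - x2)) = (x1 - y1) * (x2 - y1) * (x1 - y2) * (x2 - y2)"
      for x1 x2 y1 y2 :: real by (simp add: algebra_simps)
    have *: "(T j (f i) - T j (f m)) * (T j (f i) - T j (e m)) * ((T j (e i) - T j (f m)) * (T j (e i) - T j (e m))) \<ge> 0"
      unfolding perm by (rule link_T)
    then have "(T j (f i) - T j (e m)) * (T j (f i) - T j (f m)) * ((T j (e i) - T j (e m)) * (T j (e i) - T j (f m))) \<ge> 0"
      by (simp only: mult.commute)
    with * have "(T j (f i) - T j a) * (T j (f i) - T j b) * ((T j (e i) - T j a) * (T j (e i) - T j b)) \<ge> 0"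
      using ab(3) unfolding doubleton_eq_iff by blast
    moreover from this have "(T j (e i) - T j a) * (T j (e i) - T j b) * ((T j (f i) - T j a) * (T j (f i) - T j b)) \<ge> 0"
      by (simp only: mult.commute)
    ultimately show ?thesis using pq(3) unfolding doubleton_eq_iff by blast
  qed
  from between_real[OF pq(1,2) this] have "\<bar>T j p - T j q\<bar> < T j a - T j b" .
  then have lt: "\<bar>T j (e i) - T j (f i)\<bar> < \<bar>T j (e m) - T j (f m)\<bar>"
    using ab(3) pq(3) by (auto simp: doubleton_eq_iff abs_minus_commute)
  show ?thesis
  proof (rule ccontr)
    assume "\<not> ?thesis"
    then have "\<bar>T j (e i) - T j (f i)\<bar> * D i j < \<bar>T j (e m) - T j (f m)\<bar> * D m j"
      using lt D_pos[of i j] by (intro mult_less_le_imp_less) auto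
    then show False unfolding T_gap by simp
  qed
qed

end

lemma int_periodic:
  fixes F :: "int \<Rightarrow> 'a"
  assumes "\<And>i. F (i + p) = F i"
  shows "F (i + m * p) = F i"
proof (induction m rule: int_induct[where k = 0])
  case (step1 m)
  then show ?case using assms[of "i + m * p"] by (simp add: algebra_simps)
next
  case (step2 m)
  then show ?case using assms[of "i + (m - 1) * p"] by (simp add: algebra_simps)
qed simp

lemma int_succ_div_mod:
  fixes i n :: int
  assumes "n > 0"
  shows "i mod n + 1 < n \<Longrightarrow> (i + 1) div n = i div n" "i mod n + 1 < n \<Longrightarrow> (i + 1) mod n = i mod n + 1"
    and "i mod n + 1 = n \<Longrightarrow> (i + 1) div n = i div n + 1" "i mod n + 1 = n \<Longrightarrow> (i + 1) mod n = 0"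
proof -
  have nn: "0 \<le> i mod n" using assms by simp
  have 1: "i + 1 = n * (i div n) + (i mod n + 1)" by simp
  show "i mod n + 1 < n \<Longrightarrow> (i + 1) div n = i div n" "i mod n + 1 < n \<Longrightarrow> (i + 1) mod n = i mod n + 1"
    using int_div_pos_eq[OF 1] int_mod_pos_eq[OF 1] nn by linarith+
  have 2: "i + 1 = n * (i div n + 1) + 0" if "i mod n + 1 = n"
    using that 1 by (metis add_0_right distrib_left mult_1_right add.assoc)
  show "i mod n + 1 = n \<Longrightarrow> (i + 1) div n = i div n + 1" "i mod n + 1 = n \<Longrightarrow> (i + 1) mod n = 0"
    using int_div_pos_eq[OF 2] int_mod_pos_eq[OF 2] assms by blast+
qed

lemma link_scale: "link (a *\<^sub>R u) (b *\<^sub>R v) (c *\<^sub>R u') (d *\<^sub>R v') = (a * b * c * d)\<^sup>2 * link u v u' v'"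
  by (simp add: link_def power2_eq_square mult_ac)

lemma link_mult: "det M = 1 \<Longrightarrow> link (M *v u) (M *v v) (M *v u') (M *v v') = link u v u' v'"
  by (simp add: link_def wedge_mult1)

context ideal_quad
begin

lemma link_swedge: "sg ^ 4 * link p q r s = swedge p r * swedge p s * swedge q r * swedge q s"
  by (simp add: swedge_def link_def power4_eq_xxxx)

lemma link_less_0: "link p q r s < 0 \<longleftrightarrow> swedge p r * swedge p s * swedge q r * swedge q s < 0"
  unfolding link_swedge[symmetric] using sg_nz by (simp add: mult_less_0_iff)

lemma link_gr_0: "link p q r s > 0 \<longleftrightarrow> swedge p r * swedge p s * swedge q r * swedge q s > 0"
  unfolding link_swedge[symmetric] using sg_nz by (simp add: zero_less_mult_iff)

lemma link_signs:
  assumes "a = 1 \<or> a = (-1::real)" "b = 1 \<or> b = (-1::real)" "c = 1 \<or> c = (-1::real)" "d = 1 \<or> d = (-1::real)"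
  shows "link (a *\<^sub>R p) (b *\<^sub>R q) (c *\<^sub>R r) (d *\<^sub>R s) = link p q r s"
  unfolding link_scale using assms by auto

text \<open>The cones follow each other in cyclic order, so that the signs of the areas can be read off from representatives
  in a common half plane.\<close>

lemma cones_linked:
  assumes "in_proj_cone k v0" "in_proj_cone (k + 2) u0" "in_proj_cone (k + 1) v1" "in_proj_cone (k + 3) u1"
  shows "link u0 v0 u1 v1 < 0"
proof -
  obtain a where a: "a = 1 \<or> a = (-1::real)" "in_cone k (a *\<^sub>R v0)" using in_proj_cone_obtain[OF assms(1), of k] by auto
  obtain b where b: "b = 1 \<or> b = (-1::real)" "in_cone (k+2) (b *\<^sub>R u0)" using in_proj_cone_obtain[OF assms(2), of "k+2"] by auto
  obtain c where c: "c = 1 \<or> c = (-1::real)" "in_cone (k+1) (c *\<^sub>R v1)" using in_proj_cone_obtain[OF assms(3), of "k+1"] by auto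
  obtain d where d: "d = 1 \<or> d = (-1::real)" "in_cone (k+3) (d *\<^sub>R u1)" using in_proj_cone_obtain[OF assms(4), of "k+3"] by auto
  have "swedge (a *\<^sub>R v0) (c *\<^sub>R v1) > 0" "swedge (a *\<^sub>R v0) (d *\<^sub>R u1) > 0"
    "swedge (b *\<^sub>R u0) (d *\<^sub>R u1) > 0" "swedge (c *\<^sub>R v1) (b *\<^sub>R u0) > 0"
    using in_cone_order[OF a(2) c(2)] in_cone_order[OF a(2) d(2)] in_cone_order[OF b(2) d(2)] in_cone_order[OF c(2) b(2)] by auto
  then have "link (b *\<^sub>R u0) (a *\<^sub>R v0) (d *\<^sub>R u1) (c *\<^sub>R v1) < 0"
    unfolding link_less_0 using swedge_commute[of "b *\<^sub>R u0" "c *\<^sub>R v1"]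
    by (simp add: mult_pos_neg mult_neg_pos del: swedge_scaleR)
  then show ?thesis using link_signs[OF b(1) a(1) d(1) c(1)] by simp
qed

lemma cones_unlinked:
  assumes "in_proj_cone k v0" "in_proj_cone (k + 2) u0" "in_proj_cone j u1" "in_proj_cone j v1" "odd (j - k)"
  shows "link u0 v0 u1 v1 > 0"
proof -
  obtain a where a: "a = 1 \<or> a = (-1::real)" "in_cone k (a *\<^sub>R v0)" using in_proj_cone_obtain[OF assms(1), of k] by auto
  obtain b where b: "b = 1 \<or> b = (-1::real)" "in_cone (k+2) (b *\<^sub>R u0)" using in_proj_cone_obtain[OF assms(2), of "k+2"] by auto
  have "4 dvd (j - (k + 1)) \<or> 4 dvd (j - (k + 3))" using assms(5) by presburger
  then obtain m where m: "m = k + 1 \<or> m = k + 3" "4 dvd (j - m)" by blast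
  obtain c where c: "c = 1 \<or> c = (-1::real)" "in_cone m (c *\<^sub>R u1)" using in_proj_cone_obtain[OF assms(3) m(2)] by auto
  obtain d where d: "d = 1 \<or> d = (-1::real)" "in_cone m (d *\<^sub>R v1)" using in_proj_cone_obtain[OF assms(4) m(2)] by auto
  have *: "swedge (a *\<^sub>R v0) (c *\<^sub>R u1) > 0" "swedge (a *\<^sub>R v0) (d *\<^sub>R v1) > 0"
    using in_cone_order[OF a(2) c(2)] in_cone_order[OF a(2) d(2)] m(1) by auto
  have "swedge (b *\<^sub>R u0) (c *\<^sub>R u1) * swedge (b *\<^sub>R u0) (d *\<^sub>R v1) > 0"
    using m(1)
  proof
    assume "m = k + 3"
    then show ?thesis using in_cone_order[OF b(2) c(2)] in_cone_order[OF b(2) d(2)] by (simp del: swedge_scaleR)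
  next
    assume "m = k + 1"
    then have "swedge (c *\<^sub>R u1) (b *\<^sub>R u0) > 0" "swedge (d *\<^sub>R v1) (b *\<^sub>R u0) > 0"
      using in_cone_order[OF c(2) b(2)] in_cone_order[OF d(2) b(2)] by auto
    then show ?thesis using swedge_commute[of "b *\<^sub>R u0" "c *\<^sub>R u1"] swedge_commute[of "b *\<^sub>R u0" "d *\<^sub>R v1"]
      by (simp del: swedge_scaleR)
  qed
  then have "link (b *\<^sub>R u0) (a *\<^sub>R v0) (c *\<^sub>R u1) (d *\<^sub>R v1) > 0"
    unfolding link_gr_0 using * by (simp del: swedge_scaleR)
  then show ?thesis using link_signs[OF b(1) a(1) c(1) d(1)] by simp
qed

lemma X_pos_word: "4 dvd (k - j) \<Longrightarrow> \<exists>s. \<bar>s\<bar> = 1 \<and> X k *v v (j - 1) = s *\<^sub>R v j"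
  and X_pm': "4 dvd (k - (j - 1)) \<Longrightarrow> \<exists>s. \<bar>s\<bar> = 1 \<and> X k *v v (j + 1) = s *\<^sub>R v j"
proof -
  show "\<exists>s. \<bar>s\<bar> = 1 \<and> X k *v v (j - 1) = s *\<^sub>R v j" if "4 dvd (k - j)"
    using Xl[of j] X_cong[OF that] by (intro exI[of _ 1]) simp
  show "\<exists>s. \<bar>s\<bar> = 1 \<and> X k *v v (j + 1) = s *\<^sub>R v j" if "4 dvd (k - (j - 1))"
    using Xr[of "j - 1"] X_cong[OF that] by (intro exI[of _ 1]) (simp add: add.commute)
qed

end

context ideal_quad_axis
begin

lemma swedge_step:
  assumes "X (x i) *v v j' = s *\<^sub>R v j" "\<bar>s\<bar> = 1"
  shows "\<bar>swedge (v j') (e (i + 1))\<bar> = \<bar>swedge (v j) (e i)\<bar>" "\<bar>swedge (v j') (f (i + 1))\<bar> = \<bar>swedge (v j) (f i)\<bar>"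
proof -
  have "swedge (v j') y = s * swedge (v j) (X (x i) *v y)" for y
    using swedge_X[of "x i" "v j'" y] unfolding assms(1) by simp
  then have "\<bar>swedge (v j') y\<bar> = \<bar>swedge (v j) (X (x i) *v y)\<bar>" for y
    using assms(2) by (metis abs_mult mult_1)
  from this[of "e (i + 1)"] this[of "f (i + 1)"]
  show "\<bar>swedge (v j') (e (i + 1))\<bar> = \<bar>swedge (v j) (e i)\<bar>" "\<bar>swedge (v j') (f (i + 1))\<bar> = \<bar>swedge (v j) (f i)\<bar>"
    by (metis eX, metis fX)
qed

lemma D_mod: "D i j = D (i mod int n) (j mod 4)"
proof -
  have 1: "D (i + int n) j = D i j" for i j
    using mu by (simp add: D_def eper fper abs_mult)
  have 2: "D i (j + 4) = D i j" for i j by (simp add: D_def v4 abs_mult)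
  have "D i j = D (i mod int n + (i div int n) * int n) j" by simp
  also have "\<dots> = D (i mod int n) j" by (rule int_periodic) (rule 1)
  also have "\<dots> = D (i mod int n) (j mod 4 + (j div 4) * 4)" by simp
  also have "\<dots> = D (i mod int n) (j mod 4)" by (rule int_periodic) (rule 2)
  finally show ?thesis .
qed

definition nearest :: "int \<Rightarrow> int \<Rightarrow> bool" where
  "nearest i j \<longleftrightarrow> (\<forall>i' j'. D i j \<le> D i' j')"

lemma ex_nearest: "\<exists>i j. nearest i j"
proof -
  let ?S = "(\<lambda>(i, j). D i j) ` ({0..<int n} \<times> {0..<4::int})"
  have fin: "finite ?S" "?S \<noteq> {}" using npos by auto
  obtain i j where ij: "Min ?S = D i j" using Min_in[OF fin] by auto
  have "D i j \<le> D i' j'" for i' j'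
  proof -
    have "D (i' mod int n) (j' mod 4) \<in> ?S" using npos by force
    then show ?thesis using Min_le[OF fin(1)] unfolding ij D_mod[of i' j'] by blast
  qed
  then show ?thesis unfolding nearest_def by blast
qed

text \<open>If every cusp is cut off by some axis, then the axis nearest to a cusp cuts this cusp off, and
  following it through the adjacent quadrilateral keeps it nearest. It thus turns around the
  cusp for ever, which makes it invariant under a parabolic element.\<close>

lemma not_all_cusps_cut:
  assumes all: "\<And>j. \<exists>i. cuts i j"
  shows False
proof -
  have nc: "cuts i j" if "nearest i j" for i j
    using all[of j] D_less[of _ j i] that unfolding nearest_def by (meson not_le)
  obtain i0 j0 where ij0: "nearest i0 j0" using ex_nearest by blast
  \<comment> \<open>\<open>d\<close> is the direction of turning\<close>
  obtain d a :: int where da: "d = -1 \<and> a = 0 \<or> d = 1 \<and> a = -1" "4 dvd (x i0 - (j0 + a))"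
    using nc[OF ij0] unfolding cuts_def by force
  have step: "nearest (i + 1) (j + d) \<and> 4 dvd (x (i + 1) - (j + d + a)) \<and>
      \<bar>swedge (v (j + d)) (e (i + 1))\<bar> = \<bar>swedge (v j) (e i)\<bar>"
    if ij: "nearest i j" "4 dvd (x i - (j + a))" for i j
  proof -
    obtain s where s: "\<bar>s\<bar> = 1" "X (x i) *v v (j + d) = s *\<^sub>R v j"
      using da(1) ij(2) X_pos_word[of "x i" j] X_pm'[of "x i" j] by auto
    have "D (i + 1) (j + d) = D i j"
      using swedge_step[OF s(2,1)] by (simp add: D_def abs_mult)
    then have n: "nearest (i + 1) (j + d)" using ij(1) by (simp add: nearest_def)
    have aux: "4 dvd (y - (j + d + a))"
      if "(4 dvd (y - (j + d)) \<and> 4 dvd (z + 2 - (j + d - 1))) \<or> (4 dvd (y - (j + d - 1)) \<and> 4 dvd (z + 2 - (j + d)))"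
        "4 dvd (z - (j + a))" for y z :: int
      using da(1)
    proof
      assume da: "d = -1 \<and> a = 0"
      have "\<not> 4 dvd (z + 2 - (j - 1))" using that(2) da by presburger
      then show ?thesis using that(1) da by auto
    next
      assume da: "d = 1 \<and> a = -1"
      have "\<not> 4 dvd (z + 2 - j)" using that(2) da by presburger
      then show ?thesis using that(1) da by auto
    qed
    show ?thesis
      using aux[of "x (i + 1)" "x i"] nc[OF n] ij(2) n swedge_step(1)[OF s(2,1)] by (simp add: cuts_def)
  qed
  have all: "nearest (i0 + int m) (j0 + int m * d) \<and> 4 dvd (x (i0 + int m) - (j0 + int m * d + a)) \<and>
      \<bar>swedge (v (j0 + int m * d)) (e (i0 + int m))\<bar> = \<bar>swedge (v j0) (e i0)\<bar>" for m
  proof (induction m)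
    case 0
    then show ?case using ij0 da(2) by simp
  next
    case (Suc m)
    then show ?case using step[of "i0 + int m" "j0 + int m * d"] by (simp add: algebra_simps)
  qed
  have "4 dvd (x i0 - (j0 + int n * d + a))" using all[of n] by (simp add: xper)
  from dvd_diff[OF da(2) this] have "4 dvd ((j0 + int n * d) - j0)" by simp
  then have "\<bar>swedge (v (j0 + int n * d)) (e i0)\<bar> = \<bar>swedge (v j0) (e i0)\<bar>"
    using v_cong by fastforce
  then have "\<bar>\<mu>\<bar> * \<bar>swedge (v j0) (e i0)\<bar> = \<bar>swedge (v j0) (e i0)\<bar>"
    using all[of n] by (simp add: eper abs_mult)
  then show False using swedge_nz_e[of j0 i0] mu by simp
qed

text \<open>Between an occurrence of \<open>k\<close> and the next occurrence of its inverse stands a power of one of the other two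
  letters. The passages into and out of this power cut off the two cusps at the ends of the side of \<open>k + 2\<close>.\<close>

lemma both_letters_cut:
  assumes k: "4 dvd (x i - k)" "4 dvd (x i' - (k + 2))"
  shows "(\<exists>m. cuts m (k + 2)) \<and> (\<exists>m. cuts m (k + 3))"
proof -
  have xshift: "x (i + m * int n) = x i" for i m by (rule int_periodic) (rule xper)
  obtain q where q: "i' + q * int n > i"
  proof (rule that[of "\<bar>i\<bar> + \<bar>i'\<bar> + 1"])
    have "(\<bar>i\<bar> + \<bar>i'\<bar> + 1) * 1 \<le> (\<bar>i\<bar> + \<bar>i'\<bar> + 1) * int n" using npos by (intro mult_left_mono) auto
    moreover have "i < i' + (\<bar>i\<bar> + \<bar>i'\<bar> + 1)" by linarith
    ultimately show "i < i' + (\<bar>i\<bar> + \<bar>i'\<bar> + 1) * int n" by (simp only: mult_1_right)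
  qed
  let ?P = "\<lambda>d. 4 dvd (x (i + int d) - (k + 2))"
  have "?P (nat (i' + q * int n - i))" using q k(2) by (simp add: xshift)
  then have ex: "\<exists>d. ?P d" by blast
  define d where "d = (LEAST d. ?P d)"
  have d: "?P d" "\<And>t. t < d \<Longrightarrow> \<not> ?P t"
    unfolding d_def using LeastI_ex[OF ex] not_less_Least by blast+
  have d0: "d > 0"
  proof (rule ccontr)
    assume "\<not> ?thesis"
    then have "4 dvd (x i - (k + 2))" using d(1) by simp
    then show False using k(1) by presburger
  qed
  define c where "c = Max {c. c < d \<and> 4 dvd (x (i + int c) - k)}"
  let ?S = "{c. c < d \<and> 4 dvd (x (i + int c) - k)}"
  have fin: "finite ?S" and "0 \<in> ?S" using d0 k(1) by auto
  have "c \<in> ?S" unfolding c_def by (rule Max_in[OF fin]) (use \<open>0 \<in> ?S\<close> in blast)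
  then have c: "c < d" "4 dvd (x (i + int c) - k)" by auto
  have cmax: "\<not> 4 dvd (x (i + int t) - k)" if "c < t" "t < d" for t
    using Max_ge[OF fin, of t] that unfolding c_def[symmetric] by auto
  have odd: "odd (x (i + int t) - k)" if "c < t" "t < d" for t
    using cmax[OF that] d(2)[OF that(2)] by presburger
  have cd: "Suc c < d"
  proof (rule ccontr)
    assume "\<not> ?thesis"
    then have e: "int d = int c + 1" using c(1) by simp
    have "4 dvd (x (i + int c + 1) - (k + 2))" using d(1) e by (simp add: add.assoc)
    moreover have "cancels a b" if "4 dvd (a - k)" "4 dvd (b - (k + 2))" for a b
      using that unfolding cancels_def by presburger
    ultimately show False using nc[of "i + int c"] c(2) by blast
  qed
  define b where "b = x (i + int (Suc c))"
  have bd: "4 dvd (x (i + int t) - b)" if "c < t" "t < d" for t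
    using that
  proof (induction t)
    case (Suc t)
    show ?case
    proof (cases "t = c")
      case False
      then have IH: "4 dvd (x (i + int t) - b)" "c < t" "t < d" using Suc by auto
      have "odd (x (i + int t) - k)" "odd (x (i + int (Suc t)) - k)" using odd IH Suc.prems by blast+
      moreover have "\<not> cancels (x (i + int t)) (x (i + int (Suc t)))"
        using nc[of "i + int t"] by (simp add: add_ac)
      moreover have "4 dvd (z - b)" if "odd (y - k)" "odd (z - k)" "\<not> cancels y z" "4 dvd (y - b)" for y z
        using that unfolding cancels_def by presburger
      ultimately show ?thesis using IH(1) by blast
    qed (simp add: b_def)
  qed simp
  have ob: "odd (b - k)" unfolding b_def using odd cd by blast
  have p1: "x (i + int (Suc c) - 1) = x (i + int c)" by simp
  have p2: "x (i + int d - 1) = x (i + int (d - 1))" using d0 by (simp add: of_nat_diff add_diff_eq)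
  have l: "4 dvd (x (i + int (d - 1)) - b)" using bd[of "d - 1"] cd by simp
  have cut1: "cuts (i + int (Suc c)) j" if "(4 dvd (b - j) \<and> 4 dvd (x (i + int c) + 2 - (j - 1))) \<or>
    (4 dvd (b - (j - 1)) \<and> 4 dvd (x (i + int c) + 2 - j))" for j
    using that unfolding cuts_def p1 b_def[symmetric] .
  have cut2: "cuts (i + int d) j" if "(4 dvd (x (i + int d) - j) \<and> 4 dvd (x (i + int (d - 1)) + 2 - (j - 1))) \<or>
    (4 dvd (x (i + int d) - (j - 1)) \<and> 4 dvd (x (i + int (d - 1)) + 2 - j))" for j
    using that unfolding cuts_def p2 .
  have A: "(4 dvd (b - (k+2)) \<and> 4 dvd (y + 2 - ((k+2) - 1))) \<or> (4 dvd (b - ((k+2) - 1)) \<and> 4 dvd (y + 2 - (k+2)))"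
    if "4 dvd (b - (k + 1))" "4 dvd (y - k)" for y using that by presburger
  have B: "(4 dvd (b - (k+3)) \<and> 4 dvd (y + 2 - ((k+3) - 1))) \<or> (4 dvd (b - ((k+3) - 1)) \<and> 4 dvd (y + 2 - (k+3)))"
    if "4 dvd (b - (k + 3))" "4 dvd (y - k)" for y using that by presburger
  have C: "(4 dvd (z - (k+3)) \<and> 4 dvd (y + 2 - ((k+3) - 1))) \<or> (4 dvd (z - ((k+3) - 1)) \<and> 4 dvd (y + 2 - (k+3)))"
    if "4 dvd (b - (k + 1))" "4 dvd (z - (k + 2))" "4 dvd (y - b)" for y z using that by presburger
  have E: "(4 dvd (z - (k+2)) \<and> 4 dvd (y + 2 - ((k+2) - 1))) \<or> (4 dvd (z - ((k+2) - 1)) \<and> 4 dvd (y + 2 - (k+2)))"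
    if "4 dvd (b - (k + 3))" "4 dvd (z - (k + 2))" "4 dvd (y - b)" for y z using that by presburger
  have "4 dvd (b - (k + 1)) \<or> 4 dvd (b - (k + 3))" using ob by presburger
  then show ?thesis
  proof
    assume b: "4 dvd (b - (k + 1))"
    show ?thesis using cut1[OF A[OF b c(2)]] cut2[OF C[OF b d(1) l]] by blast
  next
    assume b: "4 dvd (b - (k + 3))"
    show ?thesis using cut1[OF B[OF b c(2)]] cut2[OF E[OF b d(1) l]] by blast
  qed
qed

lemma cuts_shift: "4 dvd (j - j') \<Longrightarrow> cuts i j \<Longrightarrow> cuts i j'"
proof -
  assume j: "4 dvd (j - j')"
  have "4 dvd (a - j')" if "4 dvd (a - j)" for a using j that by presburger
  moreover have "4 dvd (a - (j' - 1))" if "4 dvd (a - (j - 1))" for a using j that by presburger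
  ultimately show "cuts i j \<Longrightarrow> cuts i j'" unfolding cuts_def by blast
qed

lemma not_opposite_letters: "\<not> (4 dvd (x i - k) \<and> 4 dvd (x i' - (k + 2)))"
proof
  assume a: "4 dvd (x i - k) \<and> 4 dvd (x i' - (k + 2))"
  then have b: "4 dvd (x i - (k + 2 + 2))" by presburger
  have *: "\<exists>m. cuts m (k + 2)" "\<exists>m. cuts m (k + 3)" "\<exists>m. cuts m (k + 2 + 2)" "\<exists>m. cuts m (k + 2 + 3)"
    using both_letters_cut[of i k i'] both_letters_cut[of i' "k + 2" i] a b by auto
  have "\<exists>i. cuts i j" for j
  proof -
    obtain m where m: "m \<in> {k+2, k+2+1, k+2+2, k+2+3}" "4 dvd (j - m)" using rep4 by blast
    then have "4 dvd (m - j)" by presburger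
    then show ?thesis using m(1) * cuts_shift[of m j] by (auto simp: add.assoc)
  qed
  then show False by (rule not_all_cusps_cut)
qed

lemma positive_letters: "\<exists>k. \<forall>i. 4 dvd (x i - k) \<or> 4 dvd (x i - (k + 1))"
proof -
  define p where "p = (if \<exists>i. 4 dvd (x i) then 0 else 2::int)"
  define q where "q = (if \<exists>i. 4 dvd (x i - 1) then 1 else 3::int)"
  have n0: "\<not> (4 dvd (x i) \<and> 4 dvd (x i' - 2))" for i i' using not_opposite_letters[of i 0 i'] by simp
  have n1: "\<not> (4 dvd (x i - 1) \<and> 4 dvd (x i' - 3))" for i i' using not_opposite_letters[of i 1 i'] by simp
  have "4 dvd (x i - p) \<or> 4 dvd (x i - q)" for i
  proof -
    have "4 dvd (x i) \<or> 4 dvd (x i - 1) \<or> 4 dvd (x i - 2) \<or> 4 dvd (x i - 3)" by presburger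
    then show ?thesis unfolding p_def q_def using n0 n1 by auto
  qed
  then have *: "4 dvd (x i - p) \<or> 4 dvd (x i - q)" for i by blast
  have "p = 0 \<or> p = 2" "q = 1 \<or> q = 3" by (auto simp: p_def q_def)
  then consider "p = 0" "q = 1" | "p = 2" "q = 1" | "p = 2" "q = 3" | "p = 0" "q = 3"
    by blast
  then show ?thesis
  proof cases
    case 4
    have "4 dvd (y - 3) \<or> 4 dvd (y - (3 + 1))" if "4 dvd (y - 0) \<or> 4 dvd (y - 3)" for y :: int
      using that by presburger
    then show ?thesis using * 4 by metis
  next
    case 1 then show ?thesis using * by (intro exI[of _ 0]) auto
  next
    case 2 then show ?thesis using * by (intro exI[of _ 1]) auto
  next
    case 3 then show ?thesis using * by (intro exI[of _ 2]) auto
  qed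
qed

text \<open>A repeated letter gives an axis that joins two opposite sides of the quadrilateral.\<close>

lemma not_both_repeated:
  assumes "4 dvd (x i - k)" "4 dvd (x (i + 1) - k)" "4 dvd (x j - (k + 1))" "4 dvd (x (j + 1) - (k + 1))"
  shows False
proof -
  have 1: "4 dvd (x i + 2 - (k + 2))" "4 dvd (x j + 2 - (k + 3))" using assms by presburger+
  have "in_proj_cone k (e (i + 1))" "in_proj_cone (k + 2) (f (i + 1))" "in_proj_cone (k + 1) (e (j + 1))" "in_proj_cone (k + 3) (f (j + 1))"
    using in_proj_cone_e[of "i + 1"] in_proj_cone_f[of "i + 1"] in_proj_cone_e[of "j + 1"] in_proj_cone_f[of "j + 1"] assms in_proj_cone_cong 1 by fastforce+
  then have "link (f (i + 1)) (e (i + 1)) (f (j + 1)) (e (j + 1)) < 0" by (rule cones_linked)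
  then show False using unlinked by blast
qed

end


context ideal_quad
begin

lemma seg_snoc: "seg x i (Suc m) = seg x i m @ [x (i + int m)]"
  by (rule nth_equalityI) (auto simp: nth_append seg_nth less_Suc_eq simp del: seg.simps)

lemma act_cancel: "z \<in> upper_half_plane \<Longrightarrow> mat_act (word_prod (inv_word a)) (mat_act (word_prod a) z) = z"
  by (simp add: mat_act_comp[symmetric] det_word_prod word_prod_inv_word mat_act_one)

lemma word_prod_inv_word_snoc: "word_prod (inv_word (a @ [k])) *v p = X (k + 2) *v (word_prod (inv_word a) *v p)"
  by (simp add: inv_word_def matrix_vector_mul_assoc)

text \<open>The shifts of a cyclically reduced word whose axis is disjoint from its translates.\<close>

lemma axis_of_word:
  assumes w: "cyc_red_word w" "w \<noteq> []" and p: "word_prod w *v p = (1/lam) *\<^sub>R p" "p \<noteq> 0"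
    and q: "word_prod w *v q = lam *\<^sub>R q" "q \<noteq> 0" and lam: "\<bar>lam\<bar> > 1"
    and unl: "\<And>u. \<not> link p q (word_prod u *v p) (word_prod u *v q) < 0"
  obtains e f where "ideal_quad_axis v X sg (\<lambda>i. w ! nat (i mod int (length w))) e f (length w) (1/lam)"
proof -
  define n where "n = length w"
  define x where "x = (\<lambda>i. w ! nat (i mod int n))"
  have n: "n > 0" using w by (simp add: n_def)
  have lam0: "lam \<noteq> 0" using lam by auto
  define h where "h = (\<lambda>i. word_prod (inv_word (seg x 0 (nat (i mod int n)))))"
  have xper: "x (i + int n) = x i" for i by (simp add: x_def)
  have hper: "h (i + int n) = h i" for i by (simp add: h_def)
  have seg_w: "seg x 0 n = w"
    by (rule nth_equalityI) (simp_all add: seg_nth n_def x_def)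
  have key: "c powi (i div int n) *\<^sub>R (h i *v y) = X (x i) *v (c powi ((i + 1) div int n) *\<^sub>R (h (i + 1) *v y))"
    if y: "word_prod w *v y = (1/c) *\<^sub>R y" "c \<noteq> 0" for c y i
  proof -
    define r where "r = nat (i mod int n)"
    have r: "int r = i mod int n" "r < n" using n by (simp_all add: r_def nat_less_iff)
    have xi: "x i = x (int r)" by (simp add: x_def r)
    have hi: "h i = word_prod (inv_word (seg x 0 r))" by (simp add: h_def r_def)
    have sn: "word_prod (inv_word (seg x 0 (Suc r))) *v y = X (x i + 2) *v (h i *v y)"
      unfolding seg_snoc word_prod_inv_word_snoc hi by (simp add: xi)
    then have sn': "h i *v y = X (x i) *v (word_prod (inv_word (seg x 0 (Suc r))) *v y)"
      by (simp add: X_cancel)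
    show ?thesis
    proof (cases "Suc r < n")
      case True
      have m: "(i + 1) mod int n = int (Suc r)" "(i + 1) div int n = i div int n"
        using int_succ_div_mod(1,2)[of "int n" i] True n r by auto
      have "h (i + 1) = word_prod (inv_word (seg x 0 (Suc r)))" unfolding h_def m nat_int ..
      then show ?thesis using m sn' by (simp add: matrix_vector_mult_scaleR)
    next
      case False
      then have rn: "Suc r = n" using r by simp
      then have m: "(i + 1) mod int n = 0" "(i + 1) div int n = i div int n + 1"
        using int_succ_div_mod(3,4)[of "int n" i] rn n r by auto
      have "h (i + 1) = mat 1" unfolding h_def m by (simp add: inv_word_def)
      moreover have "word_prod (inv_word w) *v (word_prod w *v y) = y"
        by (simp add: matrix_vector_mul_assoc word_prod_inv_word)
      then have "word_prod (inv_word w) *v y = c *\<^sub>R y"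
        using that by (simp add: matrix_vector_mult_scaleR) (metis divideR_right scaleR_scaleR inverse_eq_divide)
      then have "h i *v y = X (x i) *v (c *\<^sub>R y)" using sn' unfolding rn seg_w by simp
      ultimately show ?thesis using that(2) by (simp add: m matrix_vector_mult_scaleR power_int_add)
    qed
  qed
  have q': "word_prod w *v q = (1/(1/lam)) *\<^sub>R q" using q by simp
  define e where "e = (\<lambda>i. (1/lam) powi (i div int n) *\<^sub>R (h i *v q))"
  define f where "f = (\<lambda>i. lam powi (i div int n) *\<^sub>R (h i *v p))"
  have dvd: "(i + int n) div int n = i div int n + 1" for i using n by simp
  have hnz: "h i *v y \<noteq> 0" if "y \<noteq> 0" for i y
    using that word_prod_inv_word(1)[of "seg x 0 (nat (i mod int n))"] unfolding h_def
    by (metis matrix_vector_mul_assoc matrix_vector_mul_lid matrix_vector_mult_0_right)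
  have "ideal_quad_axis v X sg x e f n (1/lam)"
  proof
    show "\<not> cancels (x i) (x (i + 1))" for i
    proof -
      define r where "r = nat (i mod int n)"
      have r: "int r = i mod int n" "r < n" using n by (simp_all add: r_def nat_less_iff)
      have xi: "x i = w ! r" by (simp add: x_def r_def)
      show ?thesis
      proof (cases "Suc r < n")
        case True
        have "(i + 1) mod int n = int (Suc r)" 
          using int_succ_div_mod(2)[of "int n" i] True n r by auto
        then have "x (i + 1) = w ! Suc r" unfolding x_def by (simp only: nat_int)
        then show ?thesis using w True unfolding cyc_red_word_def red_word_def successively_conv_nth n_def xi by simp
      next
        case False
        then have rn: "Suc r = n" using r by simp
        then have "(i + 1) mod int n = 0" 
          using int_succ_div_mod(4)[of "int n" i] rn n r by auto
        then have "x (i + 1) = hd w" unfolding x_def using w(2) by (simp add: hd_conv_nth)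
        moreover have "x i = last w" using rn w(2) unfolding xi n_def by (simp add: last_conv_nth flip: rn n_def)
        ultimately show ?thesis using w by (simp add: cyc_red_word_def)
      qed
    qed
    show "x (i + int n) = x i" for i by (rule xper)
    show "n > 0" by (rule n)
    show "e i = X (x i) *v e (i + 1)" for i unfolding e_def by (rule key[OF q']) (use lam0 in simp)
    show "f i = X (x i) *v f (i + 1)" for i unfolding f_def by (rule key[OF p(1)]) (rule lam0)
    show "e (i + int n) = (1/lam) *\<^sub>R e i" for i
      using lam0 by (simp add: e_def dvd hper power_int_add)
    show "f (i + int n) = (1/(1/lam)) *\<^sub>R f i" for i
      using lam0 by (simp add: f_def dvd hper power_int_add)
    show "e i \<noteq> 0" "f i \<noteq> 0" for i
      using hnz p(2) q(2) lam0 by (simp_all add: e_def f_def)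
    show "0 < \<bar>1/lam\<bar>" "\<bar>1/lam\<bar> < 1" using lam by simp_all
    show "\<not> link (f i) (e i) (f j) (e j) < 0" for i j
    proof -
      define a where "a = seg x 0 (nat (i mod int n))"
      define b where "b = seg x 0 (nat (j mod int n))"
      have e: "word_prod (inv_word b) = word_prod (inv_word a) ** word_prod (a @ inv_word b)"
        by (simp add: word_prod_append matrix_mul_assoc word_prod_inv_word)
      have "link (h i *v p) (h i *v q) (h j *v p) (h j *v q) = link p q (word_prod (a @ inv_word b) *v p) (word_prod (a @ inv_word b) *v q)"
        unfolding h_def a_def[symmetric] b_def[symmetric] e
        by (simp add: link_mult det_word_prod flip: matrix_vector_mul_assoc)
      then show ?thesis
        using unl[of "a @ inv_word b"] unfolding e_def f_def link_scale by (simp add: mult_less_0_iff)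
    qed
  qed
  then show ?thesis using that unfolding x_def n_def by blast
qed

lemma axis_letters:
  assumes "cyc_red_word w" "w \<noteq> []" "word_prod w *v p = (1/lam) *\<^sub>R p" "p \<noteq> 0"
    "word_prod w *v q = lam *\<^sub>R q" "q \<noteq> 0" "\<bar>lam\<bar> > 1" "\<And>u. \<not> link p q (word_prod u *v p) (word_prod u *v q) < 0"
  shows "\<exists>k. \<forall>j\<in>set w. 4 dvd (j - k) \<or> 4 dvd (j - (k + 1))"
    and "\<lbrakk>i < length w; i' < length w; 4 dvd (w ! i - k); 4 dvd (w ! (Suc i mod length w) - k);
      4 dvd (w ! i' - (k + 1)); 4 dvd (w ! (Suc i' mod length w) - (k + 1))\<rbrakk> \<Longrightarrow> False"
proof -
  obtain e f where "ideal_quad_axis v X sg (\<lambda>i. w ! nat (i mod int (length w))) e f (length w) (1/lam)"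
    using axis_of_word[OF assms] .
  then interpret ideal_quad_axis v X sg "\<lambda>i. w ! nat (i mod int (length w))" e f "length w" "1/lam" .
  have nm: "nat (int i mod int (length w)) = i" if "i < length w" for i
    using that by (simp add: nat_mod_as_int[symmetric] flip: zmod_int)
  obtain k0 where k: "\<And>i. 4 dvd (w ! nat (i mod int (length w)) - k0) \<or> 4 dvd (w ! nat (i mod int (length w)) - (k0 + 1))"
    using positive_letters by blast
  have "\<forall>j\<in>set w. 4 dvd (j - k0) \<or> 4 dvd (j - (k0 + 1))"
  proof
    fix j assume "j \<in> set w"
    then obtain i where "i < length w" "j = w ! i" by (auto simp: in_set_conv_nth)
    then show "4 dvd (j - k0) \<or> 4 dvd (j - (k0 + 1))" using k[of "int i"] by (simp add: nm)
  qed
  then show "\<exists>k. \<forall>j\<in>set w. 4 dvd (j - k) \<or> 4 dvd (j - (k + 1))" by blast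
  have ns: "nat ((int i + 1) mod int (length w)) = Suc i mod length w" for i
    by (metis nat_int of_nat_Suc zmod_int add.commute)
  show "\<lbrakk>i < length w; i' < length w; 4 dvd (w ! i - k); 4 dvd (w ! (Suc i mod length w) - k);
      4 dvd (w ! i' - (k + 1)); 4 dvd (w ! (Suc i' mod length w) - (k + 1))\<rbrakk> \<Longrightarrow> False"
    using not_both_repeated[of "int i" k "int i'"] by (simp add: nm ns)
qed

text \<open>The case of a word consisting of a single letter.\<close>

lemma letter_endpoint:
  assumes "X k *v q = exp r *\<^sub>R q" "r > 0" "q \<noteq> 0"
  shows "in_proj_cone k q"
proof -
  have "in_proj_cone k (exp (- r * real_of_int 0) *\<^sub>R q)"
  proof (rule endpoints[where x = "\<lambda>_. k" and n = 1 and \<mu> = "exp (- r)" and e = "\<lambda>i. exp (- r * real_of_int i) *\<^sub>R q"])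
    show "\<not> cancels k k" by (simp add: cancels_def)
    show "exp (- r * real_of_int i) *\<^sub>R q = X k *v (exp (- r * real_of_int (i + 1)) *\<^sub>R q)" for i
    proof -
      have "- r * real_of_int (i + 1) + r = - r * real_of_int i" by (simp add: algebra_simps)
      then have "exp (- r * real_of_int (i + 1)) * exp r = exp (- r * real_of_int i)" by (simp only: exp_add[symmetric])
      then show ?thesis by (simp add: matrix_vector_mult_scaleR assms(1) del: mult_minus_left)
    qed
    show "exp (- r * real_of_int (i + int 1)) *\<^sub>R q = exp (- r) *\<^sub>R (exp (- r * real_of_int i) *\<^sub>R q)" for i
    proof -
      have "- r * real_of_int (i + int 1) = - r + - r * real_of_int i" by (simp add: algebra_simps)
      then show ?thesis by (simp only: exp_add scaleR_scaleR)
    qed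
  qed (use assms in simp_all)
  then show ?thesis by simp
qed

lemma word_prod_shift:
  assumes pq: "wedge q p = 1" and k: "\<And>s. mat_act (X k) (geo_line p q s) = geo_line p q (s + l)"
    and a: "\<forall>j\<in>set a. even (j - k)"
  shows "\<exists>m::int. \<forall>s. mat_act (word_prod a) (geo_line p q s) = geo_line p q (s + real_of_int m * l)"
  using a
proof (induction a)
  case Nil
  show ?case by (intro exI[of _ 0]) (simp add: mat_act_one)
next
  case (Cons j a)
  then obtain m :: int where m: "\<And>s. mat_act (word_prod a) (geo_line p q s) = geo_line p q (s + real_of_int m * l)" by auto
  have "even (j - k)" using Cons.prems by simp
  then have "4 dvd (j - k) \<or> 4 dvd (j - (k + 2))" by presburger
  then have "X j = X k \<or> X j = X (k + 2)" using X_cong by blast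
  moreover have "mat_act (X (k + 2)) (geo_line p q s) = geo_line p q (s - l)" for s
  proof -
    have "mat_act (X (k + 2)) (mat_act (X k) (geo_line p q (s - l))) = geo_line p q (s - l)"
      using pq by (simp add: mat_act_comp[symmetric] detX geo_line_H Xinv' mat_act_one)
    then show ?thesis by (simp add: k)
  qed
  ultimately have "\<exists>m::int. \<forall>s. mat_act (X j) (geo_line p q s) = geo_line p q (s + real_of_int m * l)"
    using k by (metis (no_types) mult_1 of_int_1 mult_minus_left of_int_minus uminus_add_conv_diff add.commute)
  then obtain m' :: int where m': "\<And>s. mat_act (X j) (geo_line p q s) = geo_line p q (s + real_of_int m' * l)" by auto
  show ?case
    using pq by (intro exI[of _ "m + m'"]) (simp add: mat_act_comp detX det_word_prod geo_line_H m m' algebra_simps)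
qed

text \<open>An element carrying a point of the axis of one generator to a point of the axis of a generator
  is, up to powers of the two generators, a reduced word that neither begins nor ends with them;
  ping-pong shows that this word is empty.\<close>

lemma axes_meet:
  assumes pq: "wedge q p = 1" "in_proj_cone k q" "in_proj_cone (k + 2) p" "\<And>s. mat_act (X k) (geo_line p q s) = geo_line p q (s + l)"
    and pq': "wedge q' p' = 1" "in_proj_cone k' q'" "in_proj_cone (k' + 2) p'" "\<And>s. mat_act (X k') (geo_line p' q' s) = geo_line p' q' (s + l')"
    and meet: "mat_act (word_prod w) (geo_line p' q' t) = geo_line p q s"
  shows "\<exists>m m'::int. geo_line p q (s + real_of_int m * l) = geo_line p' q' (t + real_of_int m' * l')"
proof -
  obtain w1 where w1: "red_word w1" "word_prod w1 = word_prod w" using ex_red_word by blast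
  define a where "a = takeWhile (\<lambda>j. even (j - k)) w1"
  define r where "r = dropWhile (\<lambda>j. even (j - k)) w1"
  define b where "b = rev (takeWhile (\<lambda>j. even (j - k')) (rev r))"
  define y where "y = rev (dropWhile (\<lambda>j. even (j - k')) (rev r))"
  have "r = y @ b" unfolding y_def b_def by (metis rev_append rev_rev_ident takeWhile_dropWhile_id)
  moreover have "a @ r = w1" unfolding a_def r_def by (rule takeWhile_dropWhile_id)
  ultimately have w: "w1 = a @ y @ b" and ry: "r = y @ b" by simp_all
  have "\<forall>j\<in>set a. even (j - k)" unfolding a_def by (auto dest: set_takeWhileD)
  then obtain m :: int where m: "\<And>s. mat_act (word_prod a) (geo_line p q s) = geo_line p q (s + real_of_int m * l)"
    using word_prod_shift[OF pq(1,4)] by blast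
  have "\<forall>j\<in>set b. even (j - k')" unfolding b_def by (auto dest: set_takeWhileD)
  then obtain m' :: int where m': "\<And>s. mat_act (word_prod b) (geo_line p' q' s) = geo_line p' q' (s + real_of_int m' * l')"
    using word_prod_shift[OF pq'(1,4)] by blast
  have "word_prod a ** (word_prod y ** word_prod b) = word_prod w" using w1 w by (simp add: word_prod_append)
  then have "mat_act (word_prod a) (mat_act (word_prod y) (mat_act (word_prod b) (geo_line p' q' t))) = geo_line p q s"
    using meet pq' by (simp add: mat_act_comp[symmetric] det_word_prod geo_line_H det_mul mat_act_H)
  then have "mat_act (word_prod (inv_word a)) (mat_act (word_prod a) (mat_act (word_prod y) (mat_act (word_prod b) (geo_line p' q' t)))) =
      mat_act (word_prod (inv_word a)) (mat_act (word_prod a) (geo_line p q (s - real_of_int m * l)))" by (simp add: m)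
  then have eq: "mat_act (word_prod y) (geo_line p' q' (t + real_of_int m' * l')) = geo_line p q (s - real_of_int m * l)"
    unfolding m' using pq(1) pq'(1) by (simp only: act_cancel mat_act_H det_word_prod geo_line_H)
  show ?thesis
  proof (cases "y = []")
    case True
    then show ?thesis using eq by (intro exI[of _ "- m"] exI[of _ m']) (simp add: mat_act_one)
  next
    case False
    have "red_word y" using w1(1) unfolding w red_word_def by (auto simp: successively_append_iff)
    have "hd y = hd r" "r \<noteq> []" using False ry by auto
    then have h: "odd (hd y - k)" unfolding r_def using hd_dropWhile by metis
    have l: "odd (last y - k')" using False hd_dropWhile[of "\<lambda>j. even (j - k')" "rev r"]
      unfolding y_def by (simp add: last_rev)
    have "\<not> cancels (last y) k'" "\<not> cancels (last y) (k' + 2)"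
      using l unfolding cancels_def by presburger+
    then have "in_proj_cone (hd y) (word_prod y *v q')" "in_proj_cone (hd y) (word_prod y *v p')"
      using word_maps_in_proj_cone[OF \<open>red_word y\<close> False] pq' by blast+
    then have "link p q (word_prod y *v p') (word_prod y *v q') > 0"
      using cones_unlinked[OF pq(2,3)] h by blast
    then have "geo_line p q (s - real_of_int m * l) \<noteq> geo_line (word_prod y *v p') (word_prod y *v q') (t + real_of_int m' * l')"
      using pq(1) pq'(1) by (intro geo_line_no_cross) (simp_all add: wedge_mult1 det_word_prod)
    then show ?thesis using eq pq' by (simp add: mat_act_geo_line det_word_prod)
  qed
qed

end

section \<open>Closed geodesics of a freely acting group\<close>

text \<open>Countability enters when the equality of two closed geodesics is turned into the conjugacy of their group elements.\<close>

locale fgroup =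
  fixes G :: "(real^2^2) set"
  assumes G1: "mat 1 \<in> G"
    and Gm: "\<lbrakk>g \<in> G; h \<in> G\<rbrakk> \<Longrightarrow> g ** h \<in> G"
    and Gi: "g \<in> G \<Longrightarrow> matrix_inv g \<in> G"
    and Gdet: "g \<in> G \<Longrightarrow> det g = 1"
    and Gfree: "\<lbrakk>g \<in> G; z \<in> upper_half_plane; mat_act g z = z\<rbrakk> \<Longrightarrow> g = mat 1"
    and Gcount: "countable G"
begin

lemma act_comp: "\<lbrakk>g \<in> G; h \<in> G; z \<in> upper_half_plane\<rbrakk> \<Longrightarrow> mat_act (g ** h) z = mat_act g (mat_act h z)"
  by (simp add: mat_act_comp Gdet)

lemma act_H: "\<lbrakk>g \<in> G; z \<in> upper_half_plane\<rbrakk> \<Longrightarrow> mat_act g z \<in> upper_half_plane"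
  by (simp add: mat_act_H Gdet)

lemma act_inv:
  assumes "g \<in> G" "z \<in> upper_half_plane"
  shows "mat_act (matrix_inv g) (mat_act g z) = z" "mat_act g (mat_act (matrix_inv g) z) = z"
  using assms by (simp_all add: act_comp[symmetric] Gi det1_inv Gdet mat_act_one)

lemma quot_map_act: "\<lbrakk>g \<in> G; z \<in> upper_half_plane\<rbrakk> \<Longrightarrow> quot_map G (mat_act g z) = quot_map G z"
proof -
  assume g: "g \<in> G" and z: "z \<in> upper_half_plane"
  have "mat_act h (mat_act g z) \<in> quot_map G z" if "h \<in> G" for h
    using that g z Gm unfolding quot_map_def by (auto simp flip: act_comp)
  moreover have "mat_act h z \<in> quot_map G (mat_act g z)" if "h \<in> G" for h
  proof -
    have "mat_act (h ** matrix_inv g) (mat_act g z) = mat_act h z"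
      using that g z by (simp add: act_comp Gi act_H act_inv)
    then show ?thesis using that g Gm Gi unfolding quot_map_def by (metis imageI)
  qed
  ultimately show "quot_map G (mat_act g z) = quot_map G z"
    unfolding quot_map_def by blast
qed

lemma quot_map_eqD:
  assumes "quot_map G z = quot_map G w"
  obtains h where "h \<in> G" "mat_act h w = z"
proof -
  have "z \<in> quot_map G z" using G1 mat_act_one unfolding quot_map_def by (metis imageI)
  then show ?thesis using assms that unfolding quot_map_def by auto
qed

lemma closes_up_H: "closes_up G c l g \<Longrightarrow> c s \<in> upper_half_plane"
  by (simp add: closes_up_def geodesic_line_def)

lemma geodesic_line_inj: "\<lbrakk>geodesic_line c; c s = c t\<rbrakk> \<Longrightarrow> s = t"
  unfolding geodesic_line_def by (metis abs_eq_0 diff_self eq_iff_diff_eq_0)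

lemma closes_upD:
  assumes "closes_up G c l g"
  obtains u v e where "wedge v u = 1" "c = geo_line u v" "l > 0" "e = 1 \<or> e = (-1::real)"
    "g *v u = (e * exp (- l/2)) *\<^sub>R u" "g *v v = (e * exp (l/2)) *\<^sub>R v"
proof -
  obtain u v where uv: "wedge v u = 1" "c = geo_line u v"
    using assms geodesic_line_imp unfolding closes_up_def by blast
  moreover have "det g = 1" "\<And>s. mat_act g (geo_line u v s) = geo_line u v (s + l)" "l > 0"
    using assms uv Gdet unfolding closes_up_def by auto
  ultimately show ?thesis using translation_axis that by metis
qed

lemma closes_up_periodic:
  assumes "closes_up G c l g"
  obtains k where "k \<in> G" "\<And>s. mat_act k (c s) = c (s + real_of_int m * l)"
proof -
  have g: "g \<in> G" "\<And>s. mat_act g (c s) = c (s + l)" using assms by (auto simp: closes_up_def)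
  have H: "c s \<in> upper_half_plane" for s using assms by (rule closes_up_H)
  have gi: "mat_act (matrix_inv g) (c s) = c (s - l)" for s
    using act_inv(1)[OF g(1) H[of "s - l"]] by (simp add: g(2))
  have "\<exists>k\<in>G. \<forall>s. mat_act k (c s) = c (s + real_of_int m * l)"
  proof (induction m rule: int_induct[where k = 0])
    case base
    show ?case using G1 by (intro bexI[of _ "mat 1"]) (auto simp: mat_act_one)
  next
    case (step1 i)
    then obtain k where "k \<in> G" "\<And>s. mat_act k (c s) = c (s + real_of_int i * l)" by blast
    then show ?case using g H Gm by (intro bexI[of _ "g ** k"]) (auto simp: act_comp algebra_simps)
  next
    case (step2 i)
    then obtain k where "k \<in> G" "\<And>s. mat_act k (c s) = c (s + real_of_int i * l)" by blast
    then show ?case using g gi H Gm Gi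
      by (intro bexI[of _ "matrix_inv g ** k"]) (auto simp: act_comp algebra_simps)
  qed
  then show ?thesis using that by blast
qed

lemma quot_periodic:
  assumes "closes_up G c l g"
  shows "quot_map G (c (s + real_of_int m * l)) = quot_map G (c s)"
  using closes_up_periodic[OF assms, of m] quot_map_act closes_up_H[OF assms] by metis

lemma reduce_mod:
  assumes "l > (0::real)"
  obtains m :: int where "s + real_of_int m * l \<in> {0..<l}"
proof
  have "real_of_int \<lfloor>s / l\<rfloor> * l \<le> s" "s < (real_of_int \<lfloor>s / l\<rfloor> + 1) * l"
    using assms by (simp_all add: pos_le_divide_eq[symmetric] pos_divide_less_eq[symmetric])
  then show "s + real_of_int (- \<lfloor>s / l\<rfloor>) * l \<in> {0..<l}" by (simp add: algebra_simps)
qed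

text \<open>The half-open interval is a fundamental domain for the translation by \<open>l\<close>.\<close>

lemma simple_loop_iff:
  "simple_loop G c l g \<longleftrightarrow> closes_up G c l g \<and>
    (\<forall>s t. quot_map G (c s) = quot_map G (c t) \<longrightarrow> (\<exists>m::int. t = s + real_of_int m * l))"
proof
  assume s: "simple_loop G c l g"
  then have c: "closes_up G c l g" and inj: "inj_on (\<lambda>s. quot_map G (c s)) {0..<l}"
    by (auto simp: simple_loop_def)
  have l: "l > 0" using c by (simp add: closes_up_def)
  have "\<exists>m::int. t = s + real_of_int m * l" if eq: "quot_map G (c s) = quot_map G (c t)" for s t
  proof -
    obtain m n :: int where mn: "s + real_of_int m * l \<in> {0..<l}" "t + real_of_int n * l \<in> {0..<l}"
      using reduce_mod[OF l] by metis
    then have "s + real_of_int m * l = t + real_of_int n * l"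
      using inj eq quot_periodic[OF c] unfolding inj_on_def by metis
    then have "t = s + real_of_int (m - n) * l" by (simp add: algebra_simps)
    then show ?thesis by blast
  qed
  with c show "closes_up G c l g \<and>
    (\<forall>s t. quot_map G (c s) = quot_map G (c t) \<longrightarrow> (\<exists>m::int. t = s + real_of_int m * l))" by blast
next
  assume a: "closes_up G c l g \<and>
    (\<forall>s t. quot_map G (c s) = quot_map G (c t) \<longrightarrow> (\<exists>m::int. t = s + real_of_int m * l))"
  have l: "l > 0" using a by (simp add: closes_up_def)
  have "s = t" if st: "s \<in> {0..<l}" "t \<in> {0..<l}" "quot_map G (c s) = quot_map G (c t)" for s t
  proof -
    obtain m :: int where m: "t = s + real_of_int m * l" using a st by blast
    then have "\<bar>real_of_int m * l\<bar> < 1 * l" using st by auto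
    then have "\<bar>real_of_int m\<bar> < 1" using l by (simp add: abs_mult)
    then have "m = 0" by linarith
    then show ?thesis using m by simp
  qed
  then show "simple_loop G c l g" using a by (auto simp: simple_loop_def inj_on_def)
qed

text \<open>A crossing of the axis with a translate would be a double point of the closed geodesic.\<close>

lemma simple_unlinked:
  assumes s: "simple_loop G c l g" and c: "c = geo_line u v" "wedge v u = 1" and h: "h \<in> G"
  shows "\<not> link u v (h *v u) (h *v v) < 0"
proof
  assume "link u v (h *v u) (h *v v) < 0"
  then obtain s t where st: "geo_line u v s = geo_line (h *v u) (h *v v) t"
    using geo_line_cross_exists[OF c(2)] c(2) wedge_mult1[OF Gdet[OF h]] by metis
  have cl: "closes_up G c l g" using s by (simp add: simple_loop_iff)
  note H = closes_up_H[OF cl]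
  have hs: "mat_act h (c t) = c s" using st c Gdet[OF h] by (simp add: mat_act_geo_line)
  then have "quot_map G (c s) = quot_map G (c t)" using quot_map_act[OF h H] by metis
  then obtain m :: int where m: "t = s + real_of_int m * l" using s simple_loop_iff by blast
  obtain k where k: "k \<in> G" "\<And>s. mat_act k (c s) = c (s + real_of_int m * l)"
    using closes_up_periodic[OF cl] by blast
  have "mat_act (h ** k) (c s) = c s" using h k H hs m by (simp add: act_comp)
  then have hk: "h ** k = mat 1" using Gfree Gm h k(1) H by blast
  obtain e where e: "e = 1 \<or> e = (-1::real)" "k *v u = (e * exp (- (real_of_int m * l)/2)) *\<^sub>R u"
    using translation_axis[OF c(2) Gdet[OF k(1)], of "real_of_int m * l"] k(2) c(1) by metis
  have "h *v (k *v u) = u" by (simp add: matrix_vector_mul_assoc hk)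
  then have "(e * exp (- (real_of_int m * l)/2)) *\<^sub>R (h *v u) = u"
    by (simp add: e(2) matrix_vector_mult_scaleR)
  from arg_cong[OF this, of "wedge u"] have "wedge u (h *v u) = 0" using e(1) by auto
  then show False using \<open>link u v (h *v u) (h *v v) < 0\<close> by (simp add: link_def)
qed

text \<open>The end points of both lines are eigenvectors of \<open>g\<close> for the contracting and the expanding eigenvalue.\<close>

lemma axis_unique:
  assumes "closes_up G c l g" "closes_up G c' l' g"
  obtains r where "l' = l" "\<And>s. c' s = c (s + r)"
proof -
  obtain u v e where 1: "wedge v u = 1" "c = geo_line u v" "l > 0" "e = 1 \<or> e = (-1::real)"
    "g *v u = (e * exp (- l/2)) *\<^sub>R u" "g *v v = (e * exp (l/2)) *\<^sub>R v"
    using assms(1) by (rule closes_upD)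
  obtain u' v' e' where 2: "wedge v' u' = 1" "c' = geo_line u' v'" "l' > 0" "e' = 1 \<or> e' = (-1::real)"
    "g *v u' = (e' * exp (- l'/2)) *\<^sub>R u'" "g *v v' = (e' * exp (l'/2)) *\<^sub>R v'"
    using assms(2) by (rule closes_upD)
  have g: "det g = 1" using assms(1) Gdet by (simp add: closes_up_def)
  have nz: "u \<noteq> 0" "v \<noteq> 0" using 1 by auto
  have z: "y = 0" if "(e * exp r) * ((e' * exp r') * y) = y" "r + r' \<noteq> 0" for r r' y :: real
  proof -
    have "(e * e') * exp (r + r') * y = y" using that(1) by (simp add: exp_add mult_ac)
    then have "y = 0 \<or> (e * e') * exp (r + r') = 1" by auto
    moreover have "(e * e') * exp (r + r') \<noteq> 1"
    proof
      assume a: "(e * e') * exp (r + r') = 1"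
      have unit_sign: "d * E = 1 \<Longrightarrow> d = 1 \<or> d = -1 \<Longrightarrow> E > 0 \<Longrightarrow> E = 1" for d E :: real by auto
      have "e * e' = 1 \<or> e * e' = -1" using 1(4) 2(4) by auto
      from unit_sign[OF a this exp_gt_zero] have "r + r' = 0" by simp
      then show False using that(2) by blast
    qed
    ultimately show ?thesis by blast
  qed
  have "(e * exp (- l/2)) * ((e' * exp (- l'/2)) * wedge u u') = wedge u u'"
    "(e * exp (l/2)) * ((e' * exp (l'/2)) * wedge v v') = wedge v v'"
    using wedge_mult1[OF g, of u u'] wedge_mult1[OF g, of v v'] by (simp_all only: 1(5,6) 2(5,6) wedge_scaleR mult_ac)
  moreover have "- l/2 + - l'/2 \<noteq> 0" "l/2 + l'/2 \<noteq> 0" using 1(3) 2(3) by linarith+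
  ultimately have "wedge u u' = 0" "wedge v v' = 0" using z by blast+
  then obtain a b where ab: "u' = a *\<^sub>R u" "v' = b *\<^sub>R v" using nz wedge_eq_0_imp by metis
  have "a * b = 1" using 1(1) 2(1) ab by (simp add: mult.commute)
  then have a: "a \<noteq> 0" by auto
  with \<open>a * b = 1\<close> have "b = 1/a" by (simp add: field_simps)
  then have c': "c' s = c (s - ln (a\<^sup>2))" for s
    using geo_line_scale[OF 1(1) a] 1(2) 2(2) ab by simp
  have "c' (0 + l') = mat_act g (c' 0)" using assms(2) by (simp add: closes_up_def)
  also have "\<dots> = mat_act g (c (- ln (a\<^sup>2)))" by (simp add: c')
  also have "\<dots> = c (- ln (a\<^sup>2) + l)" using assms(1) by (simp add: closes_up_def)
  finally have "c (l' - ln (a\<^sup>2)) = c (- ln (a\<^sup>2) + l)" by (simp add: c')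
  then have "l' = l" using assms(1) geodesic_line_inj by (force simp: closes_up_def)
  then show ?thesis using that[of "- ln (a\<^sup>2)"] c' by simp
qed

lemma loop_image_range:
  assumes "closes_up G c l g"
  shows "loop_image G c l = range (\<lambda>s. quot_map G (c s))"
proof -
  have "quot_map G (c s) \<in> loop_image G c l" for s
  proof -
    obtain m :: int where "s + real_of_int m * l \<in> {0..<l}"
      using reduce_mod assms unfolding closes_up_def by metis
    then show ?thesis unfolding loop_image_def using quot_periodic[OF assms, of s m] by (metis imageI)
  qed
  then show ?thesis unfolding loop_image_def by auto
qed

lemma geod_of_eq:
  assumes "closes_up G c l g"
  shows "geod_of G g = loop_image G c l"
proof -
  have "geod_of G g \<subseteq> range (\<lambda>s. quot_map G (c s))"
  proof
    fix y assume "y \<in> geod_of G g"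
    then obtain c' l' s where y: "y = quot_map G (c' s)" "closes_up G c' l' g" by (auto simp: geod_of_def)
    obtain r where "\<And>s. c' s = c (s + r)" using axis_unique[OF assms y(2)] by metis
    then show "y \<in> range (\<lambda>s. quot_map G (c s))" using y(1) by simp
  qed
  moreover have "range (\<lambda>s. quot_map G (c s)) \<subseteq> geod_of G g" using assms by (auto simp: geod_of_def)
  ultimately show ?thesis unfolding loop_image_range[OF assms] by (rule antisym)
qed

lemma closes_up_conj:
  assumes "closes_up G c l g" "h \<in> G"
  shows "closes_up G (\<lambda>s. mat_act h (c s)) l (h ** g ** matrix_inv h)"
proof -
  have H: "c s \<in> upper_half_plane" for s using assms(1) by (rule closes_up_H)
  have "geodesic_line (\<lambda>s. mat_act h (c s))"
    using assms H unfolding closes_up_def geodesic_line_def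
    by (simp add: hyp_dist_mat_act Gdet act_H)
  then show ?thesis using assms H unfolding closes_up_def
    by (simp add: act_comp Gm Gi act_H act_inv)
qed

lemma closes_up_inv:
  assumes "closes_up G c l g"
  shows "closes_up G (\<lambda>s. c (- s)) l (matrix_inv g)"
proof -
  have "geodesic_line (\<lambda>s. c (- s))"
    using assms unfolding closes_up_def geodesic_line_def by (simp add: abs_minus_commute)
  moreover have "mat_act (matrix_inv g) (c (- s)) = c (- (s + l))" for s
    using act_inv(1)[of g "c (- s - l)"] closes_up_H[OF assms] assms by (simp add: closes_up_def)
  ultimately show ?thesis using assms Gi unfolding closes_up_def by simp
qed

definition simple_elt :: "real^2^2 \<Rightarrow> bool" where
  "simple_elt g \<longleftrightarrow> (\<exists>c l. simple_loop G c l g)"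

lemma simple_elt_conj:
  assumes "simple_elt g" "h \<in> G"
  shows "simple_elt (h ** g ** matrix_inv h)" "geod_of G (h ** g ** matrix_inv h) = geod_of G g"
proof -
  obtain c l where s: "simple_loop G c l g" using assms by (auto simp: simple_elt_def)
  then have c: "closes_up G c l g" by (simp add: simple_loop_def)
  have q: "quot_map G (mat_act h (c s)) = quot_map G (c s)" for s
    using assms(2) closes_up_H[OF c] by (rule quot_map_act)
  have "simple_loop G (\<lambda>s. mat_act h (c s)) l (h ** g ** matrix_inv h)"
    using s closes_up_conj[OF c assms(2)] unfolding simple_loop_def by (simp add: q)
  then show "simple_elt (h ** g ** matrix_inv h)" by (auto simp: simple_elt_def)
  show "geod_of G (h ** g ** matrix_inv h) = geod_of G g"
    unfolding geod_of_eq[OF c] geod_of_eq[OF closes_up_conj[OF c assms(2)]] loop_image_def by (simp add: q)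
qed

lemma simple_elt_inv:
  assumes "simple_elt g"
  shows "simple_elt (matrix_inv g)" "geod_of G (matrix_inv g) = geod_of G g"
proof -
  obtain c l where s: "simple_loop G c l g" using assms by (auto simp: simple_elt_def)
  then have c: "closes_up G c l g" by (simp add: simple_loop_def)
  have "\<exists>m::int. t = s + real_of_int m * l" if q: "quot_map G (c (- s)) = quot_map G (c (- t))" for s t
  proof -
    obtain m :: int where "- t = - s + real_of_int m * l" using s q unfolding simple_loop_iff by blast
    then have "t = s + real_of_int (- m) * l" by (simp add: algebra_simps)
    then show ?thesis by blast
  qed
  then have "simple_loop G (\<lambda>s. c (- s)) l (matrix_inv g)"
    using closes_up_inv[OF c] by (simp add: simple_loop_iff)
  then show "simple_elt (matrix_inv g)" by (auto simp: simple_elt_def)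
  have "range (uminus :: real \<Rightarrow> real) = UNIV" by (rule surjI[of _ uminus]) simp
  then have "range (\<lambda>s. quot_map G (c (- s))) = range (\<lambda>s. quot_map G (c s))"
    using image_image[of "\<lambda>s. quot_map G (c s)" uminus UNIV] by simp
  then show "geod_of G (matrix_inv g) = geod_of G g"
    unfolding geod_of_eq[OF c] geod_of_eq[OF closes_up_inv[OF c]]
      loop_image_range[OF c] loop_image_range[OF closes_up_inv[OF c]] .
qed

lemma simple_closed_geodesics_eq: "simple_closed_geodesics G = geod_of G ` Collect simple_elt"
proof -
  have "loop_image G c l = geod_of G g" if "simple_loop G c l g" for c l g
    using that geod_of_eq[of c l g] by (simp add: simple_loop_def)
  then show ?thesis unfolding simple_closed_geodesics_def simple_elt_def
    by (auto simp: image_def) metis+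
qed

text \<open>Countably many translates of one axis cover the other one, so one of them meets it twice.\<close>

lemma same_image:
  assumes s: "simple_loop G c l g" and s': "simple_loop G c' l' g'"
    and im: "loop_image G c l = loop_image G c' l'"
  shows "l' = l" "\<exists>h\<in>G. g' = h ** g ** matrix_inv h \<or> g' = h ** matrix_inv g ** matrix_inv h"
proof -
  have c: "closes_up G c l g" and c': "closes_up G c' l' g'" using s s' by (simp_all add: simple_loop_def)
  have gG: "g \<in> G" "g' \<in> G" using c c' by (simp_all add: closes_up_def)
  obtain u v e where 1: "wedge v u = 1" "c = geo_line u v" "l > 0" using c by (rule closes_upD)
  obtain u' v' e' where 2: "wedge v' u' = 1" "c' = geo_line u' v'" "l' > 0" using c' by (rule closes_upD)
  have "\<exists>h\<in>G. \<exists>t. mat_act h (c t) = c' r" for r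
  proof -
    have "quot_map G (c' r) \<in> loop_image G c l"
      unfolding im loop_image_range[OF c'] by blast
    then obtain t where "quot_map G (c' r) = quot_map G (c t)" unfolding loop_image_range[OF c] by blast
    then show ?thesis using quot_map_eqD by metis
  qed
  then obtain H where H: "\<And>r. H r \<in> G" "\<And>r. \<exists>t. mat_act (H r) (c t) = c' r" by metis
  have "\<not> inj H"
  proof
    assume "inj H"
    moreover have "countable (range H)" by (rule countable_subset[OF _ Gcount]) (use H(1) in blast)
    ultimately have "countable (UNIV :: real set)" by (rule countable_image_inj_on[rotated])
    then show False using uncountable_UNIV_real by blast
  qed
  then obtain r1 r2 where r: "r1 \<noteq> r2" "H r1 = H r2" by (auto simp: inj_def)
  define h where "h = H r1"
  have h: "h \<in> G" "det h = 1" using H(1) Gdet by (simp_all add: h_def)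
  obtain t1 t2 where t: "mat_act h (c t1) = c' r1" "mat_act h (c t2) = c' r2"
    using H(2)[of r1] H(2)[of r2] r(2) by (auto simp: h_def)
  have hu: "wedge (h *v v) (h *v u) = 1" using 1 h by (simp add: wedge_mult1)
  have hc: "mat_act h (c s) = geo_line (h *v u) (h *v v) s" for s using 1 h by (simp add: mat_act_geo_line)
  obtain \<sigma> t0 where st: "\<sigma> = 1 \<or> \<sigma> = -1" "\<And>r. geo_line u' v' r = geo_line (h *v u) (h *v v) (\<sigma> * r + t0)"
    using geo_line_two_points[OF hu 2(1)] t r(1) unfolding hc 2(2) by metis
  then have rel: "c' r = mat_act h (c (\<sigma> * r + t0))" for r by (simp add: hc 2(2))
  have qc: "quot_map G (c' r) = quot_map G (c (\<sigma> * r + t0))" for r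
    unfolding rel by (rule quot_map_act[OF h(1) closes_up_H[OF c]])
  have sig: "\<sigma> * \<sigma> = 1" using st(1) by auto
  have per: "\<exists>m::int. t = s + real_of_int m * l" if "quot_map G (c s) = quot_map G (c t)" for s t
    using s that unfolding simple_loop_iff by blast
  have per': "\<exists>m::int. t = s + real_of_int m * l'" if "quot_map G (c' s) = quot_map G (c' t)" for s t
    using s' that unfolding simple_loop_iff by blast
  have "quot_map G (c' (0 + real_of_int 1 * l')) = quot_map G (c' 0)" by (rule quot_periodic[OF c'])
  then have "quot_map G (c t0) = quot_map G (c (\<sigma> * l' + t0))" unfolding qc by simp
  from per[OF this] obtain m :: int where m: "\<sigma> * l' = real_of_int m * l" by auto
  have "quot_map G (c' 0) = quot_map G (c' (\<sigma> * l))"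
    unfolding qc using quot_periodic[OF c, of t0 1] sig by (simp add: mult.assoc[symmetric] add.commute)
  from per'[OF this] obtain n :: int where n: "\<sigma> * l = real_of_int n * l'" by auto
  have "l' = \<sigma> * (\<sigma> * l')" using sig by (simp add: mult.assoc[symmetric])
  also have "\<dots> = real_of_int (m * n) * l'" using m n by (simp add: mult_ac)
  finally have "real_of_int (m * n) = real_of_int 1" using 2(3) by (simp only: mult_cancel_right1) simp
  then have "m * n = 1" by (simp only: of_int_eq_iff)
  then have "\<bar>m\<bar> = 1" by (auto simp: zmult_eq_1_iff)
  then have "\<bar>real_of_int m\<bar> = 1" by (metis of_int_abs of_int_1)
  then have "\<bar>\<sigma> * l'\<bar> = l" unfolding m abs_mult using 1(3) by simp
  then show ll: "l' = l" using st(1) 1(3) 2(3) by auto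
  have fin: "g' = k" if k: "k \<in> G" "mat_act k (c' 0) = c' l'" for k
  proof -
    have "mat_act (matrix_inv k ** g') (c' 0) = c' 0"
    proof -
      have "mat_act g' (c' 0) = c' (0 + l')" using c' unfolding closes_up_def by blast
      then show ?thesis
        using act_comp[OF Gi[OF k(1)] gG(2) closes_up_H[OF c', of 0]]
          act_inv(1)[OF k(1) closes_up_H[OF c', of 0]] k(2) by simp
    qed
    then have "matrix_inv k ** g' = mat 1" by (rule Gfree[OF Gm[OF Gi[OF k(1)] gG(2)] closes_up_H[OF c']])
    then have "k ** (matrix_inv k ** g') = k" by simp
    then show ?thesis using det1_inv(1)[OF Gdet[OF k(1)]] by (simp add: matrix_mul_assoc)
  qed
  from st(1) show "\<exists>h\<in>G. g' = h ** g ** matrix_inv h \<or> g' = h ** matrix_inv g ** matrix_inv h"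
  proof
    assume sg: "\<sigma> = 1"
    note cj = closes_up_conj[OF c h(1)]
    have "mat_act (h ** g ** matrix_inv h) (mat_act h (c t0)) = mat_act h (c (t0 + l))"
      using cj unfolding closes_up_def by blast
    moreover have "c' 0 = mat_act h (c t0)" "c' l' = mat_act h (c (t0 + l))"
      by (simp_all add: rel sg ll add.commute)
    ultimately have "g' = h ** g ** matrix_inv h"
      using cj unfolding closes_up_def by (intro fin) simp_all
    then show ?thesis using h(1) by blast
  next
    assume sg: "\<sigma> = -1"
    note cj = closes_up_conj[OF closes_up_inv[OF c] h(1)]
    have "mat_act (h ** matrix_inv g ** matrix_inv h) (mat_act h (c (- (- t0)))) = mat_act h (c (- (- t0 + l)))"
      using cj unfolding closes_up_def by blast
    moreover have "c' 0 = mat_act h (c (- (- t0)))" "c' l' = mat_act h (c (- (- t0 + l)))"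
      by (simp_all add: rel sg ll)
    ultimately have "g' = h ** matrix_inv g ** matrix_inv h"
      using cj unfolding closes_up_def by (intro fin) simp_all
    then show ?thesis using h(1) by blast
  qed
qed

lemma geod_length_eq:
  assumes "simple_loop G c l g"
  shows "geod_length G (geod_of G g) = l"
  unfolding geod_length_def
proof (rule the_equality)
  have "geod_of G g = loop_image G c l" using assms geod_of_eq[of c l g] by (simp add: simple_loop_def)
  then show "\<exists>c g'. simple_loop G c l g' \<and> geod_of G g = loop_image G c l" using assms by blast
  show "l' = l" if "\<exists>c g'. simple_loop G c l' g' \<and> geod_of G g = loop_image G c l'" for l'
    using that same_image(1)[OF assms] \<open>geod_of G g = loop_image G c l\<close> by metis
qed

lemma simple_elt_same_geod:
  assumes "simple_elt g" "simple_elt g'" "geod_of G g = geod_of G g'"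
  shows "\<exists>h\<in>G. g' = h ** g ** matrix_inv h \<or> g' = h ** matrix_inv g ** matrix_inv h"
proof -
  obtain c l c' l' where s: "simple_loop G c l g" "simple_loop G c' l' g'"
    using assms by (auto simp: simple_elt_def)
  then have "geod_of G g = loop_image G c l" "geod_of G g' = loop_image G c' l'"
    using geod_of_eq by (simp_all add: simple_loop_def)
  then show ?thesis using same_image(2)[OF s] assms(3) by simp
qed

lemma simple_elt_length:
  assumes "simple_elt g" "trace g > 2"
  shows "geod_length G (geod_of G g) > 0" "2 * cosh (geod_length G (geod_of G g) / 2) = trace g"
proof -
  obtain c l where s: "simple_loop G c l g" using assms by (auto simp: simple_elt_def)
  then have c: "closes_up G c l g" by (simp add: simple_loop_def)
  obtain u v e where 1: "wedge v u = 1" "c = geo_line u v" "l > 0" "e = 1 \<or> e = (-1::real)"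
    "g *v u = (e * exp (- l/2)) *\<^sub>R u" "g *v v = (e * exp (l/2)) *\<^sub>R v"
    using c by (rule closes_upD)
  have tr: "trace g = e * (2 * cosh (l/2))" using wedge_trace[of g v u] 1 by (simp add: cosh_def algebra_simps)
  have "cosh (l/2) > 0" by (rule cosh_real_pos)
  have "e \<noteq> -1"
  proof
    assume "e = -1"
    then have "trace g = - (2 * cosh (l/2))" using tr by simp
    then show False using assms(2) \<open>cosh (l/2) > 0\<close> by linarith
  qed
  then have "e = 1" using 1(4) by blast
  then show "geod_length G (geod_of G g) > 0" "2 * cosh (geod_length G (geod_of G g) / 2) = trace g"
    using geod_length_eq[OF s] 1(3) tr by simp_all
qed

text \<open>A root \<open>y\<close> of \<open>g\<close> translates the axis of \<open>g\<close>, and the length of this translation is an integral multiple of \<open>l\<close> since the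
  loop is simple.\<close>

lemma simple_elt_not_power:
  assumes s: "simple_elt g" and y: "y \<in> G" "g = ((\<lambda>z. y ** z) ^^ n) (mat 1)"
  shows "n = 1"
proof -
  obtain c l where s: "simple_loop G c l g" using assms by (auto simp: simple_elt_def)
  then have c: "closes_up G c l g" by (simp add: simple_loop_def)
  obtain u v e where 1: "wedge v u = 1" "c = geo_line u v" "l > 0" "e = 1 \<or> e = (-1::real)"
    "g *v u = (e * exp (- l/2)) *\<^sub>R u" "g *v v = (e * exp (l/2)) *\<^sub>R v"
    using c by (rule closes_upD)
  have gG: "g \<in> G" using c by (simp add: closes_up_def)
  have comm: "y ** ((\<lambda>z. y ** z) ^^ k) (mat 1) = ((\<lambda>z. y ** z) ^^ k) (mat 1) ** y" for k
    by (induction k) (simp_all add: matrix_mul_assoc)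
  then have yg: "y ** g ** matrix_inv y = g"
    using y det1_inv(1)[OF Gdet[OF y(1)]] by (metis matrix_mul_assoc matrix_mul_rid)
  obtain r where r: "\<And>t. mat_act y (c t) = c (t + r)"
    using axis_unique[OF c closes_up_conj[OF c y(1), unfolded yg]] by metis
  have H: "c t \<in> upper_half_plane" for t using c by (rule closes_up_H)
  have pw: "((\<lambda>z. y ** z) ^^ k) (mat 1) \<in> G \<and> mat_act (((\<lambda>z. y ** z) ^^ k) (mat 1)) (c t) = c (t + real k * r)" for k t
    by (induction k) (auto simp: G1 Gm y mat_act_one act_comp H r algebra_simps)
  have "c (0 + l) = c (0 + real n * r)" using pw[of n 0] c y(2) by (simp add: closes_up_def)
  then have l: "l = real n * r" using c geodesic_line_inj unfolding closes_up_def by fastforce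
  have "quot_map G (c (0 + r)) = quot_map G (c 0)" unfolding r[symmetric] by (rule quot_map_act[OF y(1) H])
  then obtain m :: int where "r = 0 + real_of_int m * l" using s simple_loop_iff by (metis add_0)
  then have "r = real_of_int m * l" by simp
  then have "l = real n * (real_of_int m * l)" using l by simp
  then have "l = real_of_int (int n * m) * l" by (simp only: of_int_mult of_int_of_nat_eq mult.assoc)
  then have "real_of_int (int n * m) = 1" using 1(3) by simp
  then have "int n * m = 1" by linarith
  then show ?thesis by (simp add: zmult_eq_1_iff)
qed

end

section \<open>Bases of once-punctured torus groups\<close>

text \<open>By the trace identity below, the equation says that the commutator has trace \<open>-2\<close>. In this form the condition is visibly
  inherited by the bases obtained by changing one trace.\<close>

definition torus_basis :: "real^2^2 \<Rightarrow> real^2^2 \<Rightarrow> bool" where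
  "torus_basis A B \<longleftrightarrow> det A = 1 \<and> det B = 1 \<and> trace A > 2 \<and> trace B > 2 \<and> trace (A ** B) > 2 \<and>
    (trace A)\<^sup>2 + (trace B)\<^sup>2 + (trace (A ** B))\<^sup>2 = trace A * trace B * trace (A ** B)"

lemma trace_mult_inv:
  fixes M N :: "real^2^2"
  assumes "det N = 1"
  shows "trace (M ** matrix_inv N) = trace M * trace N - trace (M ** N)"
  by (simp add: trace_2 mm_nth matrix_inv_entries[OF assms] algebra_simps)

lemma trace_inv_mult:
  fixes M N :: "real^2^2"
  assumes "det N = 1"
  shows "trace (matrix_inv N ** M) = trace M * trace N - trace (N ** M)"
  by (metis assms trace_mult_inv trace_mul_sym)

text \<open>Fricke's identity: the equation between the traces says that the commutator is parabolic.\<close>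

lemma trace_commutator:
  fixes A B :: "real^2^2"
  assumes A: "det A = 1" and B: "det B = 1"
  shows "trace (A ** B ** matrix_inv A ** matrix_inv B) =
    (trace A)\<^sup>2 + (trace B)\<^sup>2 + (trace (A ** B))\<^sup>2 - trace A * trace B * trace (A ** B) - 2"
proof -
  have AB: "det (A ** B) = 1" by (simp add: det_mul A B)
  have 1: "trace (A ** B ** matrix_inv A) = trace B"
    using trace_mul_sym[of "A ** B" "matrix_inv A"] by (simp add: matrix_mul_assoc det1_inv A)
  have 2: "trace (A ** B ** B) = trace (A ** B) * trace B - trace A"
    using trace_mult_inv[OF B, of "A ** B"] by (simp add: matrix_mul_assoc[symmetric] det1_inv B)
  have 3: "trace (A ** B ** (A ** B)) = (trace (A ** B))\<^sup>2 - 2"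
    using trace_mult_inv[OF AB, of "A ** B"]
    by (simp add: det1_inv AB power2_eq_square trace_2 mat_def)
  have "trace (A ** B ** matrix_inv A ** B) = trace (B ** A ** B ** matrix_inv A)"
    using trace_mul_sym[of "A ** B ** matrix_inv A" B] by (simp add: matrix_mul_assoc)
  also have "\<dots> = trace (B ** A ** B) * trace A - trace (B ** A ** B ** A)" by (rule trace_mult_inv[OF A])
  also have "trace (B ** A ** B) = trace (A ** B ** B)"
    using trace_mul_sym[of B "A ** B"] by (simp add: matrix_mul_assoc)
  also have "trace (B ** A ** B ** A) = trace (A ** B ** (A ** B))"
    using trace_mul_sym[of "B ** A ** B" A] by (simp add: matrix_mul_assoc)
  finally show ?thesis
    using trace_mult_inv[OF B, of "A ** B ** matrix_inv A"] 1 2 3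
    by (simp add: power2_eq_square algebra_simps)
qed

text \<open>The numbers \<open>p\<close>, \<open>q\<close> are the areas spanned by the sides and \<open>r\<close>, \<open>s\<close> those spanned by the diagonals of the quadrilateral.
  The relations with the traces force them to have a common sign.\<close>

lemma sgn_pos_chain:
  fixes p q r s x y z :: real
  assumes "p \<noteq> 0" "x > 0" "y > 0" "z > 0" "x * p = r + s" "y * q = r + s" "z * q * p = q\<^sup>2 + r\<^sup>2 + p\<^sup>2" "r * s = p\<^sup>2 + q\<^sup>2"
  shows "sgn p * p > 0" "sgn p * q > 0" "sgn p * r > 0" "sgn p * s > 0"
proof -
  have *: "\<And>t. p * t > 0 \<Longrightarrow> sgn p * t > 0"
    using assms(1) by (auto simp: sgn_if zero_less_mult_iff)
  show "sgn p * p > 0" using assms(1) by (intro *) (auto simp: zero_less_mult_iff)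
  have pp: "p * p > 0" using assms(1) by (auto simp: zero_less_mult_iff)
  have "y * (p * q) = x * (p * p)" using assms by algebra
  then have "y * (p * q) > 0" using mult_pos_pos[OF assms(2) pp] by linarith
  then have pq: "p * q > 0" using assms(3) by (simp add: zero_less_mult_iff)
  then show "sgn p * q > 0" by (rule *)
  have "x * (p * r) = z * (p * q)" using assms by algebra
  then have "x * (p * r) > 0" using mult_pos_pos[OF assms(4) pq] by linarith
  then have pr: "p * r > 0" using assms(2) by (simp add: zero_less_mult_iff)
  then show "sgn p * r > 0" by (rule *)
  have "r * s > 0" using assms(1,8) by (simp add: add_pos_nonneg)
  then have "(p * r) * (p * s) > 0" using mult_pos_pos[OF pp] by (metis mult.assoc mult.left_commute)
  then have "p * s > 0" using pr zero_less_mult_pos by blast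
  then show "sgn p * s > 0" by (rule *)
qed

text \<open>The vertices are the four cusps fixed by the cyclic permutations of the commutator.\<close>

lemma ex_ideal_quad:
  assumes "torus_basis A B"
  obtains v X sg where "ideal_quad v X sg" "X 0 = A" "X 3 = B"
proof -
  have A: "det A = 1" and B: "det B = 1" and tr: "trace A > 2" "trace B > 2" "trace (A ** B) > 2"
    and eq: "(trace A)\<^sup>2 + (trace B)\<^sup>2 + (trace (A ** B))\<^sup>2 = trace A * trace B * trace (A ** B)"
    using assms by (auto simp: torus_basis_def)
  let ?a = "matrix_inv A" and ?b = "matrix_inv B"
  have ab: "det ?a = 1" "det ?b = 1" by (simp_all add: det1_inv A B)
  define K where "K = A ** B ** ?a ** ?b"
  have K: "det K = 1" "trace K = -1 + 1 / -1"
    using trace_commutator[OF A B] eq by (simp_all add: K_def det_mul A B ab)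
  obtain v0 where v0: "v0 \<noteq> 0" "K *v v0 = -1 *\<^sub>R v0"
    by (rule eigenvector_2[OF K(1) _ K(2)]) auto
  define v1 where "v1 = ?b *v v0"
  define v2 where "v2 = ?a *v v1"
  define v3 where "v3 = B *v v2"
  have Bv1: "B *v v1 = v0" by (simp add: v1_def inv_mv B)
  have Bv2: "B *v v2 = v3" by (simp add: v3_def)
  have Av2: "A *v v2 = v1" by (simp add: v2_def inv_mv A)
  have Av3: "A *v v3 = - v0"
    using v0(2) by (simp add: K_def v3_def v2_def v1_def matrix_vector_mul_assoc matrix_mul_assoc)
  have bv: "?b *v v0 = v1" "?b *v v3 = v2"
    using inv_mv(1)[OF B, of v1] inv_mv(1)[OF B, of v2] by (simp_all add: Bv1 Bv2)
  have av: "?a *v v1 = v2" "?a *v v0 = - v3"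
    using inv_mv(1)[OF A, of v2] inv_mv(1)[OF A, of "- v3"] Av3
    by (simp_all add: Av2 vec.neg)
  define p q r s where "p = wedge v0 v1" and "q = wedge v1 v2" and "r = wedge v0 v2" and "s = wedge v1 v3"
  have p': "wedge v2 v3 = p" using wedge_mult1[OF A, of v2 v3] wedge_commute[of v1 v0] by (simp add: Av2 Av3 p_def)
  have q': "wedge v0 v3 = q" using wedge_mult1[OF B, of v1 v2] by (simp add: Bv1 Bv2 q_def)
  have 1: "trace A * p = r + s"
    using wedge_trace[of A v2 v3] wedge_commute[of v2 v0] by (simp add: Av2 Av3 p' r_def s_def)
  have 2: "trace B * q = r + s"
    using wedge_trace[of B v1 v2] by (simp add: Bv1 Bv2 q_def r_def s_def)
  have 3: "r * s = p\<^sup>2 + q\<^sup>2"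
    using wedge_plucker[of v0 v1 v2 v3] by (simp add: p' q' p_def[symmetric] q_def[symmetric] r_def[symmetric] s_def[symmetric] power2_eq_square)
  have 4: "trace (A ** B) * q * p = q\<^sup>2 + r\<^sup>2 + p\<^sup>2"
  proof -
    have e: "p *\<^sub>R (A *v v0) = q *\<^sub>R v1 + r *\<^sub>R v0"
      using arg_cong[OF wedge_expand[of v2 v3 v0], of "\<lambda>z. A *v z"] wedge_commute[of v2 v0]
      by (simp add: p' q' r_def matrix_vector_right_distrib matrix_vector_mult_diff_distrib matrix_vector_mult_scaleR Av2 Av3)
    have "trace (A ** B) * q = wedge (A *v v0) v2 + p"
      using wedge_trace[of "A ** B" v1 v2] wedge_commute[of v1 v0]
      by (simp add: q_def p_def Bv1 Bv2 Av3 flip: matrix_vector_mul_assoc)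
    then have "trace (A ** B) * q * p = wedge (p *\<^sub>R (A *v v0)) v2 + p * p" by (simp add: algebra_simps)
    then show ?thesis unfolding e by (simp add: wedge_add q_def r_def power2_eq_square)
  qed
  have p0: "p \<noteq> 0"
  proof
    assume p: "p = 0"
    then have rs: "r + s = 0" "r * s = 0" "q = 0" using 1 2 3 tr by auto
    then have r0: "r = 0" by auto
    obtain m where m: "v1 = m *\<^sub>R v0" using wedge_eq_0_imp[OF _ v0(1), of v1] p by (auto simp: p_def)
    have "v1 \<noteq> 0" using Bv1 v0 by auto
    then have m0: "m \<noteq> 0" using m by auto
    obtain k where k: "v2 = k *\<^sub>R v0" using wedge_eq_0_imp[OF _ v0(1), of v2] r0 by (auto simp: r_def)
    have "v2 \<noteq> 0" using Av2 \<open>v1 \<noteq> 0\<close> by auto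
    then have k0: "k \<noteq> 0" using k by auto
    have B0: "m *\<^sub>R (B *v v0) = v0" using Bv1 m by (simp add: matrix_vector_mult_scaleR)
    have A0: "k *\<^sub>R (A *v v0) = m *\<^sub>R v0" using Av2 m k by (simp add: matrix_vector_mult_scaleR)
    have "m *\<^sub>R v3 = k *\<^sub>R v0" unfolding v3_def k
      using B0 by (simp add: matrix_vector_mult_scaleR) (metis scaleR_left_commute scaleR_scaleR mult.commute)
    then have "m *\<^sub>R (A *v v3) = k *\<^sub>R (A *v v0)" by (metis matrix_vector_mult_scaleR)
    then have "m *\<^sub>R (- v0) = m *\<^sub>R v0" unfolding Av3 A0 .
    then have "- v0 = v0" using m0 by (simp only: scaleR_cancel_left) simp
    then show False using v0(1) by (simp add: vec2_eq_iff)
  qed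
  have x0: "trace A > 0" "trace B > 0" "trace (A ** B) > 0" using tr by linarith+
  note sgn = sgn_pos_chain[OF p0 x0 1 2 4 3]
  define u :: "int \<Rightarrow> real^2" where "u i = (if i = 0 then v0 else if i = 1 then v1 else if i = 2 then v2 else v3)" for i
  define w :: "int \<Rightarrow> real^2" where "w k = (if even (k div 4) then u (k mod 4) else - u (k mod 4))" for k
  define Y :: "int \<Rightarrow> real^2^2" where "Y k = (if k mod 4 = 0 then A else if k mod 4 = 1 then ?b else if k mod 4 = 2 then ?a else B)" for k
  have w4: "w (k + 4) = - w k" for k by (simp add: w_def)
  have Y4: "Y (k + 4) = Y k" for k by (simp add: Y_def)
  \<comment> \<open>the values around one period, up to a common sign\<close>
  have vals: "\<exists>c. (c = 1 \<or> c = (-1::real)) \<and> w (4*m) = c *\<^sub>R v0 \<and> w (4*m+1) = c *\<^sub>R v1 \<and> w (4*m+2) = c *\<^sub>R v2 \<and> w (4*m+3) = c *\<^sub>R v3"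
    for m by (intro exI[of _ "if even m then 1 else -1"]) (simp add: w_def u_def)
  have Yvals: "Y (4*m) = A" "Y (4*m+1) = ?b" "Y (4*m+2) = ?a" "Y (4*m+3) = B" for m
    by (simp_all add: Y_def)
  have cases4: "\<exists>m. k = 4*m \<or> k = 4*m+1 \<or> k = 4*m+2 \<or> k = 4*m+3" for k :: int
    by presburger
  have "ideal_quad w Y (sgn p)"
  proof
    fix k :: int
    show "w (k + 4) = - w k" by (rule w4)
    show "Y (k + 4) = Y k" by (rule Y4)
    obtain m where m: "k = 4*m \<or> k = 4*m+1 \<or> k = 4*m+2 \<or> k = 4*m+3" using cases4 by blast
    obtain c where c: "c = 1 \<or> c = (-1::real)" "w (4*m) = c *\<^sub>R v0" "w (4*m+1) = c *\<^sub>R v1" "w (4*m+2) = c *\<^sub>R v2" "w (4*m+3) = c *\<^sub>R v3"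
      using vals by blast
    have n: "w (4*m+4) = - c *\<^sub>R v0" "w (4*m+5) = - c *\<^sub>R v1" "w (4*m+6) = - c *\<^sub>R v2" "w (4*m-1) = - c *\<^sub>R v3"
    proof -
      have "4*m - 1 + 4 = 4*m + 3" by simp
      then have "w (4*m+3) = - w (4*m-1)" using w4[of "4*m-1"] by (simp only:)
      then show "w (4*m-1) = - c *\<^sub>R v3" using c(5) by simp
      show "w (4*m+4) = - c *\<^sub>R v0" "w (4*m+5) = - c *\<^sub>R v1" "w (4*m+6) = - c *\<^sub>R v2"
        using w4[of "4*m"] w4[of "4*m+1"] w4[of "4*m+2"] c by (simp_all add: add.assoc)
    qed
    have c': "w (1 + 4*m) = c *\<^sub>R v1" "w (2 + 4*m) = c *\<^sub>R v2" "w (3 + 4*m) = c *\<^sub>R v3"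
      using c by (simp_all add: add.commute)
    have mv_minus: "M *v (- y) = - (M *v y)" for M :: "real^2^2" and y by (simp add: vec2_eq_iff mv_nth)
    have Yn: "Y (4*m+4) = A" "Y (4*m+5) = ?b" using Y4[of "4*m"] Y4[of "4*m+1"] by (simp_all add: Yvals add.assoc)
    show "det (Y k) = 1" using m by (auto simp: Y_def A B ab)
    show "Y k ** Y (k + 2) = mat 1"
      using m by (elim disjE) (simp_all add: Yvals Yn add.assoc det1_inv A B)
    show "Y k *v w (k - 1) = w k"
      using m by (elim disjE) (simp_all add: c c' n Yvals mv_minus matrix_vector_mult_scaleR Av2 Bv1 Av3 Bv2 av bv)
    show "Y k *v w (k + 2) = w (k + 1)"
      using m by (elim disjE) (simp_all add: c c' n Yvals mv_minus add.assoc matrix_vector_mult_scaleR Av2 Bv1 Av3 Bv2 av bv)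
    fix j assume j: "k < j" "j < k + 4"
    have j3: "j = k + 1 \<or> j = k + 2 \<or> j = k + 3" using j by linarith
    have cc: "c * (c * t) = t" for t using c(1) by auto
    show "sgn p * wedge (w k) (w j) > 0"
      using m j3 sgn
      by (elim disjE; simp add: c n add.assoc cc wedge_commute[of v1 v0] wedge_commute[of v2 v0] wedge_commute[of v2 v1]
        wedge_commute[of v3 v0] wedge_commute[of v3 v1] wedge_commute[of v3 v2] p' q'
        p_def[symmetric] q_def[symmetric] r_def[symmetric] s_def[symmetric])
  qed
  moreover have "Y 0 = A" "Y 3 = B" by (simp_all add: Y_def)
  ultimately show ?thesis by (rule that)
qed

lemma word_mat_append: "word_mat A B (w @ w') = word_mat A B w ** word_mat A B w'"
  by (induction w) (simp_all add: matrix_mul_assoc)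

lemma gen_in_group: "A \<in> gen_group A B" "B \<in> gen_group A B"
proof -
  have "word_mat A B [(GenA, True)] = A" "word_mat A B [(GenB, True)] = B" by simp_all
  then show "A \<in> gen_group A B" "B \<in> gen_group A B" unfolding gen_group_def by (metis rangeI)+
qed

context ideal_quad
begin

lemma word_prod_group: "range word_prod = gen_group (X 0) (X 3)"
proof -
  have inv: "matrix_inv (X 0) = X 2" "matrix_inv (X 3) = X 1"
    using matrix_inv_unique2[OF detX, of 0 "X 2"] matrix_inv_unique2[OF detX, of 3 "X 1"]
      Xinv[of 0] Xinv[of 3] X4[of 1] by simp_all
  define code where "code = (\<lambda>(g, b). (case g of GenA \<Rightarrow> (if b then 0 else 2) | GenB \<Rightarrow> (if b then 3 else 1 :: int)))"
  have l: "letter_mat (X 0) (X 3) y = X (code y)" for y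
    by (cases y; cases "fst y") (auto simp: code_def inv)
  have "word_mat (X 0) (X 3) y = word_prod (map code y)" for y
    by (induction y) (simp_all add: l)
  moreover have "\<exists>y. word_prod w = word_mat (X 0) (X 3) y" for w
  proof (induction w)
    case Nil
    show ?case by (intro exI[of _ "[]"]) simp
  next
    case (Cons k w)
    then obtain y where y: "word_prod w = word_mat (X 0) (X 3) y" by blast
    have "4 dvd (k - 0) \<or> 4 dvd (k - 1) \<or> 4 dvd (k - 2) \<or> 4 dvd (k - 3)" by presburger
    then have "X k = X 0 \<or> X k = X 1 \<or> X k = X 2 \<or> X k = X 3" using X_cong by blast
    then obtain a where "X k = letter_mat (X 0) (X 3) a"
      using that[of "(GenA, True)"] that[of "(GenB, False)"] that[of "(GenA, False)"] that[of "(GenB, True)"]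
      by (auto simp: inv)
    then show ?case using y by (intro exI[of _ "a # y"]) simp
  qed
  ultimately show ?thesis unfolding gen_group_def by blast
qed

lemma fgroup_word_prod: "fgroup (range word_prod)"
proof
  show "mat 1 \<in> range word_prod" by (rule range_eqI[of _ _ "[]"]) simp
  show "g ** h \<in> range word_prod" if "g \<in> range word_prod" "h \<in> range word_prod" for g h
    using that by (auto simp flip: word_prod_append)
  show "matrix_inv g \<in> range word_prod" if "g \<in> range word_prod" for g
    using that by (auto simp: matrix_inv_word_prod)
  show "det g = 1" if "g \<in> range word_prod" for g using that by (auto simp: det_word_prod)
  show "g = mat 1" if "g \<in> range word_prod" "z \<in> upper_half_plane" "mat_act g z = z" for g z
    using that fixes_point by blast
  show "countable (range word_prod)" by simp
qed

end

sublocale ideal_quad \<subseteq> Gr: fgroup "range word_prod"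
  by (rule fgroup_word_prod)

lemma torus_fgroup: "torus_basis A B \<Longrightarrow> fgroup (gen_group A B)"
proof -
  assume "torus_basis A B"
  then obtain v X sg where q: "ideal_quad v X sg" "X 0 = A" "X 3 = B" by (rule ex_ideal_quad)
  then interpret ideal_quad v X sg by simp
  show ?thesis using fgroup_word_prod word_prod_group q by simp
qed

context ideal_quad
begin

lemma letter_axis:
  assumes "trace (X k) > 2"
  obtains p q l where "l > 0" "wedge q p = 1" "closes_up (range word_prod) (geo_line p q) l (X k)" "in_proj_cone k q" "in_proj_cone (k + 2) p"
    "\<And>s. mat_act (X k) (geo_line p q s) = geo_line p q (s + l)"
proof -
  obtain p q l where l: "l > 0" "wedge q p = 1" "X k *v p = exp (- l/2) *\<^sub>R p" "X k *v q = exp (l/2) *\<^sub>R q"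
    using hyperbolic_axis[OF detX assms] by metis
  have sh: "mat_act (X k) (geo_line p q s) = geo_line p q (s + l)" for s
    by (rule axis_translation[of q p "X k" 1]) (use l detX in simp_all)
  have "X k \<in> range word_prod" by (rule range_eqI[of _ _ "[k]"]) simp
  then have c: "closes_up (range word_prod) (geo_line p q) l (X k)"
    using l sh geodesic_geo_line by (simp add: closes_up_def)
  have nz: "p \<noteq> 0" "q \<noteq> 0" using l(2) by auto
  have "X (k + 2) *v (exp (- l/2) *\<^sub>R p) = p" using X_cancel(1)[of k p] l(3) by simp
  then have "exp (l/2) *\<^sub>R (exp (- l/2) *\<^sub>R (X (k + 2) *v p)) = exp (l/2) *\<^sub>R p"
    by (simp add: matrix_vector_mult_scaleR)
  moreover have "exp (l/2) * exp (- l/2) = 1" by (simp flip: exp_add)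
  ultimately have "X (k + 2) *v p = exp (l/2) *\<^sub>R p" by simp
  then have "in_proj_cone (k + 2) p" using letter_endpoint[of "k + 2" p "l/2"] l(1) nz by simp
  moreover have "in_proj_cone k q" using letter_endpoint[of k q "l/2"] l nz by simp
  ultimately show ?thesis using that l c sh by blast
qed

text \<open>By ping-pong, only powers of a generator move a point of its axis within the axis.\<close>

lemma letter_simple:
  assumes "trace (X k) > 2"
  shows "Gr.simple_elt (X k)"
proof -
  obtain p q l where c: "l > 0" "wedge q p = 1" "closes_up (range word_prod) (geo_line p q) l (X k)" "in_proj_cone k q" "in_proj_cone (k + 2) p"
    and sh: "\<And>s. mat_act (X k) (geo_line p q s) = geo_line p q (s + l)"
    using letter_axis[OF assms] by metis
  have "\<exists>m::int. t = s + real_of_int m * l"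
    if q: "quot_map (range word_prod) (geo_line p q s) = quot_map (range word_prod) (geo_line p q t)" for s t
  proof -
    obtain w where "mat_act (word_prod w) (geo_line p q t) = geo_line p q s" using Gr.quot_map_eqD[OF q] by blast
    then obtain m m' :: int where "geo_line p q (s + real_of_int m * l) = geo_line p q (t + real_of_int m' * l)"
      using axes_meet[OF c(2,4,5) sh c(2,4,5) sh] by blast
    then have "s + real_of_int m * l = t + real_of_int m' * l" using geo_line_inj[OF c(2)] by blast
    then have "t = s + real_of_int (m - m') * l" by (simp add: algebra_simps)
    then show ?thesis by blast
  qed
  then have "simple_loop (range word_prod) (geo_line p q) l (X k)" using c(3) by (simp add: Gr.simple_loop_iff)
  then show ?thesis unfolding Gr.simple_elt_def by blast
qed

text \<open>The axes of the two generators are linked, and every other intersection is the image of this one under powers of the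
  generators.\<close>

lemma letters_meet_once:
  assumes "trace (X 0) > 2" "trace (X 3) > 2"
  shows "card (geod_of (range word_prod) (X 0) \<inter> geod_of (range word_prod) (X 3)) = 1"
proof -
  let ?G = "range word_prod"
  obtain p q l where c: "l > 0" "wedge q p = 1" "closes_up ?G (geo_line p q) l (X 0)" "in_proj_cone 0 q" "in_proj_cone (0 + 2) p"
    and sh: "\<And>s. mat_act (X 0) (geo_line p q s) = geo_line p q (s + l)"
    using letter_axis[OF assms(1)] by metis
  obtain p' q' l' where c': "l' > 0" "wedge q' p' = 1" "closes_up ?G (geo_line p' q') l' (X 3)" "in_proj_cone 3 q'" "in_proj_cone (3 + 2) p'"
    and sh': "\<And>s. mat_act (X 3) (geo_line p' q' s) = geo_line p' q' (s + l')"
    using letter_axis[OF assms(2)] by metis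
  have "in_proj_cone 1 p'" using c'(5) in_proj_cone_cong[of "3 + 2" 1 p'] by simp
  then have "link p q q' p' < 0" using cones_linked[of 0 q p p' q'] c(4,5) c'(4) by simp
  then have lk: "link p q p' q' < 0" by (simp add: link_def mult_ac)
  then obtain s0 t0 where st: "geo_line p q s0 = geo_line p' q' t0" using geo_line_cross_exists[OF c(2) c'(2)] by blast
  have nz: "wedge q q' \<noteq> 0" "wedge q p' \<noteq> 0" using lk by (auto simp: link_def)
  have g: "geod_of ?G (X 0) = range (\<lambda>s. quot_map ?G (geo_line p q s))"
    "geod_of ?G (X 3) = range (\<lambda>s. quot_map ?G (geo_line p' q' s))"
    using Gr.geod_of_eq Gr.loop_image_range c(3) c'(3) by metis+
  have "geod_of ?G (X 0) \<inter> geod_of ?G (X 3) = {quot_map ?G (geo_line p q s0)}"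
  proof (intro equalityI subsetI)
    fix y assume "y \<in> geod_of ?G (X 0) \<inter> geod_of ?G (X 3)"
    then obtain s t where y: "y = quot_map ?G (geo_line p q s)" "y = quot_map ?G (geo_line p' q' t)" unfolding g by blast
    then obtain w where "mat_act (word_prod w) (geo_line p' q' t) = geo_line p q s" using Gr.quot_map_eqD by (metis rangeE)
    then obtain m m' :: int where "geo_line p q (s + real_of_int m * l) = geo_line p' q' (t + real_of_int m' * l')"
      using axes_meet[OF c(2,4,5) sh c'(2,4,5) sh'] by blast
    then have "s + real_of_int m * l = s0" using geo_line_cross_unique(1)[OF c(2) c'(2) nz _ st] by blast
    then show "y \<in> {quot_map ?G (geo_line p q s0)}" using Gr.quot_periodic[OF c(3), of s m] y(1) by simp
  next
    fix y assume "y \<in> {quot_map ?G (geo_line p q s0)}"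
    then show "y \<in> geod_of ?G (X 0) \<inter> geod_of ?G (X 3)" unfolding g using st by (metis IntI rangeI singletonD)
  qed
  then show ?thesis by simp
qed

end

section \<open>Changing the basis\<close>

text \<open>The equation is quadratic in \<open>z\<close>. Its second root is positive since the product of the roots is \<open>x\<^sup>2 + y\<^sup>2\<close>, and a
  positive root \<open>w\<close> exceeds \<open>2\<close> because \<open>x * y * (w - 2) = w\<^sup>2 + (x - y)\<^sup>2\<close>.\<close>

lemma markov_move:
  fixes x y z :: real
  assumes "x > 2" "y > 2" "z > 2" "x\<^sup>2 + y\<^sup>2 + z\<^sup>2 = x * y * z"
  shows "x * y - z > 2" "x\<^sup>2 + y\<^sup>2 + (x * y - z)\<^sup>2 = x * y * (x * y - z)"
proof -
  show eq: "x\<^sup>2 + y\<^sup>2 + (x * y - z)\<^sup>2 = x * y * (x * y - z)"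
    using assms(4) by (simp add: power2_eq_square algebra_simps)
  define w where "w = x * y - z"
  have "z * w = x\<^sup>2 + y\<^sup>2" using assms(4) by (simp add: w_def power2_eq_square algebra_simps)
  moreover have "x\<^sup>2 + y\<^sup>2 > 0" using assms by (simp add: add_pos_pos)
  ultimately have "z * w > 0" by linarith
  then have w: "w > 0" using assms(3) zero_less_mult_pos[of z w] by linarith
  have "(x * y) * (w - 2) = w\<^sup>2 + (x - y)\<^sup>2"
    using eq by (simp add: w_def[symmetric] power2_eq_square algebra_simps)
  moreover have "w\<^sup>2 + (x - y)\<^sup>2 > 0" using w by (simp add: add_pos_nonneg)
  moreover have "x * y > 0" using assms by simp
  ultimately have "w - 2 > 0" by (metis zero_less_mult_pos)
  then show "x * y - z > 2" by (simp add: w_def)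
qed

lemma torus_basis_traces:
  assumes "torus_basis V W"
  shows "trace (V ** (V ** W)) = trace V * trace (V ** W) - trace W"
    "trace (V ** W ** W) = trace (V ** W) * trace W - trace V"
    "trace (W ** matrix_inv V) = trace V * trace W - trace (V ** W)"
proof -
  have d: "det V = 1" "det W = 1" using assms by (auto simp: torus_basis_def)
  show "trace (V ** (V ** W)) = trace V * trace (V ** W) - trace W"
    using trace_inv_mult[OF d(1), of "V ** W"] by (simp add: matrix_mul_assoc det1_inv d)
  show "trace (V ** W ** W) = trace (V ** W) * trace W - trace V"
    using trace_mult_inv[OF d(2), of "V ** W"] by (simp add: matrix_mul_assoc[symmetric] det1_inv d)
  show "trace (W ** matrix_inv V) = trace V * trace W - trace (V ** W)"
    using trace_mult_inv[OF d(1), of W] trace_mul_sym[of W V] by (simp add: mult.commute)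
qed

lemma torus_basis_moves:
  assumes "torus_basis V W"
  shows "torus_basis V (V ** W)" "torus_basis (V ** W) W" "torus_basis W (matrix_inv V)"
proof -
  have d: "det V = 1" "det W = 1" and t: "trace V > 2" "trace W > 2" "trace (V ** W) > 2"
    and eq: "(trace V)\<^sup>2 + (trace W)\<^sup>2 + (trace (V ** W))\<^sup>2 = trace V * trace W * trace (V ** W)"
    using assms by (auto simp: torus_basis_def)
  note tr = torus_basis_traces[OF assms]
  show "torus_basis V (V ** W)" unfolding torus_basis_def tr
    using markov_move[OF t(1,3,2)] eq d t by (simp add: det_mul mult_ac add_ac)
  show "torus_basis (V ** W) W" unfolding torus_basis_def tr
    using markov_move[OF t(3,2,1)] eq d t by (simp add: det_mul mult_ac add_ac)
  show "torus_basis W (matrix_inv V)" unfolding torus_basis_def tr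
    using markov_move[OF t eq] d t by (simp add: det1_inv trace_matrix_inv mult_ac add_ac)
qed

lemma gen_group_least:
  assumes "fgroup H" "V \<in> H" "W \<in> H"
  shows "gen_group V W \<subseteq> H"
proof -
  interpret fgroup H by (rule assms)
  have "word_mat V W w \<in> H" for w
  proof (induction w)
    case (Cons a w)
    have "letter_mat V W a \<in> H" using assms Gi by (cases a; cases "fst a") auto
    then show ?case using Cons Gm by simp
  qed (simp add: G1)
  then show ?thesis by (auto simp: gen_group_def)
qed

lemma gen_group_moves:
  assumes "torus_basis V W"
  shows "gen_group V (V ** W) = gen_group V W" "gen_group (V ** W) W = gen_group V W"
    "gen_group W (matrix_inv V) = gen_group V W"
proof -
  have d: "det V = 1" "det W = 1" using assms by (auto simp: torus_basis_def)
  note f = torus_fgroup[OF assms] torus_fgroup[OF torus_basis_moves(1)[OF assms]]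
    torus_fgroup[OF torus_basis_moves(2)[OF assms]] torus_fgroup[OF torus_basis_moves(3)[OF assms]]
  have W: "W = matrix_inv V ** (V ** W)" and V: "V = V ** W ** matrix_inv W"
    using d by (simp_all add: matrix_mul_assoc[symmetric] det1_inv) (simp add: matrix_mul_assoc det1_inv)
  have V': "V = matrix_inv (matrix_inv V)" using d by (simp add: matrix_inv_inv)
  have "W \<in> gen_group V (V ** W)"
    by (subst W) (intro fgroup.Gm[OF f(2)] fgroup.Gi[OF f(2)] gen_in_group)
  moreover have "V ** W \<in> gen_group V W" by (intro fgroup.Gm[OF f(1)] gen_in_group)
  ultimately show "gen_group V (V ** W) = gen_group V W"
    using gen_group_least f gen_in_group by (metis antisym)
  have "V \<in> gen_group (V ** W) W"
    by (subst V) (intro fgroup.Gm[OF f(3)] fgroup.Gi[OF f(3)] gen_in_group)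
  with \<open>V ** W \<in> gen_group V W\<close> show "gen_group (V ** W) W = gen_group V W"
    using gen_group_least f gen_in_group by (metis antisym)
  have "V \<in> gen_group W (matrix_inv V)"
    by (subst V') (intro fgroup.Gi[OF f(4)] gen_in_group)
  moreover have "matrix_inv V \<in> gen_group V W" by (intro fgroup.Gi[OF f(1)] gen_in_group)
  ultimately show "gen_group W (matrix_inv V) = gen_group V W"
    using gen_group_least f gen_in_group by (metis antisym)
qed

lemma basis_simple:
  assumes "torus_basis V W"
  shows "fgroup.simple_elt (gen_group V W) V" "fgroup.simple_elt (gen_group V W) W"
    "fgroup.simple_elt (gen_group V W) (V ** W)"
    and "card (geod_of (gen_group V W) V \<inter> geod_of (gen_group V W) W) = 1"
proof -
  have *: "fgroup.simple_elt (gen_group V W) V \<and> fgroup.simple_elt (gen_group V W) W \<and>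
     card (geod_of (gen_group V W) V \<inter> geod_of (gen_group V W) W) = 1" if b: "torus_basis V W" for V W
  proof -
    obtain v X sg where q: "ideal_quad v X sg" "X 0 = V" "X 3 = W" using b by (rule ex_ideal_quad)
    interpret ideal_quad v X sg by (rule q)
    have t: "trace (X 0) > 2" "trace (X 3) > 2" using b q by (auto simp: torus_basis_def)
    show ?thesis using letter_simple[OF t(1)] letter_simple[OF t(2)] letters_meet_once[OF t]
      unfolding word_prod_group q by blast
  qed
  show "fgroup.simple_elt (gen_group V W) V" "fgroup.simple_elt (gen_group V W) W"
    "card (geod_of (gen_group V W) V \<inter> geod_of (gen_group V W) W) = 1"
    using *[OF assms] by auto
  show "fgroup.simple_elt (gen_group V W) (V ** W)"
    using *[OF torus_basis_moves(1)[OF assms]] unfolding gen_group_moves(1)[OF assms] by blast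
qed

text \<open>The regions of the tree lying between the regions of \<open>V\<close> and \<open>W\<close>, addressed by turns.\<close>

fun region_mat :: "real^2^2 \<Rightarrow> real^2^2 \<Rightarrow> bool list \<Rightarrow> real^2^2" where
  "region_mat V W [] = V ** W"
| "region_mat V W (b # p) = (if b then region_mat V (V ** W) p else region_mat (V ** W) W p)"

lemma region_mat_simple:
  "torus_basis V W \<Longrightarrow> fgroup.simple_elt (gen_group V W) (region_mat V W p)"
proof (induction p arbitrary: V W)
  case Nil
  then show ?case using basis_simple by simp
next
  case (Cons b p)
  then show ?case
    using Cons.IH[OF torus_basis_moves(1)[OF Cons.prems]] Cons.IH[OF torus_basis_moves(2)[OF Cons.prems]]
    by (simp add: gen_group_moves)
qed

section \<open>Classification of the simple closed geodesics\<close>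

text \<open>Positive words in \<open>V\<close> (for \<open>True\<close>) and \<open>W\<close> (for \<open>False\<close>).\<close>

fun pos_word :: "real^2^2 \<Rightarrow> real^2^2 \<Rightarrow> bool list \<Rightarrow> real^2^2" where
  "pos_word V W [] = mat 1"
| "pos_word V W (b # P) = (if b then V else W) ** pos_word V W P"

lemma pos_word_append: "pos_word V W (P @ Q) = pos_word V W P ** pos_word V W Q"
  by (induction P) (simp_all add: matrix_mul_assoc)

lemma pos_word_const: "\<forall>b\<in>set P. b \<Longrightarrow> pos_word V W P = ((\<lambda>z. V ** z) ^^ length P) (mat 1)"
  "\<forall>b\<in>set P. \<not> b \<Longrightarrow> pos_word V W P = ((\<lambda>z. W ** z) ^^ length P) (mat 1)"
  by (induction P) auto

text \<open>A word in \<open>V\<close> and \<open>V ** W\<close>, written out in \<open>V\<close> and \<open>W\<close>; below likewise for words in \<open>V ** W\<close> and \<open>W\<close>.\<close>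

definition expand_left :: "bool list \<Rightarrow> bool list" where
  "expand_left Q = concat (map (\<lambda>b. if b then [True] else [True, False]) Q)"

definition expand_right :: "bool list \<Rightarrow> bool list" where
  "expand_right Q = concat (map (\<lambda>b. if b then [True, False] else [False]) Q)"

lemma pos_word_expand_left: "pos_word V W (expand_left Q) = pos_word V (V ** W) Q"
  by (induction Q) (auto simp: expand_left_def matrix_mul_assoc)

lemma pos_word_expand_right: "pos_word V W (expand_right Q) = pos_word (V ** W) W Q"
  by (induction Q) (auto simp: expand_right_def matrix_mul_assoc)

lemma length_expand_left: "False \<in> set (expand_left Q) \<Longrightarrow> length Q < length (expand_left Q)"
proof -
  have le: "length Q \<le> length (expand_left Q)" for Q by (induction Q) (simp_all add: expand_left_def)
  show "False \<in> set (expand_left Q) \<Longrightarrow> length Q < length (expand_left Q)"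
  proof (induction Q)
    case (Cons b Q)
    then show ?case using le[of Q] by (cases b) (simp_all add: expand_left_def)
  qed (simp add: expand_left_def)
qed

lemma length_expand_right: "True \<in> set (expand_right Q) \<Longrightarrow> length Q < length (expand_right Q)"
proof -
  have le: "length Q \<le> length (expand_right Q)" for Q by (induction Q) (simp_all add: expand_right_def)
  show "True \<in> set (expand_right Q) \<Longrightarrow> length Q < length (expand_right Q)"
  proof (induction Q)
    case (Cons b Q)
    then show ?case using le[of Q] by (cases b) (simp_all add: expand_right_def)
  qed (simp add: expand_right_def)
qed

text \<open>If no \<open>W\<close> follows a \<open>W\<close>, every \<open>W\<close> can be joined with the \<open>V\<close> before it.\<close>

lemma parse_L: "\<lbrakk>successively (\<or>) P; P = [] \<or> hd P\<rbrakk> \<Longrightarrow> \<exists>Q. P = expand_left Q"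
proof (induction P rule: length_induct)
  case (1 P)
  show ?case
  proof (cases P)
    case Nil
    then show ?thesis by (intro exI[of _ "[]"]) (simp add: expand_left_def)
  next
    case (Cons a r)
    then have a: "a" using 1(3) by simp
    show ?thesis
    proof (cases "r = [] \<or> hd r")
      case True
      moreover have "successively (\<or>) r" using 1(2) Cons by (auto simp: successively_Cons)
      moreover have "length r < length P" using Cons by simp
      ultimately obtain Q where "r = expand_left Q" using 1(1) by blast
      then show ?thesis using Cons a by (intro exI[of _ "True # Q"]) (simp add: expand_left_def)
    next
      case False
      then obtain r' where r: "r = False # r'" by (cases r) auto
      then have "successively (\<or>) r'" "r' = [] \<or> hd r'" using 1(2) Cons by (auto simp: successively_Cons)
      moreover have "length r' < length P" using Cons r by simp
      ultimately obtain Q where "r' = expand_left Q" using 1(1) by blast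
      then show ?thesis using Cons a r by (intro exI[of _ "False # Q"]) (simp add: expand_left_def)
    qed
  qed
qed

lemma parse_R: "\<lbrakk>successively (\<lambda>a b. \<not> a \<or> \<not> b) P; P = [] \<or> \<not> last P\<rbrakk> \<Longrightarrow> \<exists>Q. P = expand_right Q"
proof (induction P rule: length_induct)
  case (1 P)
  show ?case
  proof (cases P)
    case Nil
    then show ?thesis by (intro exI[of _ "[]"]) (simp add: expand_right_def)
  next
    case (Cons a r)
    have s: "successively (\<lambda>a b. \<not> a \<or> \<not> b) r" using 1(2) Cons by (auto simp: successively_Cons)
    show ?thesis
    proof (cases a)
      case False
      have "r = [] \<or> \<not> last r" using 1(3) Cons by auto
      moreover have "length r < length P" using Cons by simp
      ultimately obtain Q where "r = expand_right Q" using 1(1) s by blast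
      then show ?thesis using Cons False by (intro exI[of _ "False # Q"]) (simp add: expand_right_def)
    next
      case True
      then have "r \<noteq> []" using 1(3) Cons by auto
      then obtain r' where r: "r = False # r'" using 1(2) Cons True by (cases r) (auto simp: successively_Cons)
      then have "successively (\<lambda>a b. \<not> a \<or> \<not> b) r'" "r' = [] \<or> \<not> last r'"
        using s 1(3) Cons by (auto simp: successively_Cons)
      moreover have "length r' < length P" using Cons r by simp
      ultimately obtain Q where "r' = expand_right Q" using 1(1) by blast
      then show ?thesis using Cons True r by (intro exI[of _ "True # Q"]) (simp add: expand_right_def)
    qed
  qed
qed

lemma cyclic_successively:
  assumes c: "\<forall>i<length (P @ Q). R ((P @ Q) ! i) ((P @ Q) ! (Suc i mod length (P @ Q)))"
  shows "successively R (Q @ P)"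
proof -
  let ?n = "length (P @ Q)"
  have r: "rotate (length P) (P @ Q) = Q @ P" by (rule rotate_append)
  have "R ((Q @ P) ! i) ((Q @ P) ! Suc i)" if i: "Suc i < length (Q @ P)" for i
  proof -
    have n: "?n = length (Q @ P)" by simp
    have e: "(Q @ P) ! k = (P @ Q) ! ((length P + k) mod ?n)" if "k < ?n" for k
      using nth_rotate[OF that, of "length P"] unfolding r .
    have "(length P + i) mod ?n < ?n" using i by (intro mod_less_divisor) auto
    from c[rule_format, OF this] show ?thesis
      using e[of i] e[of "Suc i"] i by (simp add: mod_Suc_eq add.commute)
  qed
  then show ?thesis unfolding successively_conv_nth by auto
qed

context ideal_quad
begin

lemma simple_word_eigen:
  assumes "Gr.simple_elt (word_prod w)"
  obtains p q lam where "word_prod w *v p = (1/lam) *\<^sub>R p" "p \<noteq> 0" "word_prod w *v q = lam *\<^sub>R q" "q \<noteq> 0" "\<bar>lam\<bar> > 1"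
    "\<And>u. \<not> link p q (word_prod u *v p) (word_prod u *v q) < 0"
proof -
  obtain c l where s: "simple_loop (range word_prod) c l (word_prod w)" using assms by (auto simp: Gr.simple_elt_def)
  then have "closes_up (range word_prod) c l (word_prod w)" by (simp add: simple_loop_def)
  then obtain p q e where 1: "wedge q p = 1" "c = geo_line p q" "l > 0" "e = 1 \<or> e = (-1::real)"
    "word_prod w *v p = (e * exp (- l/2)) *\<^sub>R p" "word_prod w *v q = (e * exp (l/2)) *\<^sub>R q"
    by (rule Gr.closes_upD)
  have nz: "p \<noteq> 0" "q \<noteq> 0" using 1(1) by auto
  have pr: "exp (l/2) * exp (- l/2) = 1" by (simp flip: exp_add)
  have "(e * exp (l/2)) * (e * exp (- l/2)) = (e * e) * (exp (l/2) * exp (- l/2))" by (simp only: mult_ac)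
  also have "\<dots> = 1" unfolding pr using 1(4) by auto
  finally have pe: "(e * exp (l/2)) * (e * exp (- l/2)) = 1" .
  then have "e * exp (l/2) \<noteq> 0" by auto
  with pe have "e * exp (- l/2) = 1 / (e * exp (l/2))" by (metis nonzero_mult_div_cancel_left)
  moreover have "\<bar>e * exp (l/2)\<bar> > 1" using 1(3,4) by (auto simp: abs_mult)
  ultimately show ?thesis
    using that[of p "e * exp (l/2)" q] 1(5,6) nz Gr.simple_unlinked[OF s 1(2,1)] by simp
qed

lemma pos_word_word_prod: "pos_word (X 0) (X 3) P = word_prod (map (\<lambda>b. if b then 0 else 3) P)"
  by (induction P) auto

text \<open>The geodesic of a positive word in which both generators are repeated crosses the
  quadrilateral between both pairs of opposite sides.\<close>

lemma positive_cases:
  assumes s: "Gr.simple_elt (pos_word (X 0) (X 3) P)" and P: "P \<noteq> []"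
  shows "(\<forall>i<length P. P ! i \<or> P ! (Suc i mod length P)) \<or> (\<forall>i<length P. \<not> P ! i \<or> \<not> P ! (Suc i mod length P))"
proof (rule ccontr)
  let ?w = "map (\<lambda>b. if b then 0 else 3 :: int) P"
  assume "\<not> ?thesis"
  then obtain i i' where i: "i < length P" "\<not> P ! i" "\<not> P ! (Suc i mod length P)"
    "i' < length P" "P ! i'" "P ! (Suc i' mod length P)" by blast
  have m: "Suc k mod length P < length P" for k using P by simp
  have nc: "\<not> cancels 0 0" "\<not> cancels 0 3" "\<not> cancels 3 0" "\<not> cancels 3 3" by (simp_all add: cancels_def)
  have "cyc_red_word ?w"
    unfolding cyc_red_word_def red_word_def successively_conv_nth
    using P by (auto simp: last_map hd_map nc)
  moreover have "?w \<noteq> []" using P by simp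
  moreover obtain p q lam where "word_prod ?w *v p = (1/lam) *\<^sub>R p" "p \<noteq> 0" "word_prod ?w *v q = lam *\<^sub>R q" "q \<noteq> 0" "\<bar>lam\<bar> > 1"
    "\<And>u. \<not> link p q (word_prod u *v p) (word_prod u *v q) < 0"
    using simple_word_eigen s unfolding pos_word_word_prod by metis
  ultimately show False
    using axis_letters(2)[of ?w p lam q i i' 3] i m by simp
qed

end

text \<open>A power of \<open>V\<close> or \<open>W\<close> is simple only if it is this generator itself. Otherwise both letters occur and one of them is isolated, in the
  cyclic sense. Joining it with its neighbour gives a shorter word in one of the two adjacent bases.\<close>

lemma descend:
  assumes "torus_basis V W" "P \<noteq> []" "fgroup.simple_elt (gen_group V W) (pos_word V W P)"
  shows "geod_of (gen_group V W) (pos_word V W P) \<in>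
    {geod_of (gen_group V W) V, geod_of (gen_group V W) W} \<union> range (\<lambda>p. geod_of (gen_group V W) (region_mat V W p))"
  using assms
proof (induction "length P" arbitrary: V W P rule: less_induct)
  case less
  let ?G = "gen_group V W"
  interpret G: fgroup ?G by (rule torus_fgroup[OF less.prems(1)])
  have VW: "V \<in> ?G" "W \<in> ?G" by (rule gen_in_group)+
  have pmG: "pos_word V W Q \<in> ?G" for Q by (induction Q) (use G.G1 G.Gm VW in auto)
  have rot: "G.simple_elt (pos_word V W (R @ Q)) \<and> geod_of ?G (pos_word V W (R @ Q)) = geod_of ?G (pos_word V W (Q @ R))"
    if QR: "P = Q @ R" for Q R
  proof -
    let ?h = "matrix_inv (pos_word V W Q)"
    have d: "det (pos_word V W Q) = 1" by (rule G.Gdet[OF pmG])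
    have h: "?h ** pos_word V W (Q @ R) ** matrix_inv ?h = pos_word V W (R @ Q)"
      by (simp add: pos_word_append matrix_inv_inv d matrix_mul_assoc det1_inv)
    show ?thesis
      using G.simple_elt_conj[OF less.prems(3)[unfolded QR], of ?h] G.Gi[OF pmG[of Q]] unfolding h by blast
  qed
  consider "\<forall>b\<in>set P. b" | "\<forall>b\<in>set P. \<not> b" | "True \<in> set P" "False \<in> set P" by (metis (full_types))
  then show ?case
  proof cases
    case 1
    then have "length P = 1" using G.simple_elt_not_power[OF less.prems(3) VW(1)] pos_word_const(1) by blast
    then show ?thesis using 1 by (cases P) auto
  next
    case 2
    then have "length P = 1" using G.simple_elt_not_power[OF less.prems(3) VW(2)] pos_word_const(2) by blast
    then show ?thesis using 2 by (cases P) auto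
  next
    case 3
    obtain v X sg where q: "ideal_quad v X sg" "X 0 = V" "X 3 = W" using less.prems(1) by (rule ex_ideal_quad)
    interpret ideal_quad v X sg by (rule q)
    have gx: "range word_prod = ?G" using word_prod_group q by simp
    have "(\<forall>i<length P. P ! i \<or> P ! (Suc i mod length P)) \<or> (\<forall>i<length P. \<not> P ! i \<or> \<not> P ! (Suc i mod length P))"
      using positive_cases[of P] less.prems(2,3) unfolding gx q by blast
    then show ?thesis
    proof
      assume c: "\<forall>i<length P. P ! i \<or> P ! (Suc i mod length P)"
      obtain Q R where QR: "P = Q @ True # R" using 3(1) by (meson split_list)
      have "successively (\<or>) ((True # R) @ Q)"
        using c unfolding QR by (rule cyclic_successively)
      then obtain P' where P': "(True # R) @ Q = expand_left P'" using parse_L[of "(True # R) @ Q"] by auto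
      have "False \<in> set (expand_left P')" using 3(2) unfolding P'[symmetric] QR by auto
      then have len: "length P' < length P" using length_expand_left[of P'] unfolding P'[symmetric] QR by simp
      have ne: "P' \<noteq> []" using P' by (auto simp: expand_left_def)
      note mv = torus_basis_moves(1)[OF less.prems(1)] gen_group_moves(1)[OF less.prems(1)]
      have r: "G.simple_elt (pos_word V (V ** W) P')" "geod_of ?G (pos_word V W P) = geod_of ?G (pos_word V (V ** W) P')"
        using rot[OF QR] unfolding P' pos_word_expand_left QR[symmetric] by auto
      from less.hyps[OF len mv(1) ne, unfolded mv(2), OF r(1)]
      consider "geod_of ?G (pos_word V W P) = geod_of ?G V" | "geod_of ?G (pos_word V W P) = geod_of ?G (V ** W)"
        | p where "geod_of ?G (pos_word V W P) = geod_of ?G (region_mat V (V ** W) p)"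
        unfolding r(2) by blast
      then show ?thesis
      proof cases
        case 2
        then show ?thesis by (intro UnI2 range_eqI[of _ _ "[]"]) simp
      next
        case (3 p)
        then show ?thesis by (intro UnI2 range_eqI[of _ _ "True # p"]) simp
      qed simp
    next
      assume c: "\<forall>i<length P. \<not> P ! i \<or> \<not> P ! (Suc i mod length P)"
      obtain Q R where QR': "P = Q @ False # R" using 3(2) by (meson split_list)
      then have QR: "P = (Q @ [False]) @ R" by simp
      have "successively (\<lambda>a b. \<not> a \<or> \<not> b) (R @ (Q @ [False]))"
        using c unfolding QR by (rule cyclic_successively)
      then obtain P' where P': "R @ (Q @ [False]) = expand_right P'" using parse_R[of "R @ (Q @ [False])"] by auto
      have "True \<in> set (expand_right P')" using 3(1) unfolding P'[symmetric] QR by auto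
      then have len: "length P' < length P" using length_expand_right[of P'] unfolding P'[symmetric] QR by simp
      have ne: "P' \<noteq> []" using P' by (auto simp: expand_right_def)
      note mv = torus_basis_moves(2)[OF less.prems(1)] gen_group_moves(2)[OF less.prems(1)]
      have r: "G.simple_elt (pos_word (V ** W) W P')" "geod_of ?G (pos_word V W P) = geod_of ?G (pos_word (V ** W) W P')"
        using rot[OF QR] unfolding P' pos_word_expand_right QR[symmetric] by auto
      from less.hyps[OF len mv(1) ne, unfolded mv(2), OF r(1)]
      consider "geod_of ?G (pos_word V W P) = geod_of ?G W" | "geod_of ?G (pos_word V W P) = geod_of ?G (V ** W)"
        | p where "geod_of ?G (pos_word V W P) = geod_of ?G (region_mat (V ** W) W p)"
        unfolding r(2) by blast
      then show ?thesis
      proof cases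
        case 2
        then show ?thesis by (intro UnI2 range_eqI[of _ _ "[]"]) simp
      next
        case (3 p)
        then show ?thesis by (intro UnI2 range_eqI[of _ _ "False # p"]) simp
      qed simp
    qed
  qed
qed

context ideal_quad
begin

lemma letters_positive:
  assumes "\<forall>j\<in>set w. 4 dvd (j - k) \<or> 4 dvd (j - (k + 1))"
  shows "4 dvd (k - 3) \<Longrightarrow> word_prod w = pos_word (X 0) (X 3) (map (\<lambda>j. 4 dvd j) w)"
    and "4 dvd (k - 2) \<Longrightarrow> word_prod w = pos_word (X 3) (X 2) (map (\<lambda>j. 4 dvd (j - 3)) w)"
proof -
  have aux: "\<lbrakk>4 dvd (a - k) \<or> 4 dvd (a - (k + 1)); 4 dvd (k - 3); \<not> 4 dvd a\<rbrakk> \<Longrightarrow> 4 dvd (a - 3)"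
    "\<lbrakk>4 dvd (a - k) \<or> 4 dvd (a - (k + 1)); 4 dvd (k - 2); \<not> 4 dvd (a - 3)\<rbrakk> \<Longrightarrow> 4 dvd (a - 2)" for a
    by presburger+
  show "word_prod w = pos_word (X 0) (X 3) (map (\<lambda>j. 4 dvd j) w)" if k: "4 dvd (k - 3)"
    using assms
  proof (induction w)
    case (Cons a w)
    have "if 4 dvd a then 4 dvd (a - 0) else 4 dvd (a - 3)"
      using aux(1)[of a] Cons.prems k by auto
    then have "X a = (if 4 dvd a then X 0 else X 3)" using X_cong by (metis (full_types))
    then show ?case using Cons by simp
  qed simp
  show "word_prod w = pos_word (X 3) (X 2) (map (\<lambda>j. 4 dvd (j - 3)) w)" if k: "4 dvd (k - 2)"
    using assms
  proof (induction w)
    case (Cons a w)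
    have "if 4 dvd (a - 3) then 4 dvd (a - 3) else 4 dvd (a - 2)"
      using aux(2)[of a] Cons.prems k by auto
    then have "X a = (if 4 dvd (a - 3) then X 3 else X 2)" using X_cong by (metis (full_types))
    then show ?case using Cons by simp
  qed simp
qed

end

text \<open>The letters in the word of a simple closed geodesic belong to two adjacent sides. Up to inversion of the word, the word is therefore
  positive in the pair \<open>A\<close>, \<open>B\<close> or in the pair \<open>B\<close>, \<open>matrix_inv A\<close>.\<close>

theorem classification:
  assumes b: "torus_basis A B" and s: "fgroup.simple_elt (gen_group A B) g"
  shows "geod_of (gen_group A B) g \<in> {geod_of (gen_group A B) A, geod_of (gen_group A B) B} \<union>
    range (\<lambda>p. geod_of (gen_group A B) (region_mat A B p)) \<union>
    range (\<lambda>p. geod_of (gen_group A B) (region_mat B (matrix_inv A) p))"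
proof -
  let ?G = "gen_group A B"
  obtain v X sg where q: "ideal_quad v X sg" "X 0 = A" "X 3 = B" using b by (rule ex_ideal_quad)
  interpret ideal_quad v X sg by (rule q)
  have gx: "range word_prod = ?G" using word_prod_group q by simp
  have s': "Gr.simple_elt g" using s unfolding gx .
  have X2: "X 2 = matrix_inv A"
    using matrix_inv_unique2[OF detX, of 0 "X 2"] Xinv[of 0] q by simp
  have gG: "g \<in> range word_prod" using s' by (auto simp: Gr.simple_elt_def simple_loop_def closes_up_def)
  then obtain w0 where w0: "g = word_prod w0" by blast
  obtain h w where hw: "cyc_red_word w" "word_prod w0 = word_prod h ** word_prod w ** word_prod (inv_word h)" using ex_cyc_red_word by blast
  have cw: "word_prod w = word_prod (inv_word h) ** g ** matrix_inv (word_prod (inv_word h))"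
    unfolding w0 hw(2) by (simp add: matrix_mul_assoc word_prod_inv_word matrix_inv_word_prod[symmetric] matrix_inv_inv det_word_prod det1_inv
      matrix_mul_assoc[symmetric, of "word_prod w"])
  have "word_prod (inv_word h) \<in> range word_prod" by simp
  note cj = Gr.simple_elt_conj[OF s' this, folded cw]
  have sw: "Gr.simple_elt (word_prod w)" by (rule cj)
  have gw: "geod_of ?G (word_prod w) = geod_of ?G g" using cj(2) unfolding gx .
  obtain p r lam where ev: "word_prod w *v p = (1/lam) *\<^sub>R p" "p \<noteq> 0" "word_prod w *v r = lam *\<^sub>R r" "r \<noteq> 0" "\<bar>lam\<bar> > 1"
    "\<And>u. \<not> link p r (word_prod u *v p) (word_prod u *v r) < 0"
    using simple_word_eigen[OF sw] by metis
  have ne: "w \<noteq> []"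
  proof
    assume "w = []"
    then have "1 *\<^sub>R r = lam *\<^sub>R r" using ev(3) by simp
    then have "lam = 1" using ev(4) by (simp only: scaleR_cancel_right) auto
    then show False using ev(5) by simp
  qed
  obtain k where k: "\<forall>j\<in>set w. 4 dvd (j - k) \<or> 4 dvd (j - (k + 1))"
    using axis_letters(1)[OF hw(1) ne ev] by blast
  have pos: "geod_of ?G (word_prod y) \<in> {geod_of ?G A, geod_of ?G B} \<union> range (\<lambda>p. geod_of ?G (region_mat A B p)) \<union>
     range (\<lambda>p. geod_of ?G (region_mat B (matrix_inv A) p))"
    if y: "y \<noteq> []" "Gr.simple_elt (word_prod y)" "\<forall>j\<in>set y. 4 dvd (j - k) \<or> 4 dvd (j - (k + 1))"
      "4 dvd (k - 3) \<or> 4 dvd (k - 2)" for y k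
    using y(4)
  proof
    assume "4 dvd (k - 3)"
    note e = letters_positive(1)[OF y(3) this, unfolded q]
    show ?thesis
      using descend[OF b, of "map (\<lambda>j. 4 dvd j) y"] y(1,2) unfolding e gx by auto
  next
    assume "4 dvd (k - 2)"
    note e = letters_positive(2)[OF y(3) this, unfolded q X2]
    have "geod_of ?G (matrix_inv A) = geod_of ?G A"
      using Gr.simple_elt_inv(2)[of A] basis_simple(1)[OF b] unfolding gx by blast
    then show ?thesis
      using descend[OF torus_basis_moves(3)[OF b], of "map (\<lambda>j. 4 dvd (j - 3)) y"] y(1,2)
      unfolding e gx gen_group_moves(3)[OF b] by auto
  qed
  show ?thesis
  proof (cases "4 dvd (k - 3) \<or> 4 dvd (k - 2)")
    case True
    then show ?thesis using pos[OF ne sw k] gw by simp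
  next
    case False
    then have k2: "4 dvd (k + 2 - 3) \<or> 4 dvd (k + 2 - 2)" by presburger
    have "Gr.simple_elt (word_prod (inv_word w))" "geod_of ?G (word_prod (inv_word w)) = geod_of ?G (word_prod w)"
      using Gr.simple_elt_inv[OF sw] unfolding matrix_inv_word_prod gx by auto
    moreover have "inv_word w \<noteq> []" using ne by (simp add: inv_word_def)
    moreover have "\<forall>j\<in>set (inv_word w). 4 dvd (j - (k + 2)) \<or> 4 dvd (j - (k + 2 + 1))"
      using k by (auto simp: inv_word_def algebra_simps)
    ultimately show ?thesis using pos[OF _ _ _ k2, of "inv_word w"] gw by simp
  qed
qed

section \<open>Slopes and heights\<close>

lemma exponent_sum_simps [simp]:
  "exponent_sum g [] = 0"
  "exponent_sum g ((x, e) # w) = (if x = g then (if e then 1 else -1) else 0) + exponent_sum g w"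
  "exponent_sum g (v @ w) = exponent_sum g v + exponent_sum g w"
  by (simp_all add: exponent_sum_def)

definition word_inverse :: "word \<Rightarrow> word" where
  "word_inverse w = rev (map (\<lambda>(g, e). (g, \<not> e)) w)"

lemma exponent_sum_word_inverse: "exponent_sum g (word_inverse w) = - exponent_sum g w"
proof (induction w)
  case (Cons a w)
  then show ?case by (cases a) (simp add: word_inverse_def)
qed (simp add: word_inverse_def)

lemma letter_mat_cancel:
  assumes "det A = 1" "det B = 1"
  shows "letter_mat A B (g, e) ** letter_mat A B (g, \<not> e) = mat 1"
  using assms by (cases g; cases e) (simp_all add: det1_inv)

lemma word_mat_word_inverse:
  assumes "det A = 1" "det B = 1"
  shows "det (word_mat A B w) = 1" "word_mat A B (word_inverse w) = matrix_inv (word_mat A B w)"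
proof -
  have dl: "det (letter_mat A B a) = 1" for a
    using assms by (cases a; cases "fst a") (auto simp: det1_inv)
  show d: "det (word_mat A B w) = 1" for w
    by (induction w) (simp_all add: det_mul dl)
  have "word_mat A B w ** word_mat A B (word_inverse w) = mat 1"
  proof (induction w)
    case (Cons a w)
    obtain g e where a: "a = (g, e)" by (cases a)
    have "word_mat A B (a # w) ** word_mat A B (word_inverse (a # w)) =
        letter_mat A B (g, e) ** (word_mat A B w ** word_mat A B (word_inverse w)) ** letter_mat A B (g, \<not> e)"
      by (simp add: a word_inverse_def word_mat_append matrix_mul_assoc)
    then show ?case using Cons letter_mat_cancel[OF assms] by simp
  qed (simp add: word_inverse_def)
  then show "word_mat A B (word_inverse w) = matrix_inv (word_mat A B w)"
    using matrix_inv_unique2[OF d] by metis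
qed

lemma ex_reduced:
  assumes "det A = 1" "det B = 1"
  shows "\<exists>w'. reduced w' \<and> word_mat A B w' = word_mat A B w \<and> (\<forall>g. exponent_sum g w' = exponent_sum g w)"
proof (induction w)
  case Nil
  show ?case by (intro exI[of _ "[]"]) (simp add: reduced_def)
next
  case (Cons a w)
  then obtain w' where w': "reduced w'" "word_mat A B w' = word_mat A B w" "\<forall>g. exponent_sum g w' = exponent_sum g w"
    by blast
  obtain g e where a: "a = (g, e)" by (cases a)
  show ?case
  proof (cases "\<exists>r. w' = (g, \<not> e) # r")
    case True
    then obtain r where r: "w' = (g, \<not> e) # r" by blast
    have "word_mat A B (a # w) = letter_mat A B (g, e) ** letter_mat A B (g, \<not> e) ** word_mat A B r"
      using w'(2) unfolding r by (simp add: a flip: matrix_mul_assoc)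
    then have "word_mat A B (a # w) = word_mat A B r" by (simp add: letter_mat_cancel[OF assms])
    moreover have "reduced r" using w'(1) unfolding r by (auto simp: reduced_def successively_Cons)
    moreover have "\<forall>h. exponent_sum h r = exponent_sum h (a # w)"
      using w'(3) unfolding r a by (auto split: if_splits)
    ultimately show ?thesis by metis
  next
    case False
    then have "reduced (a # w')" using w'(1) unfolding a
      by (cases w') (auto simp: reduced_def successively_Cons)
    then show ?thesis using w' by (intro exI[of _ "a # w'"]) (simp add: a)
  qed
qed

lemma exponent_sum_unique:
  assumes "det A = 1" "det B = 1" "free_on A B" "word_mat A B w = word_mat A B w'"
  shows "exponent_sum g w = exponent_sum g w'"
proof -
  obtain r where r: "reduced r" "word_mat A B r = word_mat A B (w @ word_inverse w')"
    "\<And>g. exponent_sum g r = exponent_sum g (w @ word_inverse w')"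
    using ex_reduced[OF assms(1,2)] by blast
  have "word_mat A B r = mat 1"
    using r(2) assms(4) by (simp add: word_mat_append word_mat_word_inverse[OF assms(1,2)] det1_inv)
  then have "r = []" using assms(3) r(1) unfolding free_on_def by blast
  then show ?thesis using r(3)[of g] by (simp add: exponent_sum_word_inverse)
qed

definition slope :: "word \<Rightarrow> int \<times> int" where
  "slope w = (exponent_sum GenA w, exponent_sum GenB w)"

definition slope_height :: "int \<times> int \<Rightarrow> int" where
  "slope_height = (\<lambda>(p, q). Max {\<bar>p\<bar>, \<bar>q\<bar>, \<bar>p - q\<bar>})"

locale marked_torus =
  fixes A B :: "real^2^2"
  assumes basis: "torus_basis A B" and free: "free_on A B"
begin

abbreviation "G \<equiv> gen_group A B"

sublocale fgroup G
  by (rule torus_fgroup[OF basis])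

lemma dets: "det A = 1" "det B = 1"
  using basis by (auto simp: torus_basis_def)

text \<open>Equal geodesics come from elements that are conjugate up to inversion, and conjugation does not change exponent sums.\<close>

lemma same_geod_slope:
  assumes "simple_elt (word_mat A B w)" "simple_elt (word_mat A B w')"
    and "geod_of G (word_mat A B w) = geod_of G (word_mat A B w')"
  shows "slope w' = slope w \<or> slope w' = - slope w"
proof -
  obtain h where h: "h \<in> G" "word_mat A B w' = h ** word_mat A B w ** matrix_inv h \<or>
      word_mat A B w' = h ** matrix_inv (word_mat A B w) ** matrix_inv h"
    using simple_elt_same_geod[OF assms] by blast
  obtain u where u: "h = word_mat A B u" using h(1) by (auto simp: gen_group_def)
  have sc: "slope x = slope y" if "word_mat A B x = word_mat A B y" for x y
    using exponent_sum_unique[OF dets free that] by (simp add: slope_def)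
  have "word_mat A B w' = word_mat A B (u @ w @ word_inverse u) \<or> word_mat A B w' = word_mat A B (u @ word_inverse w @ word_inverse u)"
    using h(2) unfolding u by (simp add: word_mat_append word_mat_word_inverse[OF dets] matrix_mul_assoc)
  then have "slope w' = slope (u @ w @ word_inverse u) \<or> slope w' = slope (u @ word_inverse w @ word_inverse u)"
    using sc by blast
  then show ?thesis by (simp add: slope_def exponent_sum_word_inverse)
qed

lemma height_eq:
  assumes s: "simple_elt (word_mat A B w)"
  shows "int (height A B (geod_of G (word_mat A B w))) = slope_height (slope w)"
proof -
  let ?C = "geod_of G (word_mat A B w)"
  obtain c l where cl: "simple_loop G c l (word_mat A B w)" using s by (auto simp: simple_elt_def)
  have "?C = loop_image G c l" using geod_of_eq cl by (simp add: simple_loop_def)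
  then have hs: "has_slope A B ?C (exponent_sum GenA w) (exponent_sum GenB w)"
    using cl unfolding has_slope_def by blast
  have m: "slope_height (slope w) = Max {\<bar>exponent_sum GenA w\<bar>, \<bar>exponent_sum GenB w\<bar>, \<bar>exponent_sum GenA w - exponent_sum GenB w\<bar>}"
    by (simp add: slope_height_def slope_def)
  have n0: "slope_height (slope w) \<ge> 0" by (simp add: m le_max_iff_disj)
  have "height A B ?C = nat (slope_height (slope w))"
    unfolding height_def
  proof (rule the_equality)
    show "\<exists>p q. has_slope A B ?C p q \<and> int (nat (slope_height (slope w))) = Max {\<bar>p\<bar>, \<bar>q\<bar>, \<bar>p - q\<bar>}"
      using hs n0 m by (metis nat_0_le)
  next
    fix n assume "\<exists>p q. has_slope A B ?C p q \<and> int n = Max {\<bar>p\<bar>, \<bar>q\<bar>, \<bar>p - q\<bar>}"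
    then obtain c' l' w' where w': "simple_loop G c' l' (word_mat A B w')" "?C = loop_image G c' l'"
      "int n = slope_height (slope w')"
      by (auto simp: has_slope_def slope_height_def slope_def)
    have s': "simple_elt (word_mat A B w')" using w'(1) by (auto simp: simple_elt_def)
    have "?C = geod_of G (word_mat A B w')"
      using w'(2) geod_of_eq[of c' l' "word_mat A B w'"] w'(1) by (simp add: simple_loop_def)
    from same_geod_slope[OF s s' this] have "slope_height (slope w') = slope_height (slope w)"
      by (auto simp: slope_height_def slope_def abs_minus_commute)
    then show "n = nat (slope_height (slope w))" using w'(3) by simp
  qed
  then show ?thesis using n0 by simp
qed

end

fun region_word :: "word \<Rightarrow> word \<Rightarrow> bool list \<Rightarrow> word" where
  "region_word v w [] = v @ w"
| "region_word v w (b # p) = (if b then region_word v (v @ w) p else region_word (v @ w) w p)"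

lemma word_mat_region_word: "word_mat A B (region_word v w p) = region_mat (word_mat A B v) (word_mat A B w) p"
  by (induction p arbitrary: v w) (simp_all add: word_mat_append)

text \<open>Coordinates of a region with respect to the two regions that bound its sector: an enumeration
  of the pairs of coprime positive integers by the Stern-Brocot tree.\<close>

fun stern_brocot :: "bool list \<Rightarrow> nat \<times> nat" where
  "stern_brocot [] = (1, 1)"
| "stern_brocot (b # p) = (case stern_brocot p of (m, n) \<Rightarrow> if b then (m + n, n) else (m, m + n))"

lemma stern_brocot_pos: "stern_brocot p = (m, n) \<Longrightarrow> m > 0 \<and> n > 0"
  by (induction p arbitrary: m n) (auto split: prod.splits if_splits)

lemma stern_brocot_inj: "stern_brocot p = stern_brocot p' \<Longrightarrow> p = p'"
proof (induction p arbitrary: p')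
  case Nil
  show ?case
  proof (cases p')
    case (Cons b r)
    obtain m n where "stern_brocot r = (m, n)" by force
    then show ?thesis using Nil Cons stern_brocot_pos[of r m n] by (auto split: if_splits)
  qed simp
next
  case (Cons b p)
  obtain m n where mn: "stern_brocot p = (m, n)" by force
  note pos = stern_brocot_pos[OF mn]
  show ?case
  proof (cases p')
    case Nil
    then show ?thesis using Cons.prems mn pos by (auto split: if_splits)
  next
    case (Cons b' r)
    obtain m' n' where mn': "stern_brocot r = (m', n')" by force
    have "b = b' \<and> m = m' \<and> n = n'"
      using Cons.prems mn mn' pos stern_brocot_pos[OF mn'] \<open>p' = b' # r\<close> by (cases b; cases b') auto
    then show ?thesis using Cons.IH[of r] mn mn' \<open>p' = b' # r\<close> by simp
  qed
qed

lemma exponent_sum_region_word: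
  "stern_brocot p = (m, n) \<Longrightarrow> exponent_sum g (region_word v w p) = int m * exponent_sum g v + int n * exponent_sum g w"
proof (induction p arbitrary: m n v w)
  case (Cons b p)
  obtain m' n' where mn: "stern_brocot p = (m', n')" by force
  show ?case
    using Cons.prems mn Cons.IH[OF mn, of v "v @ w"] Cons.IH[OF mn, of "v @ w" w]
    by (cases b) (auto simp: algebra_simps)
qed auto

fun region_trace :: "real \<Rightarrow> real \<Rightarrow> real \<Rightarrow> bool list \<Rightarrow> real" where
  "region_trace x y z [] = z"
| "region_trace x y z (b # p) = (if b then region_trace x z (x * z - y) p else region_trace z y (z * y - x) p)"

lemma trace_region_mat:
  "torus_basis V W \<Longrightarrow> trace (region_mat V W p) = region_trace (trace V) (trace W) (trace (V ** W)) p \<and> trace (region_mat V W p) > 2"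
proof (induction p arbitrary: V W)
  case Nil
  then show ?case by (simp add: torus_basis_def)
next
  case (Cons b p)
  show ?case
    using Cons.IH[OF torus_basis_moves(1)[OF Cons.prems]] Cons.IH[OF torus_basis_moves(2)[OF Cons.prems]]
    by (simp add: torus_basis_traces[OF Cons.prems])
qed

context marked_torus
begin

definition geo_plus :: "bool list \<Rightarrow> complex set set" where
  "geo_plus p = geod_of G (region_mat A B p)"

definition geo_minus :: "bool list \<Rightarrow> complex set set" where
  "geo_minus p = geod_of G (region_mat B (matrix_inv A) p)"

definition "wA = [(GenA, True)]"
definition "wB = [(GenB, True)]"
definition "wa = [(GenA, False)]"

lemma wmats: "word_mat A B wA = A" "word_mat A B wB = B" "word_mat A B wa = matrix_inv A"
  by (simp_all add: wA_def wB_def wa_def)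

lemma nd_words: "region_mat A B p = word_mat A B (region_word wA wB p)" "region_mat B (matrix_inv A) p = word_mat A B (region_word wB wa p)"
  by (simp_all add: word_mat_region_word wmats)

lemma simples: "simple_elt A" "simple_elt B" "simple_elt (region_mat A B p)" "simple_elt (region_mat B (matrix_inv A) p)"
  using basis_simple[OF basis] region_mat_simple[OF basis] region_mat_simple[OF torus_basis_moves(3)[OF basis]]
  unfolding gen_group_moves[OF basis] by auto

lemma word_simples: "simple_elt (word_mat A B wA)" "simple_elt (word_mat A B wB)"
  "simple_elt (word_mat A B (region_word wA wB p))" "simple_elt (word_mat A B (region_word wB wa p))"
  using simples by (simp_all add: wmats word_mat_region_word)

lemma slopes:
  assumes "stern_brocot p = (m, n)"
  shows "slope (region_word wA wB p) = (int m, int n)" "slope (region_word wB wa p) = (- int n, int m)"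
  by (simp_all add: slope_def exponent_sum_region_word[OF assms] wA_def wB_def wa_def)

lemma slopes0: "slope wA = (1, 0)" "slope wB = (0, 1)"
  by (simp_all add: slope_def wA_def wB_def)

lemma geodesics_enum:
  "simple_closed_geodesics G = {geod_of G A, geod_of G B} \<union> range geo_plus \<union> range geo_minus"
proof -
  have "geod_of G g \<in> {geod_of G A, geod_of G B} \<union> range geo_plus \<union> range geo_minus" if "simple_elt g" for g
    using classification[OF basis that] unfolding geo_plus_def geo_minus_def .
  moreover have "geod_of G g \<in> simple_closed_geodesics G" if "simple_elt g" for g
    using that unfolding simple_closed_geodesics_eq by blast
  ultimately show ?thesis
    using simples unfolding simple_closed_geodesics_eq geo_plus_def geo_minus_def by blast
qed

lemma geodesics_distinct:
  "inj geo_plus" "inj geo_minus" "range geo_plus \<inter> range geo_minus = {}"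
  "geod_of G A \<noteq> geod_of G B"
  "geod_of G A \<notin> range geo_plus" "geod_of G B \<notin> range geo_plus"
  "geod_of G A \<notin> range geo_minus" "geod_of G B \<notin> range geo_minus"
proof -
  have *: "slope w' = slope w \<or> slope w' = - slope w"
    if "simple_elt (word_mat A B w)" "simple_elt (word_mat A B w')" "geod_of G (word_mat A B w) = geod_of G (word_mat A B w')"
    for w w' using same_geod_slope that by blast
  note s = word_simples
  have positive: "\<exists>m n. stern_brocot p = (m, n) \<and> m > 0 \<and> n > 0" for p
    using stern_brocot_pos[of p "fst (stern_brocot p)" "snd (stern_brocot p)"] by (metis prod.collapse)
  show "inj geo_plus"
  proof (rule injI)
    fix p p' assume eq: "geo_plus p = geo_plus p'"
    obtain m n m' n' where mn: "stern_brocot p = (m, n)" "stern_brocot p' = (m', n')" "m > 0" "m' > 0" using positive[of p] positive[of p'] by blast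
    have "slope (region_word wA wB p') = slope (region_word wA wB p) \<or> slope (region_word wA wB p') = - slope (region_word wA wB p)"
      by (rule *) (use s eq in \<open>simp_all add: geo_plus_def nd_words\<close>)
    then show "p = p'" using mn slopes stern_brocot_inj by auto
  qed
  show "inj geo_minus"
  proof (rule injI)
    fix p p' assume eq: "geo_minus p = geo_minus p'"
    obtain m n m' n' where mn: "stern_brocot p = (m, n)" "stern_brocot p' = (m', n')" "m > 0" "m' > 0" using positive[of p] positive[of p'] by blast
    have "slope (region_word wB wa p') = slope (region_word wB wa p) \<or> slope (region_word wB wa p') = - slope (region_word wB wa p)"
      by (rule *) (use s eq in \<open>simp_all add: geo_minus_def nd_words\<close>)
    then show "p = p'" using mn slopes stern_brocot_inj by auto
  qed
  have "geo_plus p \<noteq> geo_minus p'" for p p'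
  proof
    assume eq: "geo_plus p = geo_minus p'"
    obtain m n m' n' where mn: "stern_brocot p = (m, n)" "stern_brocot p' = (m', n')" "m > 0" "m' > 0" "n > 0" "n' > 0" using positive[of p] positive[of p'] by blast
    have "slope (region_word wB wa p') = slope (region_word wA wB p) \<or> slope (region_word wB wa p') = - slope (region_word wA wB p)"
      by (rule *) (use s eq in \<open>simp_all add: geo_minus_def geo_plus_def nd_words\<close>)
    then show False using mn slopes by auto
  qed
  then show "range geo_plus \<inter> range geo_minus = {}" by blast
  show "geod_of G A \<noteq> geod_of G B"
  proof
    assume "geod_of G A = geod_of G B"
    then have "slope wB = slope wA \<or> slope wB = - slope wA" by (intro *) (use s in \<open>simp_all add: wmats\<close>)
    then show False by (simp add: slopes0)
  qed
  have pl: "slope (region_word wA wB p) \<noteq> slope w \<and> slope (region_word wA wB p) \<noteq> - slope w" if "w \<in> {wA, wB}" for p w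
  proof -
    obtain m n where "stern_brocot p = (m, n)" "m > 0" "n > 0" using positive[of p] by blast
    then show ?thesis using that slopes slopes0 by auto
  qed
  have mi: "slope (region_word wB wa p) \<noteq> slope w \<and> slope (region_word wB wa p) \<noteq> - slope w" if "w \<in> {wA, wB}" for p w
  proof -
    obtain m n where "stern_brocot p = (m, n)" "m > 0" "n > 0" using positive[of p] by blast
    then show ?thesis using that slopes slopes0 by auto
  qed
  show "geod_of G A \<notin> range geo_plus" "geod_of G B \<notin> range geo_plus"
    using *[OF s(1) s(3)] *[OF s(2) s(3)] pl by (auto simp: geo_plus_def nd_words wmats)
  show "geod_of G A \<notin> range geo_minus" "geod_of G B \<notin> range geo_minus"
    using *[OF s(1) s(4)] *[OF s(2) s(4)] mi by (auto simp: geo_minus_def nd_words wmats)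
qed

lemma heights:
  "height A B (geod_of G A) = 1" "height A B (geod_of G B) = 1" "height A B (geo_plus []) = 1"
  "stern_brocot p = (m, n) \<Longrightarrow> height A B (geo_plus (b # p)) = m + n"
  "stern_brocot p = (m, n) \<Longrightarrow> height A B (geo_minus p) = m + n"
proof -
  note s = word_simples
  show "height A B (geod_of G A) = 1" "height A B (geod_of G B) = 1"
    using height_eq[OF s(1)] height_eq[OF s(2)] by (simp_all add: wmats slopes0 slope_height_def)
  show "height A B (geo_plus []) = 1"
    using height_eq[OF s(3)[of "[]"]] slopes(1)[of "[]"] 
    by (simp add: geo_plus_def slope_height_def word_mat_append wmats)
  show "height A B (geo_plus (b # p)) = m + n" if "stern_brocot p = (m, n)"
  proof -
    have "stern_brocot (b # p) = (if b then (m + n, n) else (m, m + n))" using that by simp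
    then have "int (height A B (geo_plus (b # p))) = int (m + n)"
      using height_eq[OF s(3)[of "b # p"]] slopes(1)[of "b # p"] stern_brocot_pos[OF that]
      unfolding geo_plus_def nd_words by (cases b) (auto simp: slope_height_def)
    then show ?thesis by linarith
  qed
  show "height A B (geo_minus p) = m + n" if "stern_brocot p = (m, n)"
  proof -
    have "int (height A B (geo_minus p)) = int (m + n)"
      using height_eq[OF s(4)[of p]] slopes(2)[OF that] stern_brocot_pos[OF that]
      unfolding geo_minus_def nd_words by (auto simp: slope_height_def)
    then show ?thesis by linarith
  qed
qed

end

section \<open>Summation over a sector of the tree\<close>

text \<open>If \<open>x\<close> is the trace of a geodesic of length \<open>l\<close>, this is \<open>exp (l / 2)\<close>, the larger eigenvalue.\<close>

definition mu :: "real \<Rightarrow> real" where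
  "mu x = (x + sqrt (x\<^sup>2 - 4)) / 2"

definition log_factor :: "real \<Rightarrow> real" where
  "log_factor x = ln (x\<^sup>2 / (x\<^sup>2 - 4))"

text \<open>The traces \<open>x\<close>, \<open>y\<close> of the two regions beside a directed edge of the tree and \<open>z\<close> of the region at its target.\<close>

definition edge :: "real \<Rightarrow> real \<Rightarrow> real \<Rightarrow> bool" where
  "edge x y z \<longleftrightarrow> x > 2 \<and> y > 2 \<and> z > 2 \<and> x\<^sup>2 + y\<^sup>2 + z\<^sup>2 = x * y * z"

text \<open>The traces around a region of trace \<open>x\<close> have the form \<open>\<alpha> \<mu>\<^sup>n + \<beta> \<mu>\<^sup>-\<^sup>n\<close>. This is \<open>\<alpha>\<close>, when the traces
  for \<open>n = 0\<close> and \<open>n = 1\<close> are \<open>y\<close> and \<open>z\<close>.\<close>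

definition growth_coeff :: "real \<Rightarrow> real \<Rightarrow> real \<Rightarrow> real" where
  "growth_coeff x y z = (z - y / mu x) / (mu x - 1 / mu x)"

text \<open>The coefficient, in the sum over the sector beyond an edge, of the height of the region of trace \<open>x\<close> beside the edge.\<close>

definition sector_coeff :: "real \<Rightarrow> real \<Rightarrow> real \<Rightarrow> real" where
  "sector_coeff x y z = ln (mu y / growth_coeff x y z)"

lemma edge_moves:
  assumes "edge x y z"
  shows "edge x z (x * z - y)" "edge z y (z * y - x)" "edge y x z" "edge x y (x * y - z)"
  using assms markov_move[of x y z] markov_move[of x z y] markov_move[of z y x]
  unfolding edge_def by (auto simp: mult_ac add_ac)

lemma mu_facts:
  assumes "x > 2"
  shows "mu x > 1" "mu x + 1 / mu x = x" "mu x - 1 / mu x > 0" "(mu x - 1 / mu x)\<^sup>2 = x\<^sup>2 - 4"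
proof -
  have p: "x\<^sup>2 - 4 > 0" using assms power_strict_mono[of 2 x 2] by simp
  show 1: "mu x > 1" 
  proof -
    have "1 < (x + s) / 2" if "s > 0" for s using assms that by simp
    from this[OF real_sqrt_gt_zero[OF p]] show ?thesis unfolding mu_def .
  qed
  have "sqrt (x\<^sup>2 - 4) * sqrt (x\<^sup>2 - 4) = x\<^sup>2 - 4" using p by simp
  then have "mu x * (x - mu x) = 1" by (simp add: mu_def field_simps power2_eq_square)
  then show 2: "mu x + 1 / mu x = x" using 1 by (simp add: field_simps)
  have "1 / mu x < 1" using 1 by simp
  then show "mu x - 1 / mu x > 0" using 1 by linarith
  have "(mu x - 1 / mu x)\<^sup>2 = (mu x + 1 / mu x)\<^sup>2 - 4" using 1 by (simp add: power2_eq_square field_simps)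
  then show "(mu x - 1 / mu x)\<^sup>2 = x\<^sup>2 - 4" unfolding 2 .
qed

lemma growth_coeff_shift:
  assumes "x > 2" shows "growth_coeff x z (x * z - y) = mu x * growth_coeff x y z"
proof -
  note m = mu_facts[OF assms]
  have "x * z - y - z / mu x = mu x * z - y"
    by (subst (1) m(2)[symmetric]) (simp add: field_simps)
  also have "\<dots> = mu x * (z - y / mu x)" using m(1) by (simp add: field_simps)
  finally show ?thesis by (simp add: growth_coeff_def)
qed

text \<open>The numbers \<open>d\<close> and \<open>s\<close> have the same sum as the roots \<open>z\<close> and \<open>x * y - z\<close> of the trace equation, and a product that is smaller by \<open>4\<close>.
  So both roots lie between \<open>d\<close> and \<open>s\<close>.\<close>

lemma edge_bounds:
  assumes "edge x y z"
  defines "d \<equiv> mu x / mu y + mu y / mu x" and "s \<equiv> mu x * mu y + 1 / (mu x * mu y)"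
  shows "d > 0" "s + d = x * y" "s - d = (mu x - 1 / mu x) * (mu y - 1 / mu y)"
    "z - d > 0" "s - z > 0" "(s - z) * (z - d) = 4" "z - y / mu x > z - d" "growth_coeff x y z > 0"
    "mu y / growth_coeff x y z = 1 + (s - z) / (z - y / mu x)"
proof -
  have e: "x > 2" "y > 2" "z > 2" "x\<^sup>2 + y\<^sup>2 + z\<^sup>2 = x * y * z" using assms by (auto simp: edge_def)
  define X Y where "X = mu x" and "Y = mu y"
  note m = mu_facts[OF e(1), folded X_def] mu_facts[OF e(2), folded Y_def]
  have X: "X > 0" "X \<noteq> 0" and Y: "Y > 0" "Y \<noteq> 0" using m by auto
  have d: "d = X / Y + Y / X" and s: "s = X * Y + 1 / (X * Y)" by (simp_all add: d_def s_def X_def Y_def)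
  show "d > 0" using X Y by (simp add: d add_pos_pos)
  show sd: "s + d = x * y"
    unfolding m(2)[symmetric] m(6)[symmetric] s d using X Y by (simp add: field_simps)
  show smd: "s - d = (mu x - 1 / mu x) * (mu y - 1 / mu y)"
    unfolding X_def[symmetric] Y_def[symmetric] s d using X Y by (simp add: field_simps)
  have "s * d = x\<^sup>2 + y\<^sup>2 - 4"
    unfolding m(2)[symmetric] m(6)[symmetric] s d using X Y by (simp add: field_simps power2_eq_square)
  then show p: "(s - z) * (z - d) = 4"
    using e(4) arg_cong[OF sd, of "\<lambda>t. z * t"] by (simp add: algebra_simps power2_eq_square)
  have "s - d > 0" unfolding smd using m X_def Y_def by simp
  show "z - d > 0" "s - z > 0"
    using p \<open>s - d > 0\<close> zero_less_mult_iff[of "s - z" "z - d"] by auto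
  have "d - y / X = (X - 1 / X) / Y"
    unfolding m(6)[symmetric] d using X Y by (simp add: field_simps)
  moreover have "(X - 1 / X) / Y > 0" using m(3) Y by simp
  ultimately show zy: "z - y / mu x > z - d" unfolding X_def by linarith
  then have zy0: "z - y / X > 0" using \<open>z - d > 0\<close> by (simp add: X_def)
  then show "growth_coeff x y z > 0" using m(3) by (simp add: growth_coeff_def X_def)
  have "Y * (X - 1 / X) = (z - y / X) + (s - z)"
    unfolding m(6)[symmetric] s using X Y by (simp add: field_simps)
  moreover have "Y / ((z - y / X) / (X - 1 / X)) = (Y * (X - 1 / X)) / (z - y / X)" by simp
  ultimately have "Y / ((z - y / X) / (X - 1 / X)) = ((z - y / X) + (s - z)) / (z - y / X)" by simp
  also have "\<dots> = 1 + (s - z) / (z - y / X)"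
    unfolding add_divide_distrib using zy0 by (simp only: divide_self_if less_irrefl) simp
  finally show "mu y / growth_coeff x y z = 1 + (s - z) / (z - y / mu x)" by (simp add: growth_coeff_def X_def Y_def)
qed

lemma sector_coeff_eq:
  assumes "edge x y z" shows "sector_coeff x y z = ln (mu y) - ln (growth_coeff x y z)"
  using edge_bounds(8)[OF assms] mu_facts(1)[of y] assms by (simp add: sector_coeff_def edge_def ln_div)

lemma sector_coeff_shift:
  assumes "edge x y z"
  shows "sector_coeff x y z = sector_coeff x z (x * z - y) + ln (mu x) + ln (mu y) - ln (mu z)"
proof -
  have x: "x > 2" using assms by (simp add: edge_def)
  then show ?thesis
    using edge_bounds(8)[OF assms] mu_facts(1)[OF x]
    by (simp add: sector_coeff_eq[OF assms] sector_coeff_eq[OF edge_moves(1)[OF assms]] growth_coeff_shift ln_mult)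
qed

text \<open>The growth coefficients in the two directions around the region of trace \<open>z\<close> multiply to \<open>z\<^sup>2 / (z\<^sup>2 - 4)\<close> when both are taken
  with the same numbering of the neighbours. The numberings used here differ by one step, which contributes a factor \<open>mu z\<close>.\<close>

lemma vertex_relation:
  assumes "edge x y z"
  shows "log_factor z + sector_coeff z x (z * x - y) + sector_coeff z y (z * y - x) = ln (mu x) + ln (mu y) - ln (mu z)"
proof -
  have e: "x > 2" "y > 2" "z > 2" "x\<^sup>2 + y\<^sup>2 + z\<^sup>2 = x * y * z" using assms by (auto simp: edge_def)
  have ed: "edge z x (z * x - y)" "edge z y (z * y - x)"
    using edge_moves[OF assms] edge_moves(1,2,3) by (metis mult.commute)+
  note m = mu_facts[OF e(3)]
  define Z where "Z = mu z"
  have Z: "Z > 0" "Z \<noteq> 0" "Z - 1 / Z > 0" using m by (auto simp: Z_def)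
  have num: "growth_coeff z v (z * v - u) * (Z - 1/Z) = Z * v - u" for u v
  proof -
    have "z * v = Z * v + v / Z"
      using arg_cong[OF m(2)[folded Z_def], of "\<lambda>t. t * v"] by (simp add: distrib_right)
    then have "z * v - u - v / Z = Z * v - u" by simp
    then show ?thesis unfolding growth_coeff_def Z_def[symmetric] using Z(3) by simp
  qed
  have ZZ: "Z * z = Z * Z + 1"
    using arg_cong[OF m(2)[folded Z_def], of "\<lambda>t. Z * t"] Z(2) by (simp add: distrib_left)
  let ?p = "growth_coeff z y (z * y - x)" and ?q = "growth_coeff z x (z * x - y)"
  have "(Z * y - x) * (Z * x - y) = Z * z\<^sup>2" using e(4) ZZ by algebra
  moreover have "(?p * ?q) * (Z - 1/Z)\<^sup>2 = (?p * (Z - 1/Z)) * (?q * (Z - 1/Z))"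
    by (simp only: power2_eq_square mult_ac)
  ultimately have pq: "(?p * ?q) * (z\<^sup>2 - 4) = Z * z\<^sup>2"
    unfolding num m(4)[folded Z_def] by simp
  have "z\<^sup>2 - 4 \<noteq> 0" using e(3) power_strict_mono[of 2 z 2] by simp
  then have "?p * ?q = Z * (z\<^sup>2 / (z\<^sup>2 - 4))"
    using pq by (simp add: nonzero_eq_divide_eq)
  moreover have p: "growth_coeff z y (z * y - x) > 0" "growth_coeff z x (z * x - y) > 0" using edge_bounds(8) ed by blast+
  moreover have "z\<^sup>2 / (z\<^sup>2 - 4) > 0" using e(3) power_strict_mono[of 2 z 2] by simp
  ultimately have "ln (growth_coeff z y (z * y - x)) + ln (growth_coeff z x (z * x - y)) = ln Z + log_factor z"
    unfolding log_factor_def ln_mult_pos[OF Z(1) \<open>z\<^sup>2 / (z\<^sup>2 - 4) > 0\<close>, symmetric] ln_mult_pos[OF p, symmetric]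
    by (simp only: \<open>?p * ?q = Z * (z\<^sup>2 / (z\<^sup>2 - 4))\<close>)
  then show ?thesis unfolding sector_coeff_eq[OF ed(1)] sector_coeff_eq[OF ed(2)] Z_def by linarith
qed

text \<open>The closed form of the sum over a sector, for heights \<open>h\<close>, \<open>k\<close> of its two boundary regions.\<close>

definition sector_value :: "real \<Rightarrow> real \<Rightarrow> real \<Rightarrow> real \<Rightarrow> real \<Rightarrow> real" where
  "sector_value h k x y z = h * sector_coeff x y z + k * sector_coeff y x z"

lemma sector_value_rec:
  assumes "edge x y z"
  shows "sector_value h k x y z = (h + k) * log_factor z + sector_value h (h + k) x z (x * z - y) + sector_value (h + k) k z y (z * y - x)"
proof -
  have s: "edge y x z" using edge_moves assms by blast
  have "sector_coeff x y z = log_factor z + sector_coeff x z (x * z - y) + sector_coeff z x (x * z - y) + sector_coeff z y (z * y - x)"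
    using sector_coeff_shift[OF assms] vertex_relation[OF assms] by (simp add: mult.commute)
  moreover have "sector_coeff y x z = log_factor z + sector_coeff y z (z * y - x) + sector_coeff z x (x * z - y) + sector_coeff z y (z * y - x)"
    using sector_coeff_shift[OF s] vertex_relation[OF s] by (simp add: mult.commute)
  ultimately show ?thesis unfolding sector_value_def by algebra
qed

lemma log_factor_ge: "z > 2 \<Longrightarrow> log_factor z \<ge> 4 / z\<^sup>2"
proof -
  assume z: "z > 2"
  have z4: "z\<^sup>2 > 4" using z power_strict_mono[of 2 z 2] by simp
  then have "log_factor z = - ln (1 + (- 4 / z\<^sup>2))"
  proof -
    have "z\<^sup>2 \<noteq> 0" "z\<^sup>2 - 4 \<noteq> 0" using z4 by linarith+
    then have "1 + (- 4 / z\<^sup>2) = 1 / (z\<^sup>2 / (z\<^sup>2 - 4))" by (simp add: diff_divide_distrib)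
    then show ?thesis using z4 by (simp add: log_factor_def ln_div)
  qed
  moreover have "ln (1 + (- 4 / z\<^sup>2)) \<le> - 4 / z\<^sup>2"
    by (rule ln_add_one_self_le_self2) (use z z4 in \<open>simp add: pos_divide_less_eq[of "z\<^sup>2"]\<close>)
  ultimately show ?thesis by simp
qed

lemma log_factor_pos: "z > 2 \<Longrightarrow> log_factor z > 0"
  using log_factor_ge[of z] by (smt (verit) divide_pos_pos zero_less_power)

lemma sector_coeff_pos: "edge x y z \<Longrightarrow> sector_coeff x y z > 0"
proof -
  assume e: "edge x y z"
  note b = edge_bounds[OF e]
  have "(mu x * mu y + 1 / (mu x * mu y) - z) / (z - y / mu x) > 0"
    using b(4,5,7) by (intro divide_pos_pos) linarith+
  then show ?thesis unfolding sector_coeff_def b(9) by simp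
qed

text \<open>Under the assumption on \<open>z\<close> this root is nearer to \<open>s\<close> than to \<open>d\<close>, so \<open>z - d\<close> is comparable with \<open>z\<close>, and the coefficient has the
  same order of magnitude as the first summand.\<close>

lemma sector_coeff_le:
  assumes e: "edge x y z" and up: "2 * z \<ge> x * y" and q: "0 < q" "x\<^sup>2 - 4 \<ge> q * x\<^sup>2" "y\<^sup>2 - 4 \<ge> q * y\<^sup>2"
  shows "sector_coeff x y z \<le> 4 / q\<^sup>2 * log_factor z"
proof -
  note b = edge_bounds[OF e]
  define d s where "d = mu x / mu y + mu y / mu x" and "s = mu x * mu y + 1 / (mu x * mu y)"
  note b = b[folded d_def s_def]
  have z: "x > 2" "y > 2" "z > 2" using e by (auto simp: edge_def)
  have zd: "z - d \<ge> (s - d) / 2" using up b(2) by (simp add: field_simps)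
  have "z * z \<le> (x * y) * (x * y)"
    using b(1,2,5) z by (intro mult_mono) auto
  then have "q\<^sup>2 * z\<^sup>2 \<le> q\<^sup>2 * (x * y)\<^sup>2" using q(1) by (simp add: power2_eq_square)
  also have "\<dots> = (q * x\<^sup>2) * (q * y\<^sup>2)" by (simp add: power2_eq_square mult_ac)
  also have "\<dots> \<le> (x\<^sup>2 - 4) * (y\<^sup>2 - 4)" 
  proof (rule mult_mono[OF q(2,3)])
    show "0 \<le> x\<^sup>2 - 4" using power_strict_mono[of 2 x 2] z by simp
    show "0 \<le> q * y\<^sup>2" using q by simp
  qed
  also have "\<dots> = (s - d)\<^sup>2"
    unfolding b(3) power_mult_distrib mu_facts(4)[OF z(1)] mu_facts(4)[OF z(2)] ..
  also have "\<dots> \<le> (2 * (z - d))\<^sup>2"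
  proof (rule power_mono)
    show "s - d \<le> 2 * (z - d)" using zd by simp
    show "0 \<le> s - d" using b(4,5) by linarith
  qed
  also have "(2 * (z - d))\<^sup>2 = 4 * (z - d)\<^sup>2" unfolding power_mult_distrib by simp
  finally have le: "q\<^sup>2 * z\<^sup>2 \<le> 4 * (z - d)\<^sup>2" .
  have qz: "q\<^sup>2 * z\<^sup>2 > 0" using q z by simp
  have sz: "s - z = 4 / (z - d)" using b(4,6) by (simp add: field_simps)
  have "(s - z) / (z - y / mu x) \<le> (s - z) / (z - d)"
    using b(4,5,7) by (intro divide_left_mono) (auto intro!: mult_pos_pos)
  also have "\<dots> = 4 / (z - d)\<^sup>2" unfolding sz by (simp add: power2_eq_square)
  also have "\<dots> \<le> 4 / (q\<^sup>2 * z\<^sup>2 / 4)"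
    using le qz b(4) by (intro divide_left_mono) auto
  also have "\<dots> = 4 / q\<^sup>2 * (4 / z\<^sup>2)" by simp
  also have "\<dots> \<le> 4 / q\<^sup>2 * log_factor z" using log_factor_ge[OF z(3)] q by (intro mult_left_mono) auto
  finally have "(s - z) / (z - y / mu x) \<le> 4 / q\<^sup>2 * log_factor z" .
  moreover have "sector_coeff x y z \<le> (s - z) / (z - y / mu x)"
    unfolding sector_coeff_def b(9) using b(4,5,7) by (intro ln_add_one_self_le_self divide_nonneg_nonneg) auto
  ultimately show ?thesis by linarith
qed

definition region_height :: "real \<Rightarrow> real \<Rightarrow> bool list \<Rightarrow> real" where
  "region_height h k p = h * real (fst (stern_brocot p)) + k * real (snd (stern_brocot p))"

lemma region_height_simps [simp]:
  "region_height h k [] = h + k" "region_height h k (True # p) = region_height h (h + k) p" "region_height h k (False # p) = region_height (h + k) k p"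
  by (simp_all add: region_height_def split: prod.split) (simp_all add: algebra_simps)

lemma region_height_nonneg: "h > 0 \<Longrightarrow> k > 0 \<Longrightarrow> region_height h k p \<ge> 0"
  by (simp add: region_height_def)

definition region_term :: "real \<Rightarrow> real \<Rightarrow> real \<Rightarrow> real \<Rightarrow> real \<Rightarrow> bool list \<Rightarrow> real" where
  "region_term h k x y z p = region_height h k p * log_factor (region_trace x y z p)"

lemma region_term_simps [simp]:
  "region_term h k x y z [] = (h + k) * log_factor z"
  "region_term h k x y z (True # p) = region_term h (h + k) x z (x * z - y) p"
  "region_term h k x y z (False # p) = region_term (h + k) k z y (z * y - x) p"
  by (simp_all add: region_term_def)

lemma region_trace_edge: "edge x y z \<Longrightarrow> region_trace x y z p > 2"
proof (induction p arbitrary: x y z)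
  case Nil
  then show ?case by (simp add: edge_def)
next
  case (Cons b p)
  show ?case using Cons.IH[OF edge_moves(1)[OF Cons.prems]] Cons.IH[OF edge_moves(2)[OF Cons.prems]] by simp
qed

lemma region_term_nonneg: "edge x y z \<Longrightarrow> h > 0 \<Longrightarrow> k > 0 \<Longrightarrow> region_term h k x y z p \<ge> 0"
  unfolding region_term_def using region_trace_edge[of x y z p] log_factor_pos region_height_nonneg by (intro mult_nonneg_nonneg) (auto intro: less_imp_le)

text \<open>The part of the closed form that belongs to the regions at depth \<open>n\<close> and beyond.\<close>

fun remainder :: "nat \<Rightarrow> real \<Rightarrow> real \<Rightarrow> real \<Rightarrow> real \<Rightarrow> real \<Rightarrow> real" where
  "remainder 0 h k x y z = sector_value h k x y z"
| "remainder (Suc n) h k x y z = remainder n h (h + k) x z (x * z - y) + remainder n (h + k) k z y (z * y - x)"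

lemma remainder_nonneg: "\<lbrakk>edge x y z; h > 0; k > 0\<rbrakk> \<Longrightarrow> remainder n h k x y z \<ge> 0"
proof (induction n arbitrary: h k x y z)
  case 0
  then show ?case using sector_coeff_pos edge_moves(3) by (simp add: sector_value_def less_imp_le)
next
  case (Suc n)
  then show ?case using edge_moves by (simp add: add_pos_pos)
qed

definition below_depth :: "nat \<Rightarrow> bool list set" where
  "below_depth n = {p. length p < n}"

definition at_depth :: "nat \<Rightarrow> bool list set" where
  "at_depth n = {p. length p = n}"

lemma at_depth_Suc: "at_depth (Suc n) = Cons True ` at_depth n \<union> Cons False ` at_depth n"
proof -
  have "p \<in> Cons True ` at_depth n \<union> Cons False ` at_depth n" if "p \<in> at_depth (Suc n)" for p
    using that by (cases p; cases "hd p") (auto simp: at_depth_def)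
  then show ?thesis by (auto simp: at_depth_def)
qed

lemma below_depth_Suc: "below_depth (Suc n) = insert [] (Cons True ` below_depth n \<union> Cons False ` below_depth n)"
proof -
  have "p \<in> insert [] (Cons True ` below_depth n \<union> Cons False ` below_depth n)" if "p \<in> below_depth (Suc n)" for p
    using that by (cases p; cases "hd p") (auto simp: below_depth_def)
  then show ?thesis by (auto simp: below_depth_def)
qed

lemma below_depth_at_depth: "below_depth (Suc n) = below_depth n \<union> at_depth n" "below_depth n \<inter> at_depth n = {}"
  by (auto simp: below_depth_def at_depth_def)

lemma finite_at_depth: "finite (at_depth n)" and finite_below_depth: "finite (below_depth n)"
proof -
  show "finite (at_depth n)" by (induction n) (simp_all add: at_depth_Suc, simp add: at_depth_def)
  show "finite (below_depth n)" by (induction n) (simp_all add: below_depth_Suc, simp add: below_depth_def)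
qed

lemma sum_split_Cons:
  assumes "finite L"
  shows "sum f (Cons True ` L \<union> Cons False ` L) = (\<Sum>p\<in>L. f (True # p)) + (\<Sum>p\<in>L. f (False # p))"
proof -
  have "sum f (Cons True ` L \<union> Cons False ` L) = sum f (Cons True ` L) + sum f (Cons False ` L)"
    using assms by (intro sum.union_disjoint) auto
  then show ?thesis by (simp add: sum.reindex)
qed

lemma sector_value_partial: "edge x y z \<Longrightarrow> sector_value h k x y z = sum (region_term h k x y z) (below_depth n) + remainder n h k x y z"
proof (induction n arbitrary: h k x y z)
  case 0
  then show ?case by (simp add: below_depth_def)
next
  case (Suc n)
  have "sum (region_term h k x y z) (below_depth (Suc n)) = (h + k) * log_factor z + sum (region_term h k x y z) (Cons True ` below_depth n \<union> Cons False ` below_depth n)"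
    unfolding below_depth_Suc using finite_below_depth by (subst sum.insert) auto
  then show ?case
    using sector_value_rec[OF Suc.prems, of h k] Suc.IH[OF edge_moves(1)[OF Suc.prems], of h "h + k"]
      Suc.IH[OF edge_moves(2)[OF Suc.prems], of "h + k" k]
    by (simp add: sum_split_Cons finite_below_depth)
qed

text \<open>An edge along which traces do not decrease; this property is inherited by all edges beyond.\<close>

definition uphill :: "real \<Rightarrow> real \<Rightarrow> real \<Rightarrow> real \<Rightarrow> bool" where
  "uphill m x y z \<longleftrightarrow> edge x y z \<and> 2 * z \<ge> x * y \<and> x \<ge> m \<and> y \<ge> m \<and> z \<ge> m"

lemma uphill_moves:
  assumes "uphill m x y z"
  shows "uphill m x z (x * z - y)" "uphill m z y (z * y - x)"
proof -
  have e: "edge x y z" "2 * z \<ge> x * y" "x \<ge> m" "y \<ge> m" "z \<ge> m" and g: "x > 2" "y > 2" "z > 2"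
    using assms by (auto simp: uphill_def edge_def)
  have *: "x * z \<ge> 2 * y \<and> x * z - y \<ge> z" if "x > 2" "y > 2" "z > 2" "2 * z \<ge> x * y" for x y z :: real
  proof -
    have "x * y > 2 * y" using that by simp
    then have zy: "z > y" using that by linarith
    moreover have "x * z > 2 * z" using that by simp
    ultimately show ?thesis by linarith
  qed
  show "uphill m x z (x * z - y)"
    using *[OF g e(2)] e edge_moves(1)[OF e(1)] by (simp add: uphill_def)
  show "uphill m z y (z * y - x)"
    using *[OF g(2,1,3)] e edge_moves(2)[OF e(1)] by (simp add: uphill_def mult.commute)
qed

lemma remainder_le:
  assumes "m > 2" "uphill m x y z" "h > 0" "k > 0"
  defines "q \<equiv> 1 - 4 / m\<^sup>2"
  shows "remainder n h k x y z \<le> 4 / q\<^sup>2 * sum (region_term h k x y z) (at_depth n)"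
  using assms(2-4)
proof (induction n arbitrary: h k x y z)
  case 0
  have m4: "m\<^sup>2 > 4" using assms(1) power_strict_mono[of 2 m 2] by simp
  have m0: "m\<^sup>2 > 0" using m4 by linarith
  have q: "q > 0" using m4 m0 by (simp add: q_def pos_divide_less_eq)
  have ge: "t\<^sup>2 - 4 \<ge> q * t\<^sup>2" if "t \<ge> m" for t
  proof -
    have "t\<^sup>2 \<ge> m\<^sup>2" using that assms(1) by (intro power_mono) auto
    then have "4 * t\<^sup>2 / m\<^sup>2 \<ge> 4" using m0 by (simp add: pos_le_divide_eq)
    then show ?thesis by (simp add: q_def algebra_simps)
  qed
  have e: "edge x y z" "edge y x z" "2 * z \<ge> x * y" "2 * z \<ge> y * x" "x \<ge> m" "y \<ge> m"
    using 0 edge_moves(3) by (auto simp: uphill_def mult.commute)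
  have "sector_coeff x y z \<le> 4 / q\<^sup>2 * log_factor z" "sector_coeff y x z \<le> 4 / q\<^sup>2 * log_factor z"
    using sector_coeff_le[OF e(1,3) q] sector_coeff_le[OF e(2,4) q] ge e by auto
  then have "h * sector_coeff x y z + k * sector_coeff y x z \<le> h * (4 / q\<^sup>2 * log_factor z) + k * (4 / q\<^sup>2 * log_factor z)"
    using 0 by (intro add_mono mult_left_mono) auto
  also have "\<dots> = 4 / q\<^sup>2 * ((h + k) * log_factor z)" by (simp only: distrib_left distrib_right mult_ac)
  finally have "sector_value h k x y z \<le> 4 / q\<^sup>2 * ((h + k) * log_factor z)" by (simp only: sector_value_def)
  moreover have "at_depth 0 = {[]}" by (auto simp: at_depth_def)
  ultimately show ?case by simp
next
  case (Suc n)
  have "remainder n h (h + k) x z (x * z - y) \<le> 4 / q\<^sup>2 * sum (region_term h (h + k) x z (x * z - y)) (at_depth n)"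
    "remainder n (h + k) k z y (z * y - x) \<le> 4 / q\<^sup>2 * sum (region_term (h + k) k z y (z * y - x)) (at_depth n)"
    using Suc uphill_moves by (auto simp: add_pos_pos)
  then show ?case by (simp add: at_depth_Suc sum_split_Cons finite_at_depth distrib_left)
qed

text \<open>The partial sums are bounded by the closed form, so the layers of the sum tend to zero. By the previous estimate the
  remainder tends to zero as well.\<close>

lemma uphill_sum:
  assumes "m > 2" "uphill m x y z" "h > 0" "k > 0"
  shows "(region_term h k x y z has_sum sector_value h k x y z) UNIV"
proof -
  have e: "edge x y z" using assms(2) by (simp add: uphill_def)
  let ?t = "region_term h k x y z" and ?R = "sector_value h k x y z"
  define S where "S n = sum ?t (below_depth n)" for n
  define C where "C = 4 / (1 - 4 / m\<^sup>2)\<^sup>2"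
  note nn = region_term_nonneg[OF e assms(3,4)]
  have S_Suc: "S (Suc n) = S n + sum ?t (at_depth n)" for n
    unfolding S_def below_depth_at_depth(1) using finite_below_depth finite_at_depth below_depth_at_depth(2) by (intro sum.union_disjoint) auto
  have R: "?R = S n + remainder n h k x y z" for n unfolding S_def by (rule sector_value_partial[OF e])
  have le: "S n \<le> ?R" for n using R[of n] remainder_nonneg[OF e assms(3,4), of n] by linarith
  have "incseq S" unfolding incseq_Suc_iff S_Suc using nn by (simp add: sum_nonneg)
  then obtain L where L: "S \<longlonglongrightarrow> L" using incseq_convergent[of S ?R] le by blast
  have "(\<lambda>n. C * (S (Suc n) - S n)) \<longlonglongrightarrow> C * (L - L)"
    by (intro tendsto_intros L LIMSEQ_Suc)
  then have z: "(\<lambda>n. C * (S (Suc n) - S n)) \<longlonglongrightarrow> 0" by simp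
  have "(\<lambda>n. remainder n h k x y z) \<longlonglongrightarrow> 0"
  proof (rule tendsto_sandwich[OF _ _ tendsto_const z])
    show "\<forall>\<^sub>F n in sequentially. 0 \<le> remainder n h k x y z" using remainder_nonneg[OF e assms(3,4)] by simp
    show "\<forall>\<^sub>F n in sequentially. remainder n h k x y z \<le> C * (S (Suc n) - S n)"
      using remainder_le[OF assms] by (simp add: S_Suc C_def)
  qed
  then have "(\<lambda>n. ?R - remainder n h k x y z) \<longlonglongrightarrow> ?R - 0" by (intro tendsto_intros)
  moreover have "(\<lambda>n. ?R - remainder n h k x y z) = S"
  proof
    show "?R - remainder n h k x y z = S n" for n using R[of n] by linarith
  qed
  ultimately have SR: "S \<longlonglongrightarrow> ?R" by simp
  have sub: "\<exists>n. F \<subseteq> below_depth n" if "finite F" for F :: "bool list set"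
  proof -
    have "F \<subseteq> below_depth (Suc (Max (length ` F)))" using that by (auto simp: below_depth_def less_Suc_eq_le)
    then show ?thesis by blast
  qed
  have "?t summable_on UNIV"
  proof (rule nonneg_bdd_above_summable_on)
    show "bdd_above (sum ?t ` {F. F \<subseteq> UNIV \<and> finite F})"
    proof (rule bdd_aboveI2)
      fix F assume "F \<in> {F. F \<subseteq> (UNIV :: bool list set) \<and> finite F}"
      then obtain n where "F \<subseteq> below_depth n" using sub by blast
      then have "sum ?t F \<le> S n" unfolding S_def using nn finite_below_depth by (intro sum_mono2) auto
      then show "sum ?t F \<le> ?R" using le[of n] by linarith
    qed
  qed (rule nn)
  then have hs: "(?t has_sum infsum ?t UNIV) UNIV" by simp
  have "filterlim below_depth (finite_subsets_at_top UNIV) sequentially"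
    unfolding filterlim_finite_subsets_at_top
  proof (intro allI impI)
    fix F :: "bool list set" assume "finite F \<and> F \<subseteq> UNIV"
    then obtain n where "F \<subseteq> below_depth n" using sub by blast
    then have "F \<subseteq> below_depth k" if "k \<ge> n" for k using that by (auto simp: below_depth_def)
    then show "\<forall>\<^sub>F n in sequentially. finite (below_depth n) \<and> F \<subseteq> below_depth n \<and> below_depth n \<subseteq> UNIV"
      using finite_below_depth by (auto simp: eventually_sequentially)
  qed
  from filterlim_compose[OF hs[unfolded has_sum_def] this]
  have "S \<longlonglongrightarrow> infsum ?t UNIV" by (simp add: S_def[abs_def])
  then have "infsum ?t UNIV = ?R" using SR LIMSEQ_unique by blast
  then show ?thesis using hs by simp
qed

lemma has_sum_Cons:
  fixes f :: "bool list \<Rightarrow> real"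
  assumes "((\<lambda>p. f (True # p)) has_sum a) UNIV" "((\<lambda>p. f (False # p)) has_sum b) UNIV"
  shows "(f has_sum (f [] + a + b)) UNIV"
proof -
  have "(f has_sum a) (range (Cons True))" "(f has_sum b) (range (Cons False))"
    using assms by (simp_all add: has_sum_reindex o_def)
  then have 1: "(f has_sum (a + b)) (range (Cons True) \<union> range (Cons False))"
    by (rule has_sum_Un_disjoint) auto
  have 0: "(f has_sum f []) {[]}" by (rule has_sum_finiteI) auto
  have "(f has_sum (f [] + (a + b))) ({[]} \<union> (range (Cons True) \<union> range (Cons False)))"
    by (rule has_sum_Un_disjoint[OF 0 1]) auto
  moreover have "{[]} \<union> (range (Cons True) \<union> range (Cons False)) = UNIV"
  proof -
    have "p \<in> {[]} \<union> (range (Cons True) \<union> range (Cons False))" for p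
      by (cases p; cases "hd p") auto
    then show ?thesis by blast
  qed
  ultimately show ?thesis by (simp add: add.assoc)
qed

text \<open>Traces may first decrease. The source \<open>x y - z\<close> of the edge then drops by a definite amount
  at each step, since all traces stay bounded and hence bounded away from \<open>2\<close>.\<close>

lemma sector_sum_bounded:
  assumes "edge x y z" "h > 0" "k > 0" "x \<le> B" "y \<le> B" "x * y - z \<le> B" "x * y - z \<le> real n * (8 / B\<^sup>2)"
  shows "(region_term h k x y z has_sum sector_value h k x y z) UNIV"
  using assms
proof (induction n arbitrary: x y z h k)
  case 0
  then show ?case using edge_moves(4)[OF 0(1)] by (simp add: edge_def)
next
  case (Suc n)
  have g: "x > 2" "y > 2" "z > 2" and mk: "x\<^sup>2 + y\<^sup>2 + z\<^sup>2 = x * y * z" using Suc.prems by (auto simp: edge_def)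
  have B: "B > 2" using g Suc.prems by linarith
  show ?case
  proof (cases "2 * z \<ge> x * y")
    case True
    then have "uphill (min x (min y z)) x y z" using Suc.prems by (simp add: uphill_def min_le_iff_disj)
    moreover have "min x (min y z) > 2" using g by simp
    ultimately show ?thesis using uphill_sum Suc.prems by blast
  next
    case False
    then have zB: "z \<le> B" using Suc.prems by linarith
    have gap: "u \<ge> 2 + 4 / B\<^sup>2" if "u\<^sup>2 + v\<^sup>2 + w\<^sup>2 = u * v * w" "u > 2" "v > 2" "w > 2" "v \<le> B" "w \<le> B" for u v w
    proof -
      have "u * v * w \<ge> u\<^sup>2 + 2 * (v * w)"
        using that(1) sum_squares_bound[of v w] by (simp add: power2_eq_square)
      moreover have "u\<^sup>2 \<ge> 4" using that(2) power_mono[of 2 u 2] by simp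
      ultimately have "(u - 2) * (v * w) \<ge> 4" by (simp add: algebra_simps)
      moreover have "v * w \<le> B\<^sup>2" unfolding power2_eq_square using that by (intro mult_mono) auto
      then have "(u - 2) * (v * w) \<le> (u - 2) * B\<^sup>2" using that(2) by (intro mult_left_mono) auto
      ultimately have "(u - 2) * B\<^sup>2 \<ge> 4" by linarith
      then have "u - 2 \<ge> 4 / B\<^sup>2" using B by (simp add: pos_divide_le_eq)
      then show ?thesis by linarith
    qed
    have drop: "y \<le> real n * (8 / B\<^sup>2)"
      if "x \<ge> 2 + 4 / B\<^sup>2" "y > 2" "z < y" "x * y - z \<le> real (Suc n) * (8 / B\<^sup>2)" for x y z
    proof -
      have "4 / B\<^sup>2 \<ge> 0" by simp
      then have "(4 / B\<^sup>2) * 2 \<le> (x - 2) * y" using that(1,2) by (intro mult_mono) linarith+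
      then have "8 / B\<^sup>2 \<le> x * y - z - y" using that(3) by (simp add: algebra_simps)
      then show ?thesis using that(4) by (simp add: algebra_simps add_divide_distrib)
    qed
    have 1: "(region_term h (h + k) x z (x * z - y) has_sum sector_value h (h + k) x z (x * z - y)) UNIV"
    proof (cases "2 * (x * z - y) \<ge> x * z")
      case True
      then have up: "uphill (min x (min z (x * z - y))) x z (x * z - y)"
        using edge_moves(1)[OF Suc.prems(1)] by (simp add: uphill_def min_le_iff_disj)
      have "min x (min z (x * z - y)) > 2" using g edge_moves(1)[OF Suc.prems(1)] by (simp add: edge_def)
      then show ?thesis by (rule uphill_sum[OF _ up]) (use Suc.prems in auto)
    next
      case F: False
      have "x * z > 2 * z" using g by simp
      moreover have "x * z < 2 * y" using F by (simp add: algebra_simps)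
      ultimately have zy: "z < y" by linarith
      have "x \<ge> 2 + 4 / B\<^sup>2" using gap[OF mk g] Suc.prems zB by blast
      then have "y \<le> real n * (8 / B\<^sup>2)" using drop g zy Suc.prems by blast
      then show ?thesis
        using Suc.IH[OF edge_moves(1)[OF Suc.prems(1)], of h "h + k"] Suc.prems zB by (simp add: add_pos_pos)
    qed
    have 2: "(region_term (h + k) k z y (z * y - x) has_sum sector_value (h + k) k z y (z * y - x)) UNIV"
    proof (cases "2 * (z * y - x) \<ge> z * y")
      case True
      then have up: "uphill (min z (min y (z * y - x))) z y (z * y - x)"
        using edge_moves(2)[OF Suc.prems(1)] by (simp add: uphill_def min_le_iff_disj)
      have "min z (min y (z * y - x)) > 2" using g edge_moves(2)[OF Suc.prems(1)] by (simp add: edge_def)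
      then show ?thesis by (rule uphill_sum[OF _ up]) (use Suc.prems in auto)
    next
      case F: False
      have "z * y > z * 2" using g by simp
      moreover have "z * y < 2 * x" using F by (simp add: algebra_simps)
      ultimately have zx: "z < x" by linarith
      have "y\<^sup>2 + x\<^sup>2 + z\<^sup>2 = y * x * z" using mk by (simp add: mult_ac add_ac)
      then have "y \<ge> 2 + 4 / B\<^sup>2" using gap g Suc.prems zB by blast
      then have "x \<le> real n * (8 / B\<^sup>2)" using drop[of y x z] g zx Suc.prems by (simp add: mult.commute)
      then show ?thesis
        using Suc.IH[OF edge_moves(2)[OF Suc.prems(1)], of "h + k" k] Suc.prems zB by (simp add: add_pos_pos)
    qed
    show ?thesis
      using has_sum_Cons[of "region_term h k x y z"] 1 2 unfolding sector_value_rec[OF Suc.prems(1), of h k] by simp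
  qed
qed

lemma sector_sum:
  assumes "edge x y z" "h > 0" "k > 0"
  shows "(region_term h k x y z has_sum sector_value h k x y z) UNIV"
proof -
  define B where "B = max x (max y (x * y - z))"
  have "B > 0" using assms(1) by (simp add: B_def edge_def less_max_iff_disj)
  then have "8 / B\<^sup>2 > 0" by simp
  then obtain n where "x * y - z \<le> real n * (8 / B\<^sup>2)"
    using ex_less_of_nat_mult less_imp_le by blast
  then show ?thesis using sector_sum_bounded[OF assms, of B n] by (simp add: B_def)
qed


section \<open>The product formula\<close>

lemma mu_cosh:
  assumes "l > 0"
  shows "mu (2 * cosh (l/2)) = exp (l/2)"
    and "(2 * cosh (l/2))\<^sup>2 / ((2 * cosh (l/2))\<^sup>2 - 4) = ((exp l + 1) / (exp l - 1))\<^sup>2"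
proof -
  define E where "E = exp (l/2)"
  have E: "E > 1" "exp l = E * E" using assms by (simp_all add: E_def flip: exp_add)
  have E1: "1 / E < 1" using E by simp
  have c: "2 * cosh (l/2) = E + 1 / E" by (simp add: cosh_def E_def exp_minus inverse_eq_divide)
  have sq: "(E + 1 / E)\<^sup>2 - 4 = (E - 1 / E)\<^sup>2" using E by (simp add: power2_eq_square field_simps)
  have "E - 1 / E > 0" using E E1 by linarith
  then have "sqrt ((E - 1 / E)\<^sup>2) = E - 1 / E" by (simp only: real_sqrt_abs abs_of_pos)
  then show "mu (2 * cosh (l/2)) = exp (l/2)" unfolding mu_def c sq by (simp add: E_def)
  have "E + 1 / E = (E * E + 1) / E" "E - 1 / E = (E * E - 1) / E" using E by (simp_all add: field_simps)
  then have "(E + 1 / E) / (E - 1 / E) = (E * E + 1) / (E * E - 1)" using E by simp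
  then show "(2 * cosh (l/2))\<^sup>2 / ((2 * cosh (l/2))\<^sup>2 - 4) = ((exp l + 1) / (exp l - 1))\<^sup>2"
    unfolding c sq E(2) power_divide[symmetric] by simp
qed

lemma exp_log_factor: "t > 2 \<Longrightarrow> exp (real n * log_factor t) = (t\<^sup>2 / (t\<^sup>2 - 4)) ^ n"
proof -
  assume t: "t > 2"
  then have "t\<^sup>2 / (t\<^sup>2 - 4) > 0" using power_strict_mono[of 2 t 2] by simp
  then show ?thesis by (simp add: exp_of_nat_mult log_factor_def)
qed

lemma has_prod_over_exp:
  assumes "(f has_sum s) S" "\<And>y. y \<in> S \<Longrightarrow> g y = exp (f y)"
  shows "has_prod_over g S (exp s)"
proof -
  have "((\<lambda>F. exp (sum f F)) \<longlongrightarrow> exp s) (finite_subsets_at_top S)"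
    using assms(1) unfolding has_sum_def by (rule tendsto_exp)
  moreover have "\<forall>\<^sub>F F in finite_subsets_at_top S. exp (sum f F) = prod g F"
  proof (rule eventually_finite_subsets_at_top_weakI)
    fix F assume F: "finite F" "F \<subseteq> S"
    have "prod g F = (\<Prod>y\<in>F. exp (f y))" using F assms(2) by (intro prod.cong) auto
    then show "exp (sum f F) = prod g F" using F(1) by (simp add: exp_sum)
  qed
  ultimately show ?thesis unfolding has_prod_over_def by (rule Lim_transform_eventually)
qed

context marked_torus
begin

lemma trace_geod:
  assumes "simple_elt g" "trace g > 2"
  shows "geod_trace G (geod_of G g) = trace g"
  using simple_elt_length(2)[OF assms] by (simp add: geod_trace_def)

lemma edge_traces: "edge (trace A) (trace B) (trace (A ** B))"
  using basis by (simp add: edge_def torus_basis_def)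

text \<open>The logarithm of the product formula: the sums over the three sectors and the relation at the
  initial vertex add up.\<close>

lemma log_formula:
  "((\<lambda>C. real (height A B C) * log_factor (geod_trace G C)) has_sum
    (ln (mu (trace B)) + ln (mu (trace (A ** B))) + ln (mu (trace A)))) (simple_closed_geodesics G)"
proof -
  let ?f = "\<lambda>C. real (height A B C) * log_factor (geod_trace G C)"
  define a b c where "a = trace B" and "b = trace (A ** B)" and "c = trace A"
  have tr: "a > 2" "b > 2" "c > 2" using basis by (auto simp: torus_basis_def a_def b_def c_def)
  have e: "edge c a b" using edge_traces by (simp add: a_def b_def c_def)
  have es: "edge c b a" "edge a b c" "edge a c b" "edge c b (c * b - a)" "edge b a (b * a - c)" "edge a c (a * c - b)"
    using e edge_moves[of c a b] edge_moves[of a c b] by (auto simp: edge_def mult_ac add_ac)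
  note mv = torus_basis_moves[OF basis] and ts = torus_basis_traces[OF basis]
  have fA: "?f (geod_of G A) = log_factor c" and fB: "?f (geod_of G B) = log_factor a"
    using trace_geod[OF simples(1)] trace_geod[OF simples(2)] tr heights(1,2) by (simp_all add: a_def c_def)
  have wt1: "region_height 1 1 p = real (m + n)" if "stern_brocot p = (m, n)" for p m n using that by (simp add: region_height_def)
  have plus: "?f (geo_plus q) = real (height A B (geo_plus q)) * log_factor (trace (region_mat A B q))" for q
    unfolding geo_plus_def trace_geod[OF simples(3) conjunct2[OF trace_region_mat[OF basis]]] ..
  have f0: "?f (geo_plus []) = log_factor b" unfolding plus by (simp add: heights b_def)
  have fT: "?f (geo_plus (True # p)) = region_term 1 1 c b (c * b - a) p" for p
  proof -
    obtain m n where mn: "stern_brocot p = (m, n)" by force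
    show ?thesis unfolding plus unfolding heights(4)[OF mn] using trace_region_mat[OF mv(1), of p]
      by (simp add: region_term_def wt1[OF mn] ts a_def b_def c_def)
  qed
  have fF: "?f (geo_plus (False # p)) = region_term 1 1 b a (b * a - c) p" for p
  proof -
    obtain m n where mn: "stern_brocot p = (m, n)" by force
    show ?thesis unfolding plus unfolding heights(4)[OF mn] using trace_region_mat[OF mv(2), of p]
      by (simp add: region_term_def wt1[OF mn] ts a_def b_def c_def)
  qed
  have fM: "?f (geo_minus p) = region_term 1 1 a c (a * c - b) p" for p
  proof -
    obtain m n where mn: "stern_brocot p = (m, n)" by force
    have "trace (matrix_inv A) = c" by (simp add: trace_matrix_inv dets c_def)
    then have "trace (region_mat B (matrix_inv A) p) = region_trace a c (a * c - b) p" "trace (region_mat B (matrix_inv A) p) > 2"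
      using trace_region_mat[OF mv(3), of p] by (simp_all add: ts a_def b_def c_def mult.commute)
    then show ?thesis using trace_geod[OF simples(4)[of p]] heights(5)[OF mn]
      by (simp add: geo_minus_def region_term_def wt1[OF mn])
  qed
  have "((\<lambda>q. ?f (geo_plus q)) has_sum (?f (geo_plus []) + sector_value 1 1 c b (c * b - a) + sector_value 1 1 b a (b * a - c))) UNIV"
    by (rule has_sum_Cons) (unfold fT fF, use sector_sum es in auto)
  then have P: "(?f has_sum (log_factor b + sector_value 1 1 c b (c * b - a) + sector_value 1 1 b a (b * a - c))) (range geo_plus)"
    using geodesics_distinct(1) unfolding f0 by (simp add: has_sum_reindex o_def)
  have "((\<lambda>q. ?f (geo_minus q)) has_sum sector_value 1 1 a c (a * c - b)) UNIV"
    unfolding fM using sector_sum es by auto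
  then have M: "(?f has_sum sector_value 1 1 a c (a * c - b)) (range geo_minus)"
    using geodesics_distinct(2) by (simp add: has_sum_reindex o_def)
  have AB: "(?f has_sum (log_factor c + log_factor a)) {geod_of G A, geod_of G B}"
    by (rule has_sum_finiteI) (use fA fB geodesics_distinct(4) in auto)
  have AP: "(?f has_sum ((log_factor c + log_factor a) + (log_factor b + sector_value 1 1 c b (c * b - a) + sector_value 1 1 b a (b * a - c))))
      ({geod_of G A, geod_of G B} \<union> range geo_plus)"
    by (rule has_sum_Un_disjoint[OF AB P]) (use geodesics_distinct(5,6) in blast)
  have "(?f has_sum ((log_factor c + log_factor a) + (log_factor b + sector_value 1 1 c b (c * b - a) + sector_value 1 1 b a (b * a - c)) + sector_value 1 1 a c (a * c - b)))
      (simple_closed_geodesics G)"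
    unfolding geodesics_enum
    by (rule has_sum_Un_disjoint[OF AP M]) (use geodesics_distinct(3,7,8) in blast)
  moreover have "(log_factor c + log_factor a) + (log_factor b + sector_value 1 1 c b (c * b - a) + sector_value 1 1 b a (b * a - c)) + sector_value 1 1 a c (a * c - b)
      = ln (mu a) + ln (mu b) + ln (mu c)"
    using vertex_relation[OF e] vertex_relation[OF es(1)] vertex_relation[OF es(2)]
    by (simp add: sector_value_def mult.commute)
  ultimately show ?thesis by (simp add: a_def b_def c_def)
qed

lemma geodesic_data:
  assumes "C \<in> simple_closed_geodesics G"
  shows "geod_length G C > 0" "geod_trace G C > 2"
proof -
  have "\<exists>g. simple_elt g \<and> trace g > 2 \<and> C = geod_of G g"
    using assms simples basis trace_region_mat[OF basis] trace_region_mat[OF torus_basis_moves(3)[OF basis]]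
    unfolding geodesics_enum geo_plus_def geo_minus_def torus_basis_def by blast
  then obtain g where g: "simple_elt g" "trace g > 2" "C = geod_of G g" by blast
  show "geod_length G C > 0" "geod_trace G C > 2"
    using simple_elt_length(1)[OF g(1,2)] trace_geod[OF g(1,2)] g by simp_all
qed

lemma product_formula:
  "has_prod_over (\<lambda>C. ((geod_trace G C)\<^sup>2 / ((geod_trace G C)\<^sup>2 - 4)) ^ height A B C)
    (simple_closed_geodesics G) (mu (trace B) * mu (trace (A ** B)) * mu (trace A))"
proof -
  have "has_prod_over (\<lambda>C. ((geod_trace G C)\<^sup>2 / ((geod_trace G C)\<^sup>2 - 4)) ^ height A B C)
    (simple_closed_geodesics G) (exp (ln (mu (trace B)) + ln (mu (trace (A ** B))) + ln (mu (trace A))))"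
    by (rule has_prod_over_exp[OF log_formula]) (simp add: exp_log_factor geodesic_data)
  moreover have "mu (trace B) > 0" "mu (trace (A ** B)) > 0" "mu (trace A) > 0"
    using mu_facts(1) basis by (auto simp: torus_basis_def intro: less_trans[OF zero_less_one])
  ultimately show ?thesis by (simp add: exp_add)
qed

end

theorem mainTheorem1:
  fixes a b c :: real and A B :: "real^2^2"
    and G :: "(real^2^2) set" and \<gamma>\<^sub>1 \<gamma>\<^sub>2 \<gamma>\<^sub>3 :: "complex set set"
  assumes "a > 2" and "b > 2" and "c > 2"
    and "a^2 + b^2 + c^2 = a * b * c"
    and "marked_punctured_torus A B"
    and "trace B = a" and "trace (A ** B) = b" and "trace A = c"
    and "G = gen_group A B"
    and "\<gamma>\<^sub>1 = geod_of G B" and "\<gamma>\<^sub>2 = geod_of G (A ** B)" and "\<gamma>\<^sub>3 = geod_of G A"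
  shows "\<gamma>\<^sub>1 \<in> simple_closed_geodesics G \<and> \<gamma>\<^sub>2 \<in> simple_closed_geodesics G \<and>
           \<gamma>\<^sub>3 \<in> simple_closed_geodesics G \<and>
         card (\<gamma>\<^sub>1 \<inter> \<gamma>\<^sub>2) = 1 \<and> card (\<gamma>\<^sub>2 \<inter> \<gamma>\<^sub>3) = 1 \<and> card (\<gamma>\<^sub>1 \<inter> \<gamma>\<^sub>3) = 1 \<and>
         geod_trace G \<gamma>\<^sub>1 = a \<and> geod_trace G \<gamma>\<^sub>2 = b \<and> geod_trace G \<gamma>\<^sub>3 = c \<and>
         (has_prod_over
           (\<lambda>\<gamma>. ((geod_trace G \<gamma>)^2 / ((geod_trace G \<gamma>)^2 - 4)) ^ height A B \<gamma>)
           (simple_closed_geodesics G)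
           ((a + sqrt (a^2 - 4)) / 2 * ((b + sqrt (b^2 - 4)) / 2) * ((c + sqrt (c^2 - 4)) / 2))) \<and>
         (has_prod_over
           (\<lambda>\<gamma>. ((exp (geod_length G \<gamma>) + 1) / (exp (geod_length G \<gamma>) - 1)) ^ (2 * height A B \<gamma>))
           (simple_closed_geodesics G)
           (exp ((geod_length G \<gamma>\<^sub>1 + geod_length G \<gamma>\<^sub>2 + geod_length G \<gamma>\<^sub>3) / 2)))"
proof -
  have d: "det A = 1" "det B = 1" and free: "free_on A B"
    using assms(5) by (auto simp: marked_punctured_torus_def)
  have basis: "torus_basis A B"
    using assms d unfolding torus_basis_def by (simp add: mult_ac add_ac)
  interpret marked_torus A B by (rule marked_torus.intro[OF basis free])
  note G = assms(9) and g = assms(10-12)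
  have sAB: "simple_elt (A ** B)" using basis_simple(3)[OF basis] .
  have simp: "\<gamma>\<^sub>1 \<in> simple_closed_geodesics G" "\<gamma>\<^sub>2 \<in> simple_closed_geodesics G" "\<gamma>\<^sub>3 \<in> simple_closed_geodesics G"
    unfolding g G simple_closed_geodesics_eq using simples(1,2) sAB by blast+
  have "card (geod_of G A \<inter> geod_of G B) = 1" "card (geod_of G A \<inter> geod_of G (A ** B)) = 1"
    "card (geod_of G (A ** B) \<inter> geod_of G B) = 1"
    using basis_simple(4)[OF basis] basis_simple(4)[OF torus_basis_moves(1)[OF basis]]
      basis_simple(4)[OF torus_basis_moves(2)[OF basis]]
    unfolding gen_group_moves[OF basis] G by auto
  then have meet: "card (\<gamma>\<^sub>1 \<inter> \<gamma>\<^sub>2) = 1" "card (\<gamma>\<^sub>2 \<inter> \<gamma>\<^sub>3) = 1" "card (\<gamma>\<^sub>1 \<inter> \<gamma>\<^sub>3) = 1"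
    unfolding g by (simp_all add: Int_commute)
  have tr: "geod_trace G \<gamma>\<^sub>1 = a" "geod_trace G \<gamma>\<^sub>2 = b" "geod_trace G \<gamma>\<^sub>3 = c"
    unfolding g G using trace_geod[OF simples(2)] trace_geod[OF sAB] trace_geod[OF simples(1)] assms by auto
  have p1: "has_prod_over (\<lambda>\<gamma>. ((geod_trace G \<gamma>)^2 / ((geod_trace G \<gamma>)^2 - 4)) ^ height A B \<gamma>)
      (simple_closed_geodesics G) (mu a * mu b * mu c)"
    using product_formula unfolding assms(6-8) G .
  have mu_len: "mu (geod_trace G C) = exp (geod_length G C / 2)"
    "(geod_trace G C)\<^sup>2 / ((geod_trace G C)\<^sup>2 - 4) = ((exp (geod_length G C) + 1) / (exp (geod_length G C) - 1))\<^sup>2"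
    if "C \<in> simple_closed_geodesics G" for C
    using mu_cosh[OF geodesic_data(1)[OF that[unfolded G]]] unfolding geod_trace_def G by auto
  have "mu a * mu b * mu c = exp ((geod_length G \<gamma>\<^sub>1 + geod_length G \<gamma>\<^sub>2 + geod_length G \<gamma>\<^sub>3) / 2)"
    using mu_len(1)[OF simp(1)] mu_len(1)[OF simp(2)] mu_len(1)[OF simp(3)] unfolding tr
    by (simp add: add_divide_distrib exp_add)
  moreover have "has_prod_over (\<lambda>\<gamma>. ((exp (geod_length G \<gamma>) + 1) / (exp (geod_length G \<gamma>) - 1)) ^ (2 * height A B \<gamma>))
      (simple_closed_geodesics G) (mu a * mu b * mu c)"
  proof -
    have "prod (\<lambda>\<gamma>. ((exp (geod_length G \<gamma>) + 1) / (exp (geod_length G \<gamma>) - 1)) ^ (2 * height A B \<gamma>)) F =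
        prod (\<lambda>\<gamma>. ((geod_trace G \<gamma>)^2 / ((geod_trace G \<gamma>)^2 - 4)) ^ height A B \<gamma>) F"
      if "F \<subseteq> simple_closed_geodesics G" for F
      using that by (intro prod.cong refl) (simp add: mu_len(2) subsetD power_mult)
    then have "\<forall>\<^sub>F F in finite_subsets_at_top (simple_closed_geodesics G).
        prod (\<lambda>\<gamma>. ((geod_trace G \<gamma>)^2 / ((geod_trace G \<gamma>)^2 - 4)) ^ height A B \<gamma>) F =
        prod (\<lambda>\<gamma>. ((exp (geod_length G \<gamma>) + 1) / (exp (geod_length G \<gamma>) - 1)) ^ (2 * height A B \<gamma>)) F"
      by (intro eventually_finite_subsets_at_top_weakI) simp
    with p1 show ?thesis unfolding has_prod_over_def by (rule Lim_transform_eventually)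
  qed
  ultimately show ?thesis using simp meet tr p1 unfolding mu_def by simp
qed

end
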